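(* There exists a (small) constant $C_0>0$, depending only on the equation (that is, on $m$ and the coefficients $\alpha_k,\beta_k$ of the nonlinear terms), such that the following holds. Suppose that $(u_{0k},v_{0k})\in H^1(\mathbb{R})$ with $\|u_{0k}\|_{L^2(\mathbb{R})}^2+\|v_{0k}\|_{L^2(\mathbb{R})}^2\le C_0$ for all integers $1\le k<\infty$, and that $$\|u_{0k}-u_{0\infty}\|_{L^2(\mathbb{R})}+\|v_{0k}-v_{0\infty}\|_{L^2(\mathbb{R})}\to 0\quad\text{as }k\to\infty$$ for some $(u_{0\infty},v_{0\infty})\in L^2(\mathbb{R})$. For $1\le k<\infty$ let $(u_k,v_k)$ be the classical solution of $$i(u_t+u_x)=-mv+N_1(u,v),\qquad i(v_t-v_x)=-mu+N_2(u,v)\qquad(\ast)$$ taking $(u_{0k},v_{0k})$ as its initial data at $t=0$. Then there exists a weak solution $(u_\infty,v_\infty)\in C([0,+\infty);L^2(\mathbb{R}))$ of $(\ast)$ such that, for every $T\ge 0$, $$\|u_k-u_\infty\|_{C([0,T];L^2(\mathbb{R}))}+\|v_k-v_\infty\|_{C([0,T];L^2(\mathbb{R}))}\to 0\quad\text{as }k\to\infty.$$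
   Context: The unknowns $u,v$ are complex-valued functions of $(t,x)$, $t\ge 0$, $x\in\mathbb{R}$, and $m\ge 0$ is a constant. $\Re Z$ denotes the real part of $Z\in\mathbb{C}$. The nonlinear terms $N_1,N_2$ are fixed and satisfy: (A1) $N_1(u,v)=(\alpha_1u+\alpha_2\overline{u})(\alpha_3|v|^2+\alpha_4v^2+\alpha_5\overline{v}^2)$ and $N_2(u,v)=(\beta_1v+\beta_2\overline{v})(\beta_3|u|^2+\beta_4u^2+\beta_5\overline{u}^2)$, where $\alpha_k,\beta_k$ ($k=1,\dots,5$) are (complex) constants; (A2) for all $(u,v)\in\mathbb{C}^2$, $\Re\big(i\overline{u}N_1(u,v)+i\overline{v}N_2(u,v)\big)=0$. For initial data in $H^1(\mathbb{R})$ with $\|u_0\|_{L^2}^2+\|v_0\|_{L^2}^2\le C_0$, "the classical solution" is the unique global solution in $C([0,\infty);H^1(\mathbb{R}))\cap C^1([0,\infty);L^2(\mathbb{R}))$ (which exists for $C_0$ small). A weak solution of $(\ast)$ is a pair $(u,v)\in C([0,\infty);L^2(\mathbb{R}))$ such that $N_1(u,v),N_2(u,v)$ are locally integrable on $(0,\infty)\times\mathbb{R}$ and $(\ast)$ holds in the sense of distributions on $(0,\infty)\times\mathbb{R}$. *)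

theory Defs
  imports "HOL-Analysis.Analysis"
begin

section \<open>Test functions\<close>

primrec Ck :: "nat \<Rightarrow> ('a::euclidean_space \<Rightarrow> 'b::real_normed_vector) \<Rightarrow> bool" where
  "Ck 0 f \<longleftrightarrow> continuous_on UNIV f"
| "Ck (Suc n) f \<longleftrightarrow>
     (\<forall>x. f differentiable (at x)) \<and> (\<forall>b\<in>Basis. Ck n (\<lambda>x. frechet_derivative f (at x) b))"

definition test_functions :: "'a::euclidean_space set \<Rightarrow> ('a \<Rightarrow> complex) set" where
  "test_functions \<Omega> =
     {\<phi>. (\<forall>n. Ck n \<phi>) \<and> compact (closure {x. \<phi> x \<noteq> 0}) \<and> closure {x. \<phi> x \<noteq> 0} \<subseteq> \<Omega>}"

definition locally_integrable_on :: "('a::euclidean_space \<Rightarrow> complex) \<Rightarrow> 'a set \<Rightarrow> bool" where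
  "locally_integrable_on f \<Omega> \<longleftrightarrow>
     (\<forall>K. compact K \<and> K \<subseteq> \<Omega> \<longrightarrow> f absolutely_integrable_on K)"

section \<open>The spaces \<open>L\<^sup>2(\<real>)\<close> and \<open>H\<^sup>1(\<real>)\<close>\<close>

text \<open>Elements of these spaces are represented by functions; functions that agree almost
  everywhere represent the same element.\<close>

definition L2 :: "(real \<Rightarrow> complex) set" where
  "L2 = {f. f \<in> borel_measurable lebesgue \<and> integrable lebesgue (\<lambda>x. (cmod (f x))\<^sup>2)}"

definition L2_norm :: "(real \<Rightarrow> complex) \<Rightarrow> real" where
  "L2_norm f = sqrt (\<integral>x. (cmod (f x))\<^sup>2 \<partial>lebesgue)"

definition has_weak_deriv :: "(real \<Rightarrow> complex) \<Rightarrow> (real \<Rightarrow> complex) \<Rightarrow> bool" where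
  "has_weak_deriv f g \<longleftrightarrow>
     (\<forall>\<phi>\<in>test_functions UNIV.
        (\<integral>x. f x * vector_derivative \<phi> (at x) \<partial>lebesgue) = - (\<integral>x. g x * \<phi> x \<partial>lebesgue))"

definition H1 :: "(real \<Rightarrow> complex) set" where
  "H1 = {f \<in> L2. \<exists>g\<in>L2. has_weak_deriv f g}"

text \<open>The choice is unique up to null sets, so for \<open>f\<close> in \<open>H1\<close> norms and almost-everywhere
  statements involving \<open>weak_deriv f\<close> do not depend on it.\<close>

definition weak_deriv :: "(real \<Rightarrow> complex) \<Rightarrow> real \<Rightarrow> complex" where
  "weak_deriv f = (SOME g. g \<in> L2 \<and> has_weak_deriv f g)"

definition H1_norm :: "(real \<Rightarrow> complex) \<Rightarrow> real" where
  "H1_norm f = sqrt ((L2_norm f)\<^sup>2 + (L2_norm (weak_deriv f))\<^sup>2)"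

section \<open>Functions of time with values in \<open>L\<^sup>2(\<real>)\<close> or \<open>H\<^sup>1(\<real>)\<close>\<close>

text \<open>A function of \<open>(t, x)\<close> is curried, with time as the first argument; its values at
  negative times are irrelevant throughout.\<close>

definition cont_time ::
    "(real \<Rightarrow> complex) set \<Rightarrow> ((real \<Rightarrow> complex) \<Rightarrow> real) \<Rightarrow> (real \<Rightarrow> real \<Rightarrow> complex) set" where
  "cont_time X N =
     {u. \<forall>t\<ge>0. u t \<in> X \<and> ((\<lambda>s. N (\<lambda>x. u s x - u t x)) \<longlongrightarrow> 0) (at t within {0..})}"

definition has_L2_time_deriv ::
    "(real \<Rightarrow> real \<Rightarrow> complex) \<Rightarrow> (real \<Rightarrow> real \<Rightarrow> complex) \<Rightarrow> bool" where
  "has_L2_time_deriv u w \<longleftrightarrow>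
     (\<forall>t\<ge>0. u t \<in> L2 \<and> w t \<in> L2 \<and>
        ((\<lambda>s. L2_norm (\<lambda>x. (u s x - u t x) / of_real (s - t) - w t x)) \<longlongrightarrow> 0)
          (at t within {0..}))"

definition C_L2_norm :: "real \<Rightarrow> (real \<Rightarrow> real \<Rightarrow> complex) \<Rightarrow> real" where
  "C_L2_norm T w = (SUP t\<in>{0..T}. L2_norm (w t))"

section \<open>The equation and its solutions\<close>

text \<open>Only the coefficients with indices 1 to 5 are used.\<close>

definition N1 :: "(nat \<Rightarrow> complex) \<Rightarrow> complex \<Rightarrow> complex \<Rightarrow> complex" where
  "N1 \<alpha> u v = (\<alpha> 1 * u + \<alpha> 2 * cnj u) *
     (\<alpha> 3 * of_real ((cmod v)\<^sup>2) + \<alpha> 4 * v\<^sup>2 + \<alpha> 5 * (cnj v)\<^sup>2)"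

definition N2 :: "(nat \<Rightarrow> complex) \<Rightarrow> complex \<Rightarrow> complex \<Rightarrow> complex" where
  "N2 \<beta> u v = (\<beta> 1 * v + \<beta> 2 * cnj v) *
     (\<beta> 3 * of_real ((cmod u)\<^sup>2) + \<beta> 4 * u\<^sup>2 + \<beta> 5 * (cnj u)\<^sup>2)"

text \<open>A solution in \<open>C([0,\<infinity>);H\<^sup>1) \<inter> C\<^sup>1([0,\<infinity>);L\<^sup>2)\<close>: the equation is an identity in
  \<open>L\<^sup>2(\<real>)\<close> at each time, with \<open>u\<^sub>t\<close> the derivative of the \<open>L\<^sup>2\<close>-valued map and \<open>u\<^sub>x\<close> the weak
  derivative in space.\<close>

definition classical_solution ::
    "real \<Rightarrow> (nat \<Rightarrow> complex) \<Rightarrow> (nat \<Rightarrow> complex) \<Rightarrow> (real \<Rightarrow> complex) \<Rightarrow> (real \<Rightarrow> complex) \<Rightarrow>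
     (real \<Rightarrow> real \<Rightarrow> complex) \<Rightarrow> (real \<Rightarrow> real \<Rightarrow> complex) \<Rightarrow> bool" where
  "classical_solution m \<alpha> \<beta> u0 v0 u v \<longleftrightarrow>
     u \<in> cont_time H1 H1_norm \<and> v \<in> cont_time H1 H1_norm \<and>
     (\<exists>ut\<in>cont_time L2 L2_norm. \<exists>vt\<in>cont_time L2 L2_norm.
        has_L2_time_deriv u ut \<and> has_L2_time_deriv v vt \<and>
        (\<forall>t\<ge>0.
          (AE x in lebesgue. \<i> * (ut t x + weak_deriv (u t) x)
             = - of_real m * v t x + N1 \<alpha> (u t x) (v t x)) \<and>
          (AE x in lebesgue. \<i> * (vt t x - weak_deriv (v t) x)
             = - of_real m * u t x + N2 \<beta> (u t x) (v t x)))) \<and>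
     (AE x in lebesgue. u 0 x = u0 x) \<and> (AE x in lebesgue. v 0 x = v0 x)"

definition half_plane :: "(real \<times> real) set" where
  "half_plane = {0<..} \<times> UNIV"

definition deriv_t :: "(real \<times> real \<Rightarrow> complex) \<Rightarrow> real \<times> real \<Rightarrow> complex" where
  "deriv_t \<phi> p = frechet_derivative \<phi> (at p) (1, 0)"

definition deriv_x :: "(real \<times> real \<Rightarrow> complex) \<Rightarrow> real \<times> real \<Rightarrow> complex" where
  "deriv_x \<phi> p = frechet_derivative \<phi> (at p) (0, 1)"

text \<open>Joint measurability singles out representatives of the \<open>L\<^sup>2\<close>-valued maps \<open>u\<close> and \<open>v\<close> that
  are functions on the half plane; together with continuity in \<open>L\<^sup>2\<close> it makes \<open>u\<close> and \<open>v\<close>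
  locally integrable there, hence distributions. In the two identities all derivatives have been
  moved to the test function.\<close>

definition weak_solution ::
    "real \<Rightarrow> (nat \<Rightarrow> complex) \<Rightarrow> (nat \<Rightarrow> complex) \<Rightarrow>
     (real \<Rightarrow> real \<Rightarrow> complex) \<Rightarrow> (real \<Rightarrow> real \<Rightarrow> complex) \<Rightarrow> bool" where
  "weak_solution m \<alpha> \<beta> u v \<longleftrightarrow>
     u \<in> cont_time L2 L2_norm \<and> v \<in> cont_time L2 L2_norm \<and>
     (\<lambda>(t, x). u t x) \<in> borel_measurable (lebesgue_on half_plane) \<and>
     (\<lambda>(t, x). v t x) \<in> borel_measurable (lebesgue_on half_plane) \<and>
     locally_integrable_on (\<lambda>(t, x). N1 \<alpha> (u t x) (v t x)) half_plane \<and>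
     locally_integrable_on (\<lambda>(t, x). N2 \<beta> (u t x) (v t x)) half_plane \<and>
     (\<forall>\<phi>\<in>test_functions half_plane.
        (LINT (t, x):half_plane|lebesgue. - \<i> * u t x * (deriv_t \<phi> (t, x) + deriv_x \<phi> (t, x)))
          = (LINT (t, x):half_plane|lebesgue.
               (- of_real m * v t x + N1 \<alpha> (u t x) (v t x)) * \<phi> (t, x)) \<and>
        (LINT (t, x):half_plane|lebesgue. - \<i> * v t x * (deriv_t \<phi> (t, x) - deriv_x \<phi> (t, x)))
          = (LINT (t, x):half_plane|lebesgue.
               (- of_real m * u t x + N2 \<beta> (u t x) (v t x)) * \<phi> (t, x)))"

end

theory Submission
  imports Defs "HOL-Computational_Algebra.Polynomial"
begin

text \<open>Along the lines \<open>x + t = const\<close> and \<open>x - t = const\<close> the system is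
  a pair of ordinary differential equations: \<open>u\<close> is carried to the right and
  changes at the rate \<open>i m v - i N1(u, v)\<close>, \<open>v\<close> is carried to the
  left and changes at the rate \<open>i m u - i N2(u, v)\<close>. The proof compares two
  solutions along these lines by means of an envelope. If \<open>u\<close> changes at the rate
  \<open>g\<close>, put \<open>A(x) = |u(0, x)| + \<integral> |g(s, x + s)| ds\<close>,
  integrated over a window \<open>0 \<le> s \<le> T\<close>. Then \<open>A(x)\<close>
  dominates \<open>|u|\<close> on the whole characteristic segment that starts at
  \<open>x\<close>, and \<open>L\<^sup>2\<close> norms of envelopes control
  \<open>L\<^sup>2\<close> norms of the solution at every time of the window.

  The nonlinearity is cubic, but each term of \<open>N1\<close> has one factor
  \<open>u\<close>, which lives on the line of integration, and two factors \<open>v\<close>,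
  which cross that line. If \<open>B\<close> is the envelope of \<open>v\<close>, then
  \<open>|v(s, x + s)| \<le> B(x + 2 s)\<close>, whence \<open>\<integral> |v(s, x +
  s)|\<^sup>2 ds\<close> is at most half the integral of \<open>B\<^sup>2\<close>, uniformly
  in \<open>x\<close>. The cubic term therefore contributes at most \<open>A(x)\<close> times
  a small quantity as soon as the envelopes are small in \<open>L\<^sup>2\<close>; the mass
  term gains a factor \<open>T\<close>. So on a short window the envelope of the difference of
  two solutions is bounded in \<open>L\<^sup>2\<close> by the difference of the initial data
  (\<open>envelope_estimate\<close>, \<open>window_stability\<close>). Comparison with the
  zero solution and continuity in the length of the window show that the envelopes are small
  whenever the data are (\<open>a_priori_envelope\<close>).

  The assumed identity for \<open>N1\<close> and \<open>N2\<close> makes the charge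
  \<open>\<parallel>u(t)\<parallel>\<^sup>2 + \<parallel>v(t)\<parallel>\<^sup>2\<close>
  constant in time (\<open>charge_conservation\<close>), so the same estimate applies on each
  of the windows \<open>[n T, (n + 1) T]\<close>, and the squared \<open>L\<^sup>2\<close>
  distance of two solutions grows at most by a fixed factor per window
  (\<open>deviation_growth\<close>). Convergence of the initial data thus makes the solutions
  a Cauchy sequence in \<open>C([0, T]; L\<^sup>2)\<close> for every \<open>T\<close>. The
  same envelopes bound the differences of the nonlinear terms in \<open>L\<^sup>1\<close> of
  bounded boxes, so the nonlinear terms converge there as well
  (\<open>characteristic_limit\<close>), and the weak form of the equation, obtained for the
  approximations by integration along characteristics, passes to the limit
  (\<open>weak_equation_limit\<close>, \<open>weak_solution_of_limit\<close>).

  A classical solution is given only through \<open>L\<^sup>2\<close>- and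
  \<open>H\<^sup>1\<close>-valued maps. Before any of this applies, it is replaced by a
  jointly continuous representative that satisfies the ordinary differential equations on
  every characteristic. The representative comes from the one-dimensional Sobolev embedding,
  and the equations come from testing with smooth bumps that move along with the
  characteristics (\<open>classical_solution_has_characteristic_representative\<close>).\<close>

section \<open>Smooth functions and bumps on the line\<close>

text \<open>On the real line the only basis vector is 1, so the recursive description of smoothness is a
  statement about the ordinary derivative.\<close>
lemma Ck_Suc_if_has_vector_derivative:
  fixes f :: "real \<Rightarrow> 'b::real_normed_vector"
  assumes "\<And>x. (f has_vector_derivative f' x) (at x)"
  shows "Ck (Suc n) f \<longleftrightarrow> Ck n f'"
proof -
  have "frechet_derivative f (at x) 1 = f' x" for x
    using frechet_derivative_at[OF assms[of x, unfolded has_vector_derivative_def]]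
    by (metis scaleR_one)
  moreover have "f differentiable (at x)" for x
    using assms[of x] by (auto simp: has_vector_derivative_def differentiable_def)
  ultimately show ?thesis by simp
qed

lemmas Ck_SucI = Ck_Suc_if_has_vector_derivative[THEN iffD2]

lemma Ck_Suc_E:
  fixes f :: "real \<Rightarrow> 'b::real_normed_vector"
  assumes "Ck (Suc n) f"
  obtains f' where "\<And>x. (f has_vector_derivative f' x) (at x)" "Ck n f'"
proof -
  have *: "(f has_vector_derivative vector_derivative f (at x)) (at x)" for x
    using assms vector_derivative_works by auto
  show ?thesis
    by (rule that[OF *]) (rule Ck_Suc_if_has_vector_derivative[THEN iffD1, OF * assms])
qed

lemma Ck_imp_continuous:
  fixes f :: "real \<Rightarrow> 'b::real_normed_vector"
  assumes "Ck n f" shows "continuous_on UNIV f"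
  using assms by (cases n) (auto simp: continuous_on_eq_continuous_within differentiable_imp_continuous_within)

lemma Ck_Suc_imp_Ck:
  fixes f :: "real \<Rightarrow> 'b::real_normed_vector"
  shows "Ck (Suc n) f \<Longrightarrow> Ck n f"
proof (induction n arbitrary: f)
  case 0 thus ?case using Ck_imp_continuous Ck.simps(1) by blast
next
  case (Suc n)
  obtain f' where "\<And>x. (f has_vector_derivative f' x) (at x)" "Ck (Suc n) f'"
    using Suc.prems by (metis Ck_Suc_E)
  thus ?case using Suc.IH Ck_SucI by blast
qed

lemma Ck_add:
  fixes f g :: "real \<Rightarrow> 'b::real_normed_vector"
  shows "Ck n f \<Longrightarrow> Ck n g \<Longrightarrow> Ck n (\<lambda>x. f x + g x)"
proof (induction n arbitrary: f g)
  case 0 thus ?case by (auto intro: continuous_intros)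
next
  case (Suc n)
  obtain f' g' where "\<And>x. (f has_vector_derivative f' x) (at x)" "Ck n f'"
      "\<And>x. (g has_vector_derivative g' x) (at x)" "Ck n g'"
    using Suc.prems by (metis Ck_Suc_E)
  thus ?case
    by (intro Ck_SucI[where f' = "\<lambda>x. f' x + g' x"] Suc.IH derivative_intros)
qed

lemma Ck_mult:
  fixes f g :: "real \<Rightarrow> 'b::real_normed_algebra"
  shows "Ck n f \<Longrightarrow> Ck n g \<Longrightarrow> Ck n (\<lambda>x. f x * g x)"
proof (induction n arbitrary: f g)
  case 0 thus ?case by (auto intro: continuous_intros)
next
  case (Suc n)
  obtain f' g' where D: "\<And>x. (f has_vector_derivative f' x) (at x)" "Ck n f'"
      "\<And>x. (g has_vector_derivative g' x) (at x)" "Ck n g'"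
    using Suc.prems by (metis Ck_Suc_E)
  have "Ck n (\<lambda>x. f x * g' x + f' x * g x)"
    using Suc Ck_Suc_imp_Ck D by (intro Ck_add Suc.IH) auto
  with has_vector_derivative_mult[OF D(1) D(3)] show ?case by (rule Ck_SucI)
qed

lemma Ck_const:
  fixes c :: "'b::real_normed_vector"
  shows "Ck n (\<lambda>x::real. c)"
proof (induction n arbitrary: c)
  case (Suc n)
  thus ?case by (intro Ck_SucI[where f' = "\<lambda>x. 0"]) (auto intro!: derivative_eq_intros)
qed simp

lemma Ck_affine:
  fixes f :: "real \<Rightarrow> 'b::real_normed_algebra_1"
  shows "Ck n f \<Longrightarrow> Ck n (\<lambda>x. f (a * x + b))"
proof (induction n arbitrary: f)
  case 0 thus ?case by (auto intro!: continuous_intros intro: continuous_on_compose2)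
next
  case (Suc n)
  obtain f' where D: "\<And>x. (f has_vector_derivative f' x) (at x)" "Ck n f'"
    using Suc.prems by (metis Ck_Suc_E)
  have "((\<lambda>x. f (a * x + b)) has_vector_derivative of_real a * f' (a * x + b)) (at x)" for x
    using vector_diff_chain_at[of "\<lambda>x. a * x + b" a x f "f' (a * x + b)"] D(1)
    by (force intro!: derivative_eq_intros simp: o_def scaleR_conv_of_real has_real_derivative_iff_has_vector_derivative[symmetric])
  moreover have "Ck n (\<lambda>x. of_real a * f' (a * x + b))"
    using Ck_mult[OF Ck_const Suc.IH[OF D(2)]] .
  ultimately show ?case by (rule Ck_SucI)
qed

text \<open>For \<open>p = 1\<close> this is the standard smooth function that vanishes to infinite
  order at 0. The polynomial factor is there because the family is closed under
  differentiation, so that one induction treats all derivatives together.\<close>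
definition flat :: "real poly \<Rightarrow> real \<Rightarrow> real" where
  "flat p x = (if x > 0 then poly p (1 / x) * exp (- (1 / x)) else 0)"

lemma poly_times_exp_tendsto_0: "((\<lambda>y. poly p y * exp (- y)) \<longlongrightarrow> 0) at_top" for p :: "real poly"
proof -
  have "((\<lambda>y. \<Sum>i\<le>degree p. coeff p i * (y ^ i / exp y)) \<longlongrightarrow> (\<Sum>i\<le>degree p. coeff p i * 0)) at_top"
    by (intro tendsto_sum tendsto_mult tendsto_const tendsto_power_div_exp_0)
  thus ?thesis
    by (simp add: poly_altdef exp_minus sum_distrib_right divide_inverse mult.assoc)
qed

text \<open>The polynomial \<open>X\<^sup>2 (p - p')\<close> collects both terms of the product rule
  after the substitution of \<open>1 / x\<close>. At 0 the difference quotient has the form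
  \<open>y p(y) exp (- y)\<close> with \<open>y = 1 / x\<close>, which tends to 0.\<close>
lemma flat_has_derivative:
  "(flat p has_real_derivative flat ([:0, 0, 1:] * (p - pderiv p)) x) (at x)"
proof -
  consider "x > 0" | "x < 0" | "x = 0" by linarith
  thus ?thesis
  proof cases
    case 1
    have "((\<lambda>x. poly p (1 / x) * exp (- (1 / x))) has_real_derivative
        flat ([:0, 0, 1:] * (p - pderiv p)) x) (at x)"
      using 1 by (auto intro!: derivative_eq_intros DERIV_chain'[of "\<lambda>x. 1 / x" _ _ _ "poly p"] poly_DERIV
          simp: flat_def field_simps power2_eq_square)
    thus ?thesis
      by (rule has_field_derivative_transform_within_open[where S="{0<..}"]) (use 1 in \<open>auto simp: flat_def\<close>)
  next
    case 2
    have "((\<lambda>x. 0) has_real_derivative flat ([:0, 0, 1:] * (p - pderiv p)) x) (at x)"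
      using 2 by (auto simp: flat_def)
    thus ?thesis
      by (rule has_field_derivative_transform_within_open[where S="{..<0}"]) (use 2 in \<open>auto simp: flat_def\<close>)
  next
    case 3
    have "((\<lambda>y. poly (pCons 0 p) y * exp (- y)) \<longlongrightarrow> 0) at_top"
      by (rule poly_times_exp_tendsto_0)
    from filterlim_compose[OF this filterlim_inverse_at_top_right]
    have "((\<lambda>h. flat p h / h) \<longlongrightarrow> 0) (at_right 0)"
      by (rule Lim_transform_eventually)
        (auto simp: eventually_at_filter flat_def field_simps)
    moreover have "((\<lambda>h. flat p h / h) \<longlongrightarrow> 0) (at_left 0)"
      by (rule tendsto_eventually) (auto simp: eventually_at_filter flat_def)
    ultimately have "((\<lambda>h. flat p h / h) \<longlongrightarrow> 0) (at 0)"
      by (simp add: filterlim_split_at)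
    thus ?thesis using 3 by (simp add: DERIV_def flat_def)
  qed
qed

lemma Ck_flat: "Ck n (\<lambda>x. complex_of_real (flat p x))"
proof (induction n arbitrary: p)
  case 0
  have "continuous_on UNIV (flat p)"
    by (intro DERIV_continuous_on) (use flat_has_derivative in \<open>auto intro: has_field_derivative_at_within\<close>)
  thus ?case by (auto intro!: continuous_intros)
next
  case (Suc n)
  have "((\<lambda>x. complex_of_real (flat p x)) has_vector_derivative complex_of_real (flat ([:0, 0, 1:] * (p - pderiv p)) x)) (at x)" for x
    by (intro has_vector_derivative_of_real flat_has_derivative)
  from this Suc show ?case by (rule Ck_SucI)
qed

text \<open>A smooth function that is positive on \<open>(a, b)\<close> and zero elsewhere. Growing
  \<open>n\<close> steepens both flanks without widening the support, so that the bumps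
  increase to the indicator of \<open>(a, b)\<close>.\<close>
definition bump :: "nat \<Rightarrow> real \<Rightarrow> real \<Rightarrow> real \<Rightarrow> real" where
  "bump n a b x = flat 1 (real (Suc n) * (x - a)) * flat 1 (real (Suc n) * (b - x))"

lemma flat_1_bounds: "0 \<le> flat 1 x" "flat 1 x \<le> 1"
  by (auto simp: flat_def)

lemma bump_nonneg: "0 \<le> bump n a b x" and bump_le_1: "bump n a b x \<le> 1"
  unfolding bump_def using flat_1_bounds by (auto intro: mult_le_one)

lemma bump_eq_0_iff: "bump n a b x = 0 \<longleftrightarrow> x \<notin> {a<..<b}"
  by (auto simp: bump_def flat_def zero_less_mult_iff)

lemma bump_shift: "bump n a b (x - s) = bump n (a + s) (b + s) x"
  by (simp add: bump_def algebra_simps)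

lemma Ck_bump: "Ck k (\<lambda>x. complex_of_real (bump n a b x))"
proof -
  have "Ck k (\<lambda>x. complex_of_real (flat 1 (real (Suc n) * x + (- (real (Suc n) * a)))) *
                 complex_of_real (flat 1 (- real (Suc n) * x + real (Suc n) * b)))"
    by (intro Ck_mult Ck_affine[of k "\<lambda>x. complex_of_real (flat 1 x)"] Ck_flat)
  thus ?thesis by (simp add: bump_def algebra_simps)
qed

lemma bump_tendsto: "(\<lambda>n. bump n a b x) \<longlonglongrightarrow> indicator {a<..<b} x"
proof -
  have *: "(\<lambda>n. flat 1 (real (Suc n) * y)) \<longlonglongrightarrow> (if y > 0 then 1 else 0)" for y :: real
  proof (cases "y > 0")
    case True
    have "(\<lambda>n. exp (- (1 / y * inverse (real (Suc n))))) \<longlonglongrightarrow> exp (- (1 / y * 0))"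
      by (intro tendsto_intros LIMSEQ_inverse_real_of_nat)
    thus ?thesis using True by (simp add: flat_def zero_less_mult_iff field_simps del: of_nat_Suc)
  next
    case False
    hence "flat 1 (real (Suc n) * y) = 0" for n by (auto simp: flat_def zero_less_mult_iff)
    thus ?thesis using False by simp
  qed
  show ?thesis unfolding bump_def
    using tendsto_mult[OF *[of "x - a"] *[of "b - x"]] by (auto simp: indicator_def)
qed

lemma test_functions_realI:
  assumes "\<And>n. Ck n \<phi>" "\<And>x. x \<notin> {a..b} \<Longrightarrow> \<phi> x = 0"
  shows "\<phi> \<in> test_functions (UNIV :: real set)"
proof -
  have "{x. \<phi> x \<noteq> 0} \<subseteq> {a..b}" using assms(2) by blast
  hence "closure {x. \<phi> x \<noteq> 0} \<subseteq> {a..b}" by (simp add: closure_minimal)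
  moreover have "compact (closure {x. \<phi> x \<noteq> 0})"
    using calculation by (metis closed_closure compact_Icc compact_Int_closed inf.absorb_iff2)
  ultimately show ?thesis using assms(1) by (simp add: test_functions_def)
qed

lemma bump_test_function: "(\<lambda>x. complex_of_real (bump n a b x)) \<in> test_functions UNIV"
  by (rule test_functions_realI[of _ a b]) (use Ck_bump bump_eq_0_iff in auto)

lemma test_function_real_derivative:
  assumes "\<phi> \<in> test_functions (UNIV :: real set)"
  shows "(\<phi> has_vector_derivative vector_derivative \<phi> (at x)) (at x)"
    and "continuous_on UNIV (\<lambda>x. vector_derivative \<phi> (at x))"
proof -
  have C: "Ck (Suc 0) \<phi>" using assms by (auto simp: test_functions_def simp del: Ck.simps)
  then obtain f' where f': "\<And>x. (\<phi> has_vector_derivative f' x) (at x)" "Ck 0 f'" by (metis Ck_Suc_E)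
  have "(\<lambda>x. vector_derivative \<phi> (at x)) = f'" using f'(1) vector_derivative_at by blast
  thus "continuous_on UNIV (\<lambda>x. vector_derivative \<phi> (at x))" using f'(2) by (simp only: Ck.simps)
  show "(\<phi> has_vector_derivative vector_derivative \<phi> (at x)) (at x)"
    using f'(1) vector_derivative_at by metis
qed

section \<open>Functions determined by their integrals against bumps\<close>

text \<open>Open intervals are closed under intersection and generate the Borel sets, so by Dynkin's
  lemma the integrals of \<open>E\<close> over all Borel sets vanish.\<close>
lemma AE_zero_if_interval_integrals_zero:
  fixes E :: "real \<Rightarrow> complex"
  assumes int: "integrable lborel E"
    and zero: "\<And>a b. (\<integral>x. indicator {a<..<b} x *\<^sub>R E x \<partial>lborel) = 0"
  shows "AE x in lborel. E x = 0"
proof (rule sigma_finite_measure.density_zero[OF _ int])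
  have boxes: "sets borel = sigma_sets UNIV (range (\<lambda>(a, b). box a b :: real set))"
    by (subst borel_eq_box) simp
  fix A :: "real set" assume "A \<in> sets lborel"
  hence A: "A \<in> sigma_sets UNIV (range (\<lambda>(a, b). box a b :: real set))"
    by (simp add: boxes del: box_real)
  have intA: "integrable lborel (\<lambda>x. indicator A x *\<^sub>R E x)" if "A \<in> sets borel" for A
    using int that by (intro integrable_mult_indicator) auto
  have sets: "A \<in> sets borel" if "A \<in> sigma_sets UNIV (range (\<lambda>(a, b). box a b :: real set))" for A
    using that by (simp add: boxes del: box_real)
  have UNIV0: "(\<integral>x. E x \<partial>lborel) = 0"
  proof -
    have "(\<lambda>n. \<integral>x. indicator {- real n<..<real n} x *\<^sub>R E x \<partial>lborel) \<longlonglongrightarrow> (\<integral>x. E x \<partial>lborel)"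
    proof (rule integral_dominated_convergence[where w="\<lambda>x. norm (E x)"])
      show "AE x in lborel. (\<lambda>n. indicat_real {- real n<..<real n} x *\<^sub>R E x) \<longlonglongrightarrow> E x"
      proof (rule AE_I2, rule tendsto_eventually)
        fix x :: real
        obtain N where "\<bar>x\<bar> < real N" using reals_Archimedean2 by blast
        thus "\<forall>\<^sub>F n in sequentially. indicat_real {- real n<..<real n} x *\<^sub>R E x = E x"
          by (intro eventually_sequentiallyI[of N]) (auto simp: indicator_def)
      qed
    qed (use int in \<open>auto simp: indicator_def\<close>)
    thus ?thesis using zero by (simp add: LIMSEQ_const_iff)
  qed
  have "(\<integral>x. indicator A x *\<^sub>R E x \<partial>lborel) = 0"
  proof (rule sigma_sets_induct_disjoint[OF _ _ A])
    show "Int_stable (range (\<lambda>(a, b). box a b :: real set))"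
      by (auto simp: Int_stable_def box_Int_box)
  next
    fix A :: "real set" assume "A \<in> range (\<lambda>(a, b). box a b)"
    thus "(\<integral>x. indicator A x *\<^sub>R E x \<partial>lborel) = 0" using zero by auto
  next
    fix A assume A: "A \<in> sigma_sets UNIV (range (\<lambda>(a, b). box a b :: real set))"
      and IH: "(\<integral>x. indicator A x *\<^sub>R E x \<partial>lborel) = 0"
    have "(\<integral>x. indicator (UNIV - A) x *\<^sub>R E x \<partial>lborel) = (\<integral>x. E x - indicator A x *\<^sub>R E x \<partial>lborel)"
      by (rule Bochner_Integration.integral_cong) (auto simp: indicator_def)
    also have "\<dots> = 0" using UNIV0 IH int intA[OF sets[OF A]]
      by (subst Bochner_Integration.integral_diff) auto
    finally show "(\<integral>x. indicator (UNIV - A) x *\<^sub>R E x \<partial>lborel) = 0" .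
  next
    fix A :: "nat \<Rightarrow> real set" assume d: "disjoint_family A"
      and A: "range A \<subseteq> sigma_sets UNIV (range (\<lambda>(a, b). box a b :: real set))"
      and IH: "\<And>i. (\<integral>x. indicator (A i) x *\<^sub>R E x \<partial>lborel) = 0"
    have s: "A i \<in> sets borel" for i using A sets by blast
    have "(LINT x:(\<Union>i. A i)|lborel. E x) = (\<Sum>i. (LINT x:(A i)|lborel. E x))"
      by (rule lebesgue_integral_countable_add)
         (use s d intA[of "\<Union>i. A i"] in \<open>auto simp: disjoint_family_on_def set_integrable_def\<close>)
    thus "(\<integral>x. indicator (\<Union>i. A i) x *\<^sub>R E x \<partial>lborel) = 0"
      using IH by (simp add: set_lebesgue_integral_def)
  qed auto
  thus "set_lebesgue_integral lborel A E = 0" by (simp add: set_lebesgue_integral_def)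
qed (rule lborel.sigma_finite_measure_axioms)

text \<open>The bumps are dominated by 1 and tend to indicators of intervals, so dominated convergence
  reduces this to integrals over intervals. Local integrability suffices after truncation to
  \<open>[-N, N]\<close>; the truncated function is then zero for every \<open>N\<close>.\<close>
lemma AE_zero_if_bump_integrals_zero:
  fixes E :: "real \<Rightarrow> complex"
  assumes int: "\<And>R::real. integrable lborel (\<lambda>x. indicator {-R..R} x *\<^sub>R E x)"
    and [measurable]: "E \<in> borel_measurable borel"
    and zero: "\<And>n a b. (\<integral>x. E x * of_real (bump n a b x) \<partial>lborel) = 0"
  shows "AE x in lborel. E x = 0"
proof -
  have bm [measurable]: "(\<lambda>x. bump n a b x) \<in> borel_measurable borel" for n a b
  proof -
    have "continuous_on UNIV (\<lambda>x. Re (complex_of_real (bump n a b x)))"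
      using Ck_imp_continuous[OF Ck_bump] by (intro continuous_intros) auto
    thus ?thesis by (auto intro!: borel_measurable_continuous_onI)
  qed
  have I0: "(\<integral>x. indicator {a<..<b} x *\<^sub>R E x \<partial>lborel) = 0" for a b
  proof -
    define R where "R = max \<bar>a\<bar> \<bar>b\<bar>"
    have "(\<lambda>n. \<integral>x. E x * of_real (bump n a b x) \<partial>lborel) \<longlonglongrightarrow> (\<integral>x. indicator {a<..<b} x *\<^sub>R E x \<partial>lborel)"
    proof (rule integral_dominated_convergence[where w="\<lambda>x. norm (indicator {-R..R} x *\<^sub>R E x)"])
      show "AE x in lborel. (\<lambda>n. E x * of_real (bump n a b x)) \<longlonglongrightarrow> indicat_real {a<..<b} x *\<^sub>R E x"
      proof (rule AE_I2)
        fix x :: real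
        have "(\<lambda>n. E x * of_real (bump n a b x)) \<longlonglongrightarrow> E x * of_real (indicat_real {a<..<b} x)"
          by (intro tendsto_intros bump_tendsto)
        thus "(\<lambda>n. E x * of_real (bump n a b x)) \<longlonglongrightarrow> indicat_real {a<..<b} x *\<^sub>R E x"
          by (simp add: scaleR_conv_of_real mult.commute)
      qed
      fix n
      show "AE x in lborel. norm (E x * of_real (bump n a b x)) \<le> norm (indicat_real {-R..R} x *\<^sub>R E x)"
      proof (rule AE_I2)
        fix x :: real
        show "norm (E x * of_real (bump n a b x)) \<le> norm (indicat_real {-R..R} x *\<^sub>R E x)"
        proof (cases "x \<in> {a<..<b}")
          case True
          hence "x \<in> {-R..R}" by (auto simp: R_def)
          thus ?thesis using bump_le_1[of n a b x] bump_nonneg[of n a b x]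
            by (simp add: norm_mult mult_left_le)
        qed (use bump_eq_0_iff[of n a b x] in auto)
      qed
    qed (use integrable_norm[OF int[of R]] in auto)
    thus ?thesis by (simp add: zero LIMSEQ_const_iff)
  qed
  have "AE x in lborel. indicator {- real N..real N} x *\<^sub>R E x = 0" for N
  proof (rule AE_zero_if_interval_integrals_zero[OF int])
    fix a b :: real
    let ?a = "max a (- real N)" and ?b = "min b (real N)"
    have "(\<integral>x. indicator {a<..<b} x *\<^sub>R indicator {- real N..real N} x *\<^sub>R E x \<partial>lborel)
        = (\<integral>x. indicator {?a<..<?b} x *\<^sub>R E x \<partial>lborel)"
    proof (rule integral_cong_AE)
      show "AE x in lborel. indicat_real {a<..<b} x *\<^sub>R indicat_real {- real N..real N} x *\<^sub>R E x =
          indicat_real {?a<..<?b} x *\<^sub>R E x"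
        using AE_lborel_singleton[of "real N"] AE_lborel_singleton[of "- real N"]
        by eventually_elim (auto simp: indicator_def)
    qed measurable
    thus "(\<integral>x. indicator {a<..<b} x *\<^sub>R indicator {- real N..real N} x *\<^sub>R E x \<partial>lborel) = 0"
      using I0 by simp
  qed
  hence "AE x in lborel. \<forall>N. indicator {- real N..real N} x *\<^sub>R E x = 0"
    by (simp add: AE_all_countable del: scaleR_eq_0_iff)
  thus ?thesis
  proof eventually_elim
    case (elim x)
    obtain N where "\<bar>x\<bar> < real N" using reals_Archimedean2 by blast
    hence "x \<in> {- real N..real N}" by auto
    thus ?case using elim[rule_format, of N] by auto
  qed
qed

lemma lebesgue_measurable_AE_eq_borel:
  fixes f :: "real \<Rightarrow> complex"
  assumes "f \<in> borel_measurable lebesgue"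
  obtains g where "g \<in> borel_measurable borel" "AE x in lebesgue. f x = g x"
proof -
  have "(\<lambda>x. Re (f x)) \<in> borel_measurable lebesgue" "(\<lambda>x. Im (f x)) \<in> borel_measurable lebesgue"
    using assms by auto
  then obtain g1 g2 where g: "g1 \<in> borel_measurable lborel" "AE x in lborel. Re (f x) = g1 x"
     "g2 \<in> borel_measurable lborel" "AE x in lborel. Im (f x) = g2 x"
    using completion_ex_borel_measurable_real by metis
  have "AE x in lborel. f x = Complex (g1 x) (g2 x)"
    using g(2,4) by eventually_elim (simp add: complex_eq_iff)
  moreover have "(\<lambda>x. Complex (g1 x) (g2 x)) \<in> borel_measurable borel"
    using g(1,3) by (simp add: Complex_eq)
  ultimately show ?thesis using that AE_completion by blast
qed

lemma primitive_of_continuous: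
  fixes \<theta> :: "real \<Rightarrow> complex"
  assumes "continuous_on UNIV \<theta>"
  obtains \<Phi> where "\<And>x. (\<Phi> has_vector_derivative \<theta> x) (at x)"
  using einterval_antiderivative[of "-\<infinity>" "\<infinity>" \<theta>] assms
  by (auto simp: continuous_on_eq_continuous_at)

text \<open>The primitive that vanishes at \<open>a\<close> is constant to the left of \<open>a\<close>
  and to the right of \<open>b\<close>; the mean value zero makes the second constant zero
  too, so the primitive is again a test function.\<close>
lemma primitive_of_mean_zero_test_function:
  assumes C: "\<And>n. Ck n \<theta>" and supp: "\<And>x. x \<notin> {a..b} \<Longrightarrow> \<theta> x = 0" and ab: "a < b"
    and mean: "(\<integral>x. \<theta> x \<partial>lborel) = 0"
  obtains \<phi> where "\<phi> \<in> test_functions (UNIV::real set)"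
    "\<And>x. (\<phi> has_vector_derivative \<theta> x) (at x)" "\<And>x. x \<notin> {a..b} \<Longrightarrow> \<phi> x = 0"
proof -
  have cont: "continuous_on UNIV \<theta>" using C Ck_imp_continuous by blast
  then obtain \<Phi> where \<Phi>: "\<And>x. (\<Phi> has_vector_derivative \<theta> x) (at x)"
    using primitive_of_continuous by blast
  have const: "\<Phi> x = \<Phi> y" if "convex S" "S \<inter> {a..b} \<subseteq> {a, b}" "x \<in> S" "y \<in> S" for S x y
  proof -
    have ends: "\<theta> a = 0" "\<theta> b = 0"
    proof -
      have *: "closed {x. \<theta> x = 0}" using cont by (intro closed_Collect_eq continuous_intros)
      have "{..<a} \<union> {b<..} \<subseteq> {x. \<theta> x = 0}" using supp by auto
      hence "closure ({..<a} \<union> {b<..}) \<subseteq> {x. \<theta> x = 0}" using * by (intro closure_minimal)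
      thus "\<theta> a = 0" "\<theta> b = 0" by (auto simp: closure_Un)
    qed
    have "(\<Phi> has_derivative (\<lambda>h. 0)) (at x within S)" if "x \<in> S" for x
    proof -
      have "\<theta> x = 0" using ends supp[of x] \<open>S \<inter> {a..b} \<subseteq> {a, b}\<close> that by blast
      thus ?thesis using \<Phi>[of x] by (auto simp: has_vector_derivative_def intro: has_derivative_at_withinI)
    qed
    thus ?thesis using has_derivative_zero_unique[OF \<open>convex S\<close>] that by blast
  qed
  define \<phi> where "\<phi> x = \<Phi> x - \<Phi> a" for x
  have D: "(\<phi> has_vector_derivative \<theta> x) (at x)" for x
    unfolding \<phi>_def using \<Phi>[of x] by (auto intro!: derivative_eq_intros)
  have "\<Phi> b - \<Phi> a = (\<integral>x. indicator {a..b} x *\<^sub>R \<theta> x \<partial>lborel)"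
    using ab \<Phi> cont by (intro integral_FTC_Icc[symmetric])
      (auto intro: has_vector_derivative_at_within continuous_on_subset)
  also have "\<dots> = (\<integral>x. \<theta> x \<partial>lborel)"
    by (rule Bochner_Integration.integral_cong) (use supp in \<open>auto simp: indicator_def\<close>)
  finally have eq: "\<Phi> b = \<Phi> a" using mean by simp
  have z: "\<phi> x = 0" if "x \<notin> {a..b}" for x
  proof (cases "x < a")
    case True
    have "{..a} \<inter> {a..b} \<subseteq> {a, b}" by auto
    with True show ?thesis using const[of "{..a}" x a] by (simp add: \<phi>_def)
  next
    case False
    have "{b..} \<inter> {a..b} \<subseteq> {a, b}" by auto
    with False show ?thesis using const[of "{b..}" x b] that eq by (simp add: \<phi>_def)
  qed
  have "Ck n \<phi>" for n
  proof -
    have "Ck (Suc n) \<phi>" using D C by (rule Ck_SucI)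
    thus ?thesis by (rule Ck_Suc_imp_Ck)
  qed
  thus ?thesis using that D z test_functions_realI by blast
qed

section \<open>The spaces \<open>L\<^sup>2\<close> and \<open>H\<^sup>1\<close>\<close>

lemma mult_le_sum_power2: "0 \<le> a \<Longrightarrow> 0 \<le> b \<Longrightarrow> a * b \<le> a\<^sup>2 + b\<^sup>2" for a b :: real
proof -
  assume "0 \<le> a" "0 \<le> b"
  hence "0 \<le> a * b" by simp
  moreover have "2 * (a * b) \<le> a\<^sup>2 + b\<^sup>2" using sum_squares_bound[of a b] by (simp add: mult.assoc)
  ultimately show ?thesis by linarith
qed

lemma power2_add_le: "(a + b)\<^sup>2 \<le> 2 * a\<^sup>2 + 2 * b\<^sup>2" for a b :: real
  using sum_squares_bound[of a b] unfolding power2_sum by linarith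

lemma cmod_add_power2_le: "(cmod (a + b))\<^sup>2 \<le> 2 * (cmod a)\<^sup>2 + 2 * (cmod b)\<^sup>2"
  by (rule order_trans[OF power_mono[OF norm_triangle_ineq] power2_add_le]) simp

lemma L2D:
  assumes "f \<in> L2"
  shows "f \<in> borel_measurable lebesgue" "integrable lebesgue (\<lambda>x. (cmod (f x))\<^sup>2)"
  using assms by (auto simp: L2_def)

lemma L2_norm_nonneg: "0 \<le> L2_norm f"
  by (simp add: L2_norm_def)

lemma L2_norm_power2: "(L2_norm f)\<^sup>2 = (\<integral>x. (cmod (f x))\<^sup>2 \<partial>lebesgue)"
  by (simp add: L2_norm_def)

lemma L2_norm_cong_AE:
  assumes "AE x in lebesgue. f x = g x" "f \<in> borel_measurable lebesgue"
  shows "L2_norm f = L2_norm g"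
  unfolding L2_norm_def
  by (rule arg_cong[where f=sqrt], rule integral_cong_AE)
    (use assms borel_measurable_AE[OF assms(2,1)] in auto)

lemma L2_cong_AE:
  assumes "AE x in lebesgue. f x = g x" "f \<in> L2"
  shows "g \<in> L2"
proof -
  note [measurable] = L2D[OF assms(2)] borel_measurable_AE[OF L2D(1)[OF assms(2)] assms(1)]
  have "integrable lebesgue (\<lambda>x. (cmod (g x))\<^sup>2)"
    by (rule integrable_cong_AE_imp[OF L2D(2)[OF assms(2)]]) (use assms(1) in auto)
  thus ?thesis by (simp add: L2_def)
qed

lemma L2_mult_integrable:
  assumes "f \<in> L2" "g \<in> L2"
  shows "integrable lebesgue (\<lambda>x. f x * g x)"
proof (rule Bochner_Integration.integrable_bound)
  note [measurable] = L2D(1)[OF assms(1)] L2D(1)[OF assms(2)]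
  show "integrable lebesgue (\<lambda>x. (cmod (f x))\<^sup>2 + (cmod (g x))\<^sup>2)"
    using L2D assms by auto
  show "(\<lambda>x. f x * g x) \<in> borel_measurable lebesgue" by measurable
  have "cmod (f x) * cmod (g x) \<le> (cmod (f x))\<^sup>2 + (cmod (g x))\<^sup>2" for x
    by (simp add: mult_le_sum_power2)
  thus "AE x in lebesgue. norm (f x * g x) \<le> norm ((cmod (f x))\<^sup>2 + (cmod (g x))\<^sup>2)"
    by (auto simp: norm_mult)
qed

lemma L2_Cauchy_Schwarz:
  assumes "f \<in> L2" "g \<in> L2"
  shows "cmod (\<integral>x. f x * g x \<partial>lebesgue) \<le> L2_norm f * L2_norm g"
proof -
  note [measurable] = L2D(1)[OF assms(1)] L2D(1)[OF assms(2)]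
  let ?I = "\<integral>x. cmod (f x) * cmod (g x) \<partial>lebesgue"
  have int: "integrable lebesgue (\<lambda>x. cmod (f x) * cmod (g x))"
    using integrable_norm[OF L2_mult_integrable[OF assms]] by (simp add: norm_mult)
  have eq: "(\<integral>\<^sup>+x. ennreal (cmod (h x)) ^ 2 \<partial>lebesgue) = ennreal ((L2_norm h)\<^sup>2)" if "h \<in> L2" for h
    unfolding L2_norm_power2 by (subst nn_integral_eq_integral[symmetric]) (use L2D[OF that] in \<open>auto simp: ennreal_power\<close>)
  have "(ennreal ?I)\<^sup>2 = (\<integral>\<^sup>+x. ennreal (cmod (f x)) * ennreal (cmod (g x)) \<partial>lebesgue)\<^sup>2"
    by (subst nn_integral_eq_integral[symmetric]) (use int in \<open>auto simp: ennreal_mult\<close>)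
  also have "\<dots> \<le> (\<integral>\<^sup>+x. ennreal (cmod (f x)) ^ 2 \<partial>lebesgue) * (\<integral>\<^sup>+x. ennreal (cmod (g x)) ^ 2 \<partial>lebesgue)"
    by (rule Cauchy_Schwarz_nn_integral) auto
  also have "\<dots> = ennreal ((L2_norm f * L2_norm g)\<^sup>2)"
    by (simp add: eq assms power_mult_distrib ennreal_mult)
  finally have "?I\<^sup>2 \<le> (L2_norm f * L2_norm g)\<^sup>2"
    by (simp add: ennreal_power)
  hence "?I \<le> L2_norm f * L2_norm g"
    using L2_norm_nonneg by (meson mult_nonneg_nonneg power2_le_imp_le)
  moreover have "cmod (\<integral>x. f x * g x \<partial>lebesgue) \<le> ?I"
    using integral_norm_bound[of lebesgue "\<lambda>x. f x * g x"] by (simp add: norm_mult)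
  ultimately show ?thesis by linarith
qed

lemma L2_scale: "f \<in> L2 \<Longrightarrow> (\<lambda>x. c * f x) \<in> L2"
  by (auto simp: L2_def norm_mult power_mult_distrib)

lemma L2_add:
  assumes "f \<in> L2" "g \<in> L2"
  shows "(\<lambda>x. f x + g x) \<in> L2"
proof -
  note [measurable] = L2D(1)[OF assms(1)] L2D(1)[OF assms(2)]
  have "integrable lebesgue (\<lambda>x. (cmod (f x + g x))\<^sup>2)"
  proof (rule Bochner_Integration.integrable_bound)
    show "integrable lebesgue (\<lambda>x. 2 * (cmod (f x))\<^sup>2 + 2 * (cmod (g x))\<^sup>2)"
      using L2D(2)[OF assms(1)] L2D(2)[OF assms(2)] by simp
    show "AE x in lebesgue. norm ((cmod (f x + g x))\<^sup>2) \<le> norm (2 * (cmod (f x))\<^sup>2 + 2 * (cmod (g x))\<^sup>2)"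
      using cmod_add_power2_le by auto
  qed measurable
  thus ?thesis by (simp add: L2_def)
qed

lemma L2_diff: "f \<in> L2 \<Longrightarrow> g \<in> L2 \<Longrightarrow> (\<lambda>x. f x - g x) \<in> L2"
  using L2_add[of f "\<lambda>x. (-1) * g x"] L2_scale[of g "-1"] by simp

lemma L2_indicator: "(\<lambda>x. of_real (indicator {a..b} x)) \<in> L2"
proof -
  have eq: "(\<lambda>x. (cmod (of_real (indicator {a..b} x)))\<^sup>2) = (\<lambda>x. indicat_real {a..b} x)"
    by (auto simp: indicator_def)
  have "(\<lambda>x. complex_of_real (indicat_real {a..b} x)) \<in> borel_measurable borel" by measurable
  moreover have "emeasure lborel {a..b} < top" using emeasure_lborel_cbox_finite[of a b] by simp
  ultimately show ?thesis unfolding L2_def mem_Collect_eq eq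
    by (auto intro!: integrable_real_indicator measurable_completion)
qed

lemma L2_norm_indicator: "a \<le> b \<Longrightarrow> L2_norm (\<lambda>x. of_real (indicator {a..b} x)) = sqrt (b - a)"
proof -
  assume "a \<le> b"
  have eq: "(\<lambda>x. (cmod (of_real (indicator {a..b} x)))\<^sup>2) = (\<lambda>x. indicat_real {a..b} x)"
    by (auto simp: indicator_def)
  show ?thesis unfolding L2_norm_def eq using \<open>a \<le> b\<close> by simp
qed

lemma L2_mult_indicator_integrable:
  assumes "f \<in> L2" shows "integrable lebesgue (\<lambda>x. indicat_real {a..b} x *\<^sub>R f x)"
  using L2_mult_integrable[OF L2_indicator[of a b] assms] by (simp add: scaleR_conv_of_real)

lemma continuous_compact_support_L2:
  assumes "continuous_on UNIV f" "\<And>x. x \<notin> {a..b} \<Longrightarrow> f x = 0"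
  shows "f \<in> L2"
proof -
  have [measurable]: "f \<in> borel_measurable borel" using assms(1) by (rule borel_measurable_continuous_onI)
  have "set_integrable lborel {a..b} (\<lambda>x. (cmod (f x))\<^sup>2)"
    by (rule borel_integrable_atLeastAtMost') (auto intro!: continuous_intros continuous_on_subset[OF assms(1)])
  moreover have "(\<lambda>x. indicator {a..b} x *\<^sub>R (cmod (f x))\<^sup>2) = (\<lambda>x. (cmod (f x))\<^sup>2)"
  proof
    fix x show "indicator {a..b} x *\<^sub>R (cmod (f x))\<^sup>2 = (cmod (f x))\<^sup>2"
      using assms(2)[of x] by (cases "x \<in> {a..b}") auto
  qed
  ultimately have "integrable lborel (\<lambda>x. (cmod (f x))\<^sup>2)" by (simp add: set_integrable_def)
  thus ?thesis unfolding L2_def mem_Collect_eq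
    by (simp add: integrable_completion measurable_completion)
qed

lemma test_function_support:
  assumes "\<phi> \<in> test_functions (UNIV :: real set)"
  obtains R where "R > 0" "\<And>x. x \<notin> {-R..R} \<Longrightarrow> \<phi> x = 0" "\<And>x. x \<notin> {-R..R} \<Longrightarrow> vector_derivative \<phi> (at x) = 0"
proof -
  have "bounded (closure {x. \<phi> x \<noteq> 0})" using assms by (auto simp: test_functions_def compact_imp_bounded)
  then obtain R where R: "R > 0" "\<forall>x\<in>closure {x. \<phi> x \<noteq> 0}. norm x \<le> R" by (auto simp: bounded_pos)
  have z: "\<phi> x = 0" if "x \<notin> {-R..R}" for x
    using R(2) that closure_subset[of "{x. \<phi> x \<noteq> 0}"] by force
  have "vector_derivative \<phi> (at x) = 0" if "x \<notin> {-R..R}" for x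
  proof -
    have "open (- {-R..R})" "x \<in> - {-R..R}" using that by auto
    have "(\<phi> has_vector_derivative 0) (at x)"
      by (rule has_vector_derivative_transform_within_open[OF has_vector_derivative_const, of "- {-R..R}" _ 0])
        (use z that in auto)
    thus ?thesis by (rule vector_derivative_at)
  qed
  with z R(1) that show ?thesis by blast
qed

lemma test_function_L2:
  assumes "\<phi> \<in> test_functions (UNIV :: real set)"
  shows "\<phi> \<in> L2" "(\<lambda>x. vector_derivative \<phi> (at x)) \<in> L2"
proof -
  obtain R where R: "\<And>x. x \<notin> {-R..R} \<Longrightarrow> \<phi> x = 0" "\<And>x. x \<notin> {-R..R} \<Longrightarrow> vector_derivative \<phi> (at x) = 0"
    using test_function_support[OF assms] by metis
  have "continuous_on UNIV \<phi>"
    using assms by (auto simp: test_functions_def intro: Ck_imp_continuous)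
  thus "\<phi> \<in> L2" using R(1) by (rule continuous_compact_support_L2)
  show "(\<lambda>x. vector_derivative \<phi> (at x)) \<in> L2"
    using test_function_real_derivative(2)[OF assms] R(2) by (rule continuous_compact_support_L2)
qed

lemma H1_diff:
  assumes "f \<in> H1" "g \<in> H1"
  shows "(\<lambda>x. f x - g x) \<in> H1"
proof -
  obtain f' g' where D: "f' \<in> L2" "has_weak_deriv f f'" "g' \<in> L2" "has_weak_deriv g g'"
    and L: "f \<in> L2" "g \<in> L2" using assms by (auto simp: H1_def)
  have "has_weak_deriv (\<lambda>x. f x - g x) (\<lambda>x. f' x - g' x)"
    unfolding has_weak_deriv_def
  proof
    fix \<phi> :: "real \<Rightarrow> complex" assume \<phi>: "\<phi> \<in> test_functions UNIV"
    note t = test_function_L2[OF \<phi>]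
    have "(\<integral>x. f x * vector_derivative \<phi> (at x) \<partial>lebesgue) = - (\<integral>x. f' x * \<phi> x \<partial>lebesgue)"
         "(\<integral>x. g x * vector_derivative \<phi> (at x) \<partial>lebesgue) = - (\<integral>x. g' x * \<phi> x \<partial>lebesgue)"
      using D \<phi> by (auto simp: has_weak_deriv_def)
    thus "(\<integral>x. (f x - g x) * vector_derivative \<phi> (at x) \<partial>lebesgue) = - (\<integral>x. (f' x - g' x) * \<phi> x \<partial>lebesgue)"
      using L2_mult_integrable[OF L(1) t(2)] L2_mult_integrable[OF L(2) t(2)]
        L2_mult_integrable[OF D(1) t(1)] L2_mult_integrable[OF D(3) t(1)]
      by (simp add: left_diff_distrib)
  qed
  thus ?thesis using L2_diff D L by (auto simp: H1_def)
qed

lemma weak_deriv_H1: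
  assumes "f \<in> H1"
  shows "weak_deriv f \<in> L2" "has_weak_deriv f (weak_deriv f)"
proof -
  have "\<exists>g. g \<in> L2 \<and> has_weak_deriv f g" using assms by (auto simp: H1_def)
  from someI_ex[OF this] show "weak_deriv f \<in> L2" "has_weak_deriv f (weak_deriv f)"
    by (auto simp: weak_deriv_def)
qed

section \<open>Continuous representatives of \<open>H\<^sup>1\<close> functions\<close>

lemma L2_interval_integral_bound:
  assumes g: "g \<in> L2" and ab: "a \<le> b"
  shows "cmod (\<integral>y. indicat_real {a<..b} y *\<^sub>R g y \<partial>lebesgue) \<le> sqrt (b - a) * L2_norm g"
proof -
  note [measurable] = L2D(1)[OF g]
  have "(\<integral>y. indicat_real {a<..b} y *\<^sub>R g y \<partial>lebesgue) = (\<integral>y. of_real (indicat_real {a..b} y) * g y \<partial>lebesgue)"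
  proof (rule integral_cong_AE)
    show "AE y in lebesgue. indicat_real {a<..b} y *\<^sub>R g y = of_real (indicat_real {a..b} y) * g y"
      using AE_completion[OF AE_lborel_singleton[of a]]
      by eventually_elim (auto simp: indicator_def)
    have "indicat_real {a<..b} \<in> borel_measurable lebesgue" "indicat_real {a..b} \<in> borel_measurable lebesgue"
      by (intro borel_measurable_indicator; simp)+
    thus "(\<lambda>y. indicat_real {a<..b} y *\<^sub>R g y) \<in> borel_measurable lebesgue"
      "(\<lambda>y. of_real (indicat_real {a..b} y) * g y) \<in> borel_measurable lebesgue" by auto
  qed
  thus ?thesis using L2_Cauchy_Schwarz[OF L2_indicator[of a b] g] L2_norm_indicator[OF ab] by simp
qed

text \<open>The signed integral of \<open>g\<close> from 0 to \<open>x\<close>; the difference of two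
  indicators takes care of both signs of \<open>x\<close>.\<close>
definition primitive :: "(real \<Rightarrow> complex) \<Rightarrow> real \<Rightarrow> complex" where
  "primitive g x = (\<integral>y. (indicat_real {..x} y - indicat_real {..0} y) *\<^sub>R g y \<partial>lebesgue)"

lemma primitive_integrable:
  assumes "g \<in> L2"
  shows "integrable lebesgue (\<lambda>y. (indicat_real {..x} y - indicat_real {..0} y) *\<^sub>R g y)"
proof (rule Bochner_Integration.integrable_bound[OF L2_mult_indicator_integrable[OF assms, of "- \<bar>x\<bar>" "\<bar>x\<bar>"]])
  note [measurable] = L2D(1)[OF assms]
  have "indicat_real {..x} \<in> borel_measurable lebesgue" "indicat_real {..0::real} \<in> borel_measurable lebesgue"
    by (auto intro: borel_measurable_indicator)
  thus "(\<lambda>y. (indicat_real {..x} y - indicat_real {..0} y) *\<^sub>R g y) \<in> borel_measurable lebesgue" by auto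
  show "AE y in lebesgue. norm ((indicat_real {..x} y - indicat_real {..0} y) *\<^sub>R g y)
         \<le> norm (indicat_real {- \<bar>x\<bar>..\<bar>x\<bar>} y *\<^sub>R g y)"
    by (auto simp: indicator_def)
qed

lemma primitive_increment:
  assumes "g \<in> L2" "z \<le> x"
  shows "cmod (primitive g x - primitive g z) \<le> sqrt (x - z) * L2_norm g"
proof -
  have "primitive g x - primitive g z = (\<integral>y. indicat_real {z<..x} y *\<^sub>R g y \<partial>lebesgue)"
    unfolding primitive_def
    by (subst Bochner_Integration.integral_diff[symmetric, OF primitive_integrable primitive_integrable, OF assms(1) assms(1)])
      (rule Bochner_Integration.integral_cong, use assms(2) in \<open>auto simp: indicator_def\<close>)
  thus ?thesis using L2_interval_integral_bound[OF assms] by simp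
qed

lemma primitive_continuous:
  assumes "g \<in> L2" shows "continuous_on UNIV (primitive g)"
proof -
  have bd: "dist (primitive g x) (primitive g z) \<le> sqrt \<bar>x - z\<bar> * L2_norm g" for x z
    using primitive_increment[OF assms, of x z] primitive_increment[OF assms, of z x]
    by (cases "z \<le> x") (auto simp: dist_norm norm_minus_commute)
  have "(primitive g \<longlongrightarrow> primitive g z) (at z)" for z
  proof (rule tendsto_dist_iff[THEN iffD2], rule tendsto_sandwich[OF _ _ tendsto_const])
    have "((\<lambda>x. sqrt \<bar>x - z\<bar> * L2_norm g) \<longlongrightarrow> sqrt \<bar>z - z\<bar> * L2_norm g) (at z)"
      by (intro tendsto_intros)
    thus "((\<lambda>x. sqrt \<bar>x - z\<bar> * L2_norm g) \<longlongrightarrow> 0) (at z)" by simp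
  qed (auto simp: bd)
  thus ?thesis by (simp add: continuous_on_def continuous_on_eq_continuous_at isCont_def)
qed

text \<open>Fubini on the kernel of the primitive: for fixed \<open>y\<close> the integral of
  \<open>\<theta>\<close> over \<open>[y, \<infinity>)\<close> is \<open>- \<phi> y\<close>,
  and the integral of \<open>\<theta>\<close> over the line, which multiplies the part
  normalised at 0, vanishes.\<close>
lemma primitive_by_parts:
  assumes g: "g \<in> L2" and [measurable]: "g \<in> borel_measurable borel" and \<phi>: "\<phi> \<in> test_functions UNIV"
    and D: "\<And>x. (\<phi> has_vector_derivative \<theta> x) (at x)" and \<theta>: "continuous_on UNIV \<theta>"
    and supp: "\<And>x. x \<notin> {-R..R} \<Longrightarrow> \<phi> x = 0" "\<And>x. x \<notin> {-R..R} \<Longrightarrow> \<theta> x = 0" and "R > 0"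
  shows "(\<integral>x. primitive g x * \<theta> x \<partial>lborel) = - (\<integral>x. g x * \<phi> x \<partial>lborel)"
proof -
  have [measurable]: "\<theta> \<in> borel_measurable borel" using \<theta> by (rule borel_measurable_continuous_onI)
  let ?K = "\<lambda>x y. ((indicat_real {..x} y - indicat_real {..0} y) *\<^sub>R g y) * \<theta> x"
  have m [measurable]: "(\<lambda>(x, y). ?K x y) \<in> borel_measurable (lborel \<Otimes>\<^sub>M lborel)"
  proof -
    have eq: "(\<lambda>(x, y). ?K x y) = (\<lambda>p. ((if snd p \<le> fst p then 1 else 0) - (if snd p \<le> 0 then 1 else 0)) *\<^sub>R g (snd p) * \<theta> (fst p))"
      by (auto simp: indicator_def)
    show ?thesis unfolding eq by measurable
  qed
  have gi: "integrable lborel (\<lambda>y. indicat_real {-R..R} y *\<^sub>R g y)"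
    using L2_mult_indicator_integrable[OF g, of "-R" R] by (simp add: integrable_completion)
  have \<theta>i: "integrable lborel \<theta>"
  proof -
    have "set_integrable lborel {-R..R} \<theta>"
      by (rule borel_integrable_atLeastAtMost') (auto intro: continuous_on_subset[OF \<theta>])
    moreover have "(\<lambda>x. indicat_real {-R..R} x *\<^sub>R \<theta> x) = \<theta>"
    proof
      fix x show "indicat_real {-R..R} x *\<^sub>R \<theta> x = \<theta> x" using supp(2)[of x] by (cases "x \<in> {-R..R}") auto
    qed
    ultimately show ?thesis by (simp add: set_integrable_def)
  qed
  have Kb: "norm (?K x y) \<le> norm (indicat_real {-R..R} y *\<^sub>R g y) * norm (\<theta> x)" for x y
    using supp(2)[of x] \<open>R > 0\<close> by (cases "x \<in> {-R..R}") (auto simp: indicator_def norm_mult)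
  have Kint: "integrable (lborel \<Otimes>\<^sub>M lborel) (\<lambda>(x, y). ?K x y)"
  proof (rule Bochner_Integration.integrable_bound)
    show "integrable (lborel \<Otimes>\<^sub>M lborel) (\<lambda>(x, y). norm (\<theta> x) * norm (indicat_real {-R..R} y *\<^sub>R g y))"
    proof (rule lborel_pair.Fubini_integrable)
      show "integrable lborel (\<lambda>x. LBINT y. norm (case (x, y) of (x, y) \<Rightarrow> norm (\<theta> x) * norm (indicat_real {- R..R} y *\<^sub>R g y)))"
        using \<theta>i by (simp add: abs_mult)
      show "AE x in lborel. integrable lborel (\<lambda>y. case (x, y) of (x, y) \<Rightarrow> norm (\<theta> x) * norm (indicat_real {- R..R} y *\<^sub>R g y))"
        using integrable_norm[OF gi] by auto
    qed measurable
    show "AE p in lborel \<Otimes>\<^sub>M lborel. norm (case p of (x, y) \<Rightarrow> ?K x y) \<le>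
        norm (case p of (x, y) \<Rightarrow> norm (\<theta> x) * norm (indicat_real {-R..R} y *\<^sub>R g y))"
      using Kb by (auto simp: abs_mult mult.commute)
  qed measurable
  have inner: "(\<integral>x. ?K x y \<partial>lborel) = - (g y * \<phi> y)" for y
  proof -
    have up: "(\<integral>x. indicat_real {y..} x *\<^sub>R \<theta> x \<partial>lborel) = - \<phi> y" for y
    proof -
      define M where "M = max R \<bar>y\<bar> + 1"
      have "(\<integral>x. indicat_real {y..} x *\<^sub>R \<theta> x \<partial>lborel) = (\<integral>x. indicat_real {y..M} x *\<^sub>R \<theta> x \<partial>lborel)"
      proof (rule Bochner_Integration.integral_cong[OF refl])
        fix x show "indicat_real {y..} x *\<^sub>R \<theta> x = indicat_real {y..M} x *\<^sub>R \<theta> x"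
        proof (cases "x \<le> M")
          case False
          hence "x \<notin> {-R..R}" by (auto simp: M_def)
          thus ?thesis by (simp add: supp(2))
        qed (auto simp: indicator_def)
      qed
      also have "\<dots> = \<phi> M - \<phi> y"
        by (rule integral_FTC_Icc) (auto simp: M_def intro: has_vector_derivative_at_within[OF D] continuous_on_subset[OF \<theta>])
      also have "\<phi> M = 0"
      proof -
        have "M \<notin> {-R..R}" by (auto simp: M_def)
        thus ?thesis by (rule supp(1))
      qed
      finally show ?thesis by simp
    qed
    have tot: "(\<integral>x. \<theta> x \<partial>lborel) = 0"
    proof -
      have "(\<integral>x. \<theta> x \<partial>lborel) = (\<integral>x. indicat_real {-R-1..} x *\<^sub>R \<theta> x \<partial>lborel)"
        by (rule Bochner_Integration.integral_cong) (use supp(2) in \<open>auto simp: indicator_def\<close>)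
      thus ?thesis using up[of "-R-1"] supp(1)[of "-R-1"] by auto
    qed
    have "(\<integral>x. ?K x y \<partial>lborel) = (\<integral>x. g y * (indicat_real {y..} x *\<^sub>R \<theta> x) - g y * (indicat_real {..0} y *\<^sub>R \<theta> x) \<partial>lborel)"
      by (rule Bochner_Integration.integral_cong) (auto simp: indicator_def)
    also have "\<dots> = g y * (\<integral>x. indicat_real {y..} x *\<^sub>R \<theta> x \<partial>lborel) - g y * (indicat_real {..0} y *\<^sub>R (\<integral>x. \<theta> x \<partial>lborel))"
    proof (subst Bochner_Integration.integral_diff)
      show "integrable lborel (\<lambda>x. g y * (indicat_real {y..} x *\<^sub>R \<theta> x))"
        using \<theta>i by (intro integrable_mult_right integrable_mult_indicator) auto
      show "integrable lborel (\<lambda>x. g y * (indicat_real {..0} y *\<^sub>R \<theta> x))"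
        using \<theta>i by auto
    qed (simp only: Bochner_Integration.integral_mult_right_zero Bochner_Integration.integral_scaleR_right)
    finally show ?thesis using up tot by simp
  qed
  have "(\<integral>x. primitive g x * \<theta> x \<partial>lborel) = (\<integral>x. (\<integral>y. ?K x y \<partial>lborel) \<partial>lborel)"
  proof -
    have "primitive g x = (\<integral>y. (indicat_real {..x} y - indicat_real {..0} y) *\<^sub>R g y \<partial>lborel)" for x
      unfolding primitive_def by (rule integral_completion) measurable
    thus ?thesis by (simp only: Bochner_Integration.integral_mult_left_zero)
  qed
  also have "\<dots> = (\<integral>y. (\<integral>x. ?K x y \<partial>lborel) \<partial>lborel)"
    by (rule lborel_pair.Fubini_integral[symmetric]) (rule Kint)
  also have "\<dots> = - (\<integral>y. g y * \<phi> y \<partial>lborel)"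
    using inner by simp
  finally show ?thesis .
qed

text \<open>The lemma of du Bois-Reymond. If \<open>G\<close> is a primitive of the weak derivative,
  then \<open>f - G\<close> is orthogonal to every test function of mean zero. Correcting an
  arbitrary bump by a multiple of one fixed bump gives mean zero, so \<open>f - G - c\<close>
  is orthogonal to all bumps for a suitable constant \<open>c\<close>. The modulus of
  continuity is that of \<open>G\<close>, by Cauchy-Schwarz.\<close>
theorem weak_derivative_imp_continuous_representative:
  assumes f: "f \<in> L2" and g: "g \<in> L2" and fg: "has_weak_deriv f g"
  obtains F where "continuous_on UNIV F" "AE x in lebesgue. f x = F x"
    "\<And>x z. z \<le> x \<Longrightarrow> cmod (F x - F z) \<le> sqrt (x - z) * L2_norm g"
proof -
  obtain f' where f'[measurable]: "f' \<in> borel_measurable borel" and ff': "AE x in lebesgue. f x = f' x"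
    using lebesgue_measurable_AE_eq_borel L2D(1)[OF f] by blast
  obtain g' where g'[measurable]: "g' \<in> borel_measurable borel" and gg': "AE x in lebesgue. g x = g' x"
    using lebesgue_measurable_AE_eq_borel L2D(1)[OF g] by blast
  have f'2: "f' \<in> L2" and g'2: "g' \<in> L2"
    using L2_cong_AE ff' gg' f g by blast+
  have norm_eq: "L2_norm g' = L2_norm g" using L2_norm_cong_AE[OF gg'] L2D(1)[OF g] by simp
  have wd: "(\<integral>x. f' x * \<theta> x \<partial>lborel) = - (\<integral>x. g' x * \<phi> x \<partial>lborel)"
    if \<phi>: "\<phi> \<in> test_functions UNIV" and D: "\<And>x. (\<phi> has_vector_derivative \<theta> x) (at x)" for \<phi> \<theta>
  proof -
    have eq: "vector_derivative \<phi> (at x) = \<theta> x" for x using D by (rule vector_derivative_at)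
    have [measurable]: "\<phi> \<in> borel_measurable borel" "\<theta> \<in> borel_measurable borel"
    proof -
      have "continuous_on UNIV \<phi>" using \<phi> by (auto simp: test_functions_def intro: Ck_imp_continuous)
      thus "\<phi> \<in> borel_measurable borel" by (rule borel_measurable_continuous_onI)
      have "continuous_on UNIV \<theta>" using test_function_real_derivative(2)[OF \<phi>] by (simp add: eq)
      thus "\<theta> \<in> borel_measurable borel" by (rule borel_measurable_continuous_onI)
    qed
    note t = test_function_L2[OF \<phi>]
    have "(\<integral>x. f' x * \<theta> x \<partial>lborel) = (\<integral>x. f' x * \<theta> x \<partial>lebesgue)"
      by (rule integral_completion[symmetric]) measurable
    also have "\<dots> = (\<integral>x. f x * vector_derivative \<phi> (at x) \<partial>lebesgue)"
      by (rule integral_cong_AE, use L2_mult_integrable[OF f'2 t(2)] L2_mult_integrable[OF f t(2)] eq in \<open>auto\<close>)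
        (use ff' in eventually_elim, auto)
    also have "\<dots> = - (\<integral>x. g x * \<phi> x \<partial>lebesgue)"
      using fg \<phi> by (auto simp: has_weak_deriv_def)
    also have "(\<integral>x. g x * \<phi> x \<partial>lebesgue) = (\<integral>x. g' x * \<phi> x \<partial>lebesgue)"
      by (rule integral_cong_AE, use L2_mult_integrable[OF g'2 t(1)] L2_mult_integrable[OF g t(1)] in \<open>auto\<close>)
        (use gg' in eventually_elim, auto)
    also have "\<dots> = (\<integral>x. g' x * \<phi> x \<partial>lborel)"
      by (rule integral_completion) measurable
    finally show ?thesis .
  qed
  let ?G = "primitive g'"
  have Gc: "continuous_on UNIV ?G" by (rule primitive_continuous[OF g'2])
  have [measurable]: "?G \<in> borel_measurable borel" using Gc by (rule borel_measurable_continuous_onI)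
  have Di: "integrable lborel (\<lambda>x. indicator {-R..R} x *\<^sub>R (f' x - ?G x))" for R
  proof -
    have 1: "integrable lborel (\<lambda>x. indicat_real {-R..R} x *\<^sub>R f' x)"
      using L2_mult_indicator_integrable[OF f'2, of "-R" R] by (simp add: integrable_completion)
    have 2: "integrable lborel (\<lambda>x. indicat_real {-R..R} x *\<^sub>R ?G x)"
      using borel_integrable_atLeastAtMost'[of "-R" R ?G] continuous_on_subset[OF Gc] by (simp add: set_integrable_def)
    show ?thesis using Bochner_Integration.integrable_diff[OF 1 2] by (simp add: scaleR_diff_right)
  qed
  have bint: "integrable lborel (\<lambda>x. (f' x - ?G x) * of_real (bump n a b x))"
    and bint': "integrable lborel (\<lambda>x. complex_of_real (bump n a b x))" for n a b
  proof -
    define R where "R = max \<bar>a\<bar> \<bar>b\<bar>"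
    have 0: "bump n a b x = 0" if "x \<notin> {-R..R}" for x
      using that bump_eq_0_iff[of n a b x] by (auto simp: R_def)
    have [measurable]: "(\<lambda>x. complex_of_real (bump n a b x)) \<in> borel_measurable borel"
      using Ck_imp_continuous[OF Ck_bump] by (rule borel_measurable_continuous_onI)
    show "integrable lborel (\<lambda>x. (f' x - ?G x) * of_real (bump n a b x))"
    proof (rule Bochner_Integration.integrable_bound[OF Di[of R]])
      show "AE x in lborel. norm ((f' x - ?G x) * of_real (bump n a b x)) \<le> norm (indicat_real {- R..R} x *\<^sub>R (f' x - ?G x))"
      proof (rule AE_I2)
        fix x show "norm ((f' x - ?G x) * of_real (bump n a b x)) \<le> norm (indicat_real {- R..R} x *\<^sub>R (f' x - ?G x))"
          using 0[of x] bump_le_1[of n a b x] bump_nonneg[of n a b x]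
          by (cases "x \<in> {-R..R}") (auto simp: norm_mult mult_left_le)
      qed
    qed measurable
    show "integrable lborel (\<lambda>x. complex_of_real (bump n a b x))"
    proof (rule Bochner_Integration.integrable_bound)
      show "integrable lborel (indicat_real {-R..R})" using emeasure_lborel_cbox_finite[of "-R" R]
        by (intro integrable_real_indicator) auto
      show "AE x in lborel. norm (complex_of_real (bump n a b x)) \<le> norm (indicat_real {- R..R} x)"
      proof (rule AE_I2)
        fix x show "norm (complex_of_real (bump n a b x)) \<le> norm (indicat_real {- R..R} x)"
          using 0[of x] bump_le_1[of n a b x] bump_nonneg[of n a b x] by (cases "x \<in> {-R..R}") auto
      qed
    qed measurable
  qed
  have orth: "(\<integral>x. (f' x - ?G x) * \<theta> x \<partial>lborel) = 0"
    if C: "\<And>n. Ck n \<theta>" and supp: "\<And>x. x \<notin> {-R..R} \<Longrightarrow> \<theta> x = 0" and R: "R > 0" and mean: "(\<integral>x. \<theta> x \<partial>lborel) = 0"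
    for \<theta> R
  proof -
    have \<theta>c: "continuous_on UNIV \<theta>" using C Ck_imp_continuous by blast
    hence [measurable]: "\<theta> \<in> borel_measurable borel" by (rule borel_measurable_continuous_onI)
    have "-R < R" using R by simp
    from primitive_of_mean_zero_test_function[OF C supp this mean]
    obtain \<phi> where \<phi>: "\<phi> \<in> test_functions UNIV" "\<And>x. (\<phi> has_vector_derivative \<theta> x) (at x)" "\<And>x. x \<notin> {-R..R} \<Longrightarrow> \<phi> x = 0"
      by blast
    have \<theta>L: "\<theta> \<in> L2" using continuous_compact_support_L2[OF \<theta>c supp] .
    have i1: "integrable lborel (\<lambda>x. f' x * \<theta> x)"
      using L2_mult_integrable[OF f'2 \<theta>L] by (simp add: integrable_completion)
    have "set_integrable lborel {-R..R} (\<lambda>x. ?G x * \<theta> x)"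
      by (rule borel_integrable_atLeastAtMost') (auto intro!: continuous_intros continuous_on_subset[OF Gc] continuous_on_subset[OF \<theta>c])
    moreover have "(\<lambda>x. indicat_real {-R..R} x *\<^sub>R (?G x * \<theta> x)) = (\<lambda>x. ?G x * \<theta> x)"
    proof
      fix x show "indicat_real {-R..R} x *\<^sub>R (?G x * \<theta> x) = ?G x * \<theta> x"
        using supp[of x] by (cases "x \<in> {-R..R}") auto
    qed
    ultimately have i2: "integrable lborel (\<lambda>x. ?G x * \<theta> x)" by (simp add: set_integrable_def)
    have "(\<integral>x. ?G x * \<theta> x \<partial>lborel) = - (\<integral>x. g' x * \<phi> x \<partial>lborel)"
      by (rule primitive_by_parts[OF g'2 g' \<phi>(1,2) \<theta>c \<phi>(3) supp R])
    with wd[OF \<phi>(1,2)] i1 i2 show ?thesis by (simp add: left_diff_distrib)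
  qed
  \<comment> \<open>The fixed bump that corrects mean values; \<open>c\<close> is the average of \<open>f
    - G\<close> against it.\<close>
  let ?b = "\<lambda>x. complex_of_real (bump 0 0 1 x)"
  define m where "m = (\<integral>x. ?b x \<partial>lborel)"
  define c where "c = (\<integral>x. (f' x - ?G x) * ?b x \<partial>lborel) / m"
  have m0: "m \<noteq> 0"
  proof
    assume "m = 0"
    moreover have "m = complex_of_real (\<integral>x. bump 0 0 1 x \<partial>lborel)" by (simp add: m_def)
    ultimately have "(\<integral>x. bump 0 0 1 x \<partial>lborel) = 0" by simp
    moreover have "integrable lborel (bump 0 0 1)" using integrable_Re[OF bint'[of 0 0 1]] by simp
    ultimately have "AE x in lborel. bump 0 0 1 x = 0"
      using integral_nonneg_eq_0_iff_AE[of lborel "bump 0 0 1"] bump_nonneg by auto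
    hence "AE x in lborel. x \<notin> {0<..<1::real}" by (simp only: bump_eq_0_iff)
    hence "emeasure lborel {0<..<1::real} = 0" by (subst (asm) AE_iff_measurable[of "{0<..<1::real}"]) auto
    thus False by simp
  qed
  have "AE x in lborel. (f' x - ?G x) - c = 0"
  proof (rule AE_zero_if_bump_integrals_zero)
    fix R show "integrable lborel (\<lambda>x. indicator {-R..R} x *\<^sub>R (f' x - ?G x - c))"
    proof -
      have "integrable lborel (\<lambda>x. indicat_real {-R..R} x *\<^sub>R c)" using emeasure_lborel_cbox_finite[of "-R" R]
        by (intro integrable_scaleR_left integrable_real_indicator) auto
      from Bochner_Integration.integrable_diff[OF Di[of R] this] show ?thesis
        by (simp add: scaleR_diff_right)
    qed
  next
    fix n a b
    let ?\<psi> = "\<lambda>x. complex_of_real (bump n a b x)"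
    define M where "M = (\<integral>x. ?\<psi> x \<partial>lborel)"
    define R where "R = max 1 (max \<bar>a\<bar> \<bar>b\<bar>)"
    have "(\<integral>x. (f' x - ?G x) * (?\<psi> x + (- (M / m)) * ?b x) \<partial>lborel) = 0"
    proof (rule orth)
      show "Ck k (\<lambda>x. ?\<psi> x + (- (M / m)) * ?b x)" for k
        by (intro Ck_add Ck_mult Ck_const Ck_bump)
      show "?\<psi> x + (- (M / m)) * ?b x = 0" if "x \<notin> {-R..R}" for x
        using that bump_eq_0_iff[of n a b x] bump_eq_0_iff[of 0 0 1 x] by (auto simp: R_def)
      show "R > 0" by (simp add: R_def)
      have "(\<integral>x. ?\<psi> x + (- (M / m)) * ?b x \<partial>lborel) = M + (- (M / m)) * m"
        using bint' by (subst Bochner_Integration.integral_add) (auto simp: M_def m_def)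
      thus "(\<integral>x. ?\<psi> x + (- (M / m)) * ?b x \<partial>lborel) = 0" using m0 by simp
    qed
    moreover have "(\<integral>x. (f' x - ?G x) * (?\<psi> x + (- (M / m)) * ?b x) \<partial>lborel)
       = (\<integral>x. (f' x - ?G x) * ?\<psi> x + (- (M / m)) * ((f' x - ?G x) * ?b x) \<partial>lborel)"
      by (rule Bochner_Integration.integral_cong) (simp_all only: distrib_left mult.left_commute)
    moreover have "\<dots> = (\<integral>x. (f' x - ?G x) * ?\<psi> x \<partial>lborel) + (- (M / m)) * (\<integral>x. (f' x - ?G x) * ?b x \<partial>lborel)"
      by (subst Bochner_Integration.integral_add[OF bint integrable_mult_right[OF bint]])
        (simp only: Bochner_Integration.integral_mult_right_zero)
    ultimately have "(\<integral>x. (f' x - ?G x) * ?\<psi> x \<partial>lborel) = c * M"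
      using m0 by (simp add: c_def)
    moreover have "(\<integral>x. (f' x - ?G x - c) * ?\<psi> x \<partial>lborel) = (\<integral>x. (f' x - ?G x) * ?\<psi> x \<partial>lborel) - c * M"
      unfolding left_diff_distrib[of _ c] M_def
      by (subst Bochner_Integration.integral_diff[OF bint integrable_mult_right[OF bint']])
        (simp only: Bochner_Integration.integral_mult_right_zero)
    ultimately show "(\<integral>x. (f' x - ?G x - c) * of_real (bump n a b x) \<partial>lborel) = 0" by simp
  qed measurable
  hence "AE x in lebesgue. f' x - ?G x - c = 0" by (rule AE_completion)
  hence "AE x in lebesgue. f x = ?G x + c" using ff' by eventually_elim (simp add: algebra_simps)
  moreover have "continuous_on UNIV (\<lambda>x. ?G x + c)" by (intro continuous_intros Gc)
  moreover have "cmod ((?G x + c) - (?G z + c)) \<le> sqrt (x - z) * L2_norm g" if "z \<le> x" for x z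
    using primitive_increment[OF g'2 that] by (simp add: norm_eq)
  ultimately show ?thesis by (intro that[of "\<lambda>x. ?G x + c"]) auto
qed

text \<open>Compare \<open>F x\<close> with the average of \<open>F\<close> over \<open>[x, x +
  1]\<close>: on an interval of length 1 the oscillation is at most \<open>B\<close>.\<close>
lemma L2_rep_pointwise_bound:
  assumes F: "continuous_on UNIV F" "F \<in> L2" and B: "0 \<le> B"
    and osc: "\<And>x z. z \<le> x \<Longrightarrow> cmod (F x - F z) \<le> sqrt (x - z) * B"
  shows "(cmod (F x))\<^sup>2 \<le> 2 * (L2_norm F)\<^sup>2 + 2 * B\<^sup>2"
proof -
  have pw: "(cmod (F x))\<^sup>2 \<le> 2 * (cmod (F y))\<^sup>2 + 2 * B\<^sup>2" if "y \<in> {x..x+1}" for y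
  proof -
    have "cmod (F x - F y) \<le> sqrt (y - x) * B" using osc[of x y] that by (simp add: norm_minus_commute)
    also have "\<dots> \<le> 1 * B" using that B by (intro mult_right_mono) auto
    finally have "(cmod (F x - F y))\<^sup>2 \<le> B\<^sup>2" by (intro power_mono) auto
    thus ?thesis using cmod_add_power2_le[of "F y" "F x - F y"] by simp
  qed
  have ind: "integrable lebesgue (indicat_real {x..x+1})" using emeasure_lborel_cbox_finite[of x "x+1"]
    by (auto intro!: integrable_real_indicator)
  have i: "integrable lebesgue (\<lambda>y. 2 * (cmod (F y))\<^sup>2 + 2 * B\<^sup>2 * indicat_real {x..x+1} y)"
    using L2D(2)[OF F(2)] ind by auto
  have "(cmod (F x))\<^sup>2 = (\<integral>y. (cmod (F x))\<^sup>2 * indicat_real {x..x+1} y \<partial>lebesgue)"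
    by simp
  also have "\<dots> \<le> (\<integral>y. 2 * (cmod (F y))\<^sup>2 + 2 * B\<^sup>2 * indicat_real {x..x+1} y \<partial>lebesgue)"
  proof (rule integral_mono)
    fix y show "(cmod (F x))\<^sup>2 * indicat_real {x..x+1} y \<le> 2 * (cmod (F y))\<^sup>2 + 2 * B\<^sup>2 * indicat_real {x..x+1} y"
      using pw[of y] by (cases "y \<in> {x..x+1}") auto
  qed (use i ind in auto)
  also have "\<dots> = 2 * (L2_norm F)\<^sup>2 + 2 * B\<^sup>2"
    using L2D(2)[OF F(2)] ind by (simp add: L2_norm_power2)
  finally show ?thesis .
qed

lemma continuous_AE_eq_imp_eq:
  fixes F G :: "real \<Rightarrow> complex"
  assumes "continuous_on UNIV F" "continuous_on UNIV G" "AE x in lebesgue. F x = G x"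
  shows "F = G"
proof
  fix x
  have "closed {x. F x = G x}" using assms by (intro closed_Collect_eq)
  thus "F x = G x" using mem_closed_if_AE_lebesgue[of "{x. F x = G x}" x] assms(3) by auto
qed

lemma H1_continuous_representative:
  assumes "f \<in> H1"
  obtains F where "continuous_on UNIV F" "AE x in lebesgue. f x = F x"
proof -
  have "f \<in> L2" using assms by (simp add: H1_def)
  from this weak_deriv_H1[OF assms] show ?thesis
    by (rule weak_derivative_imp_continuous_representative) (rule that)
qed

text \<open>Any continuous representative coincides with the one that has the Holder bound, so the
  Sobolev embedding holds for it.\<close>
lemma H1_sup_bound:
  assumes f: "f \<in> H1" and F: "continuous_on UNIV F" "AE x in lebesgue. f x = F x"
  shows "(cmod (F x))\<^sup>2 \<le> 2 * (H1_norm f)\<^sup>2"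
proof -
  have fL: "f \<in> L2" using f by (simp add: H1_def)
  from weak_derivative_imp_continuous_representative[OF fL weak_deriv_H1[OF f]]
  obtain G where G: "continuous_on UNIV G" "AE x in lebesgue. f x = G x"
    "\<And>x z. z \<le> x \<Longrightarrow> cmod (G x - G z) \<le> sqrt (x - z) * L2_norm (weak_deriv f)" by blast
  have "AE x in lebesgue. F x = G x" using F(2) G(2) by eventually_elim simp
  hence eq: "F = G" using continuous_AE_eq_imp_eq F(1) G(1) by blast
  have "F \<in> L2" using L2_cong_AE[OF F(2) fL] .
  hence "(cmod (F x))\<^sup>2 \<le> 2 * (L2_norm F)\<^sup>2 + 2 * (L2_norm (weak_deriv f))\<^sup>2"
    using L2_rep_pointwise_bound[OF F(1) _ L2_norm_nonneg] G(3) eq by blast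
  moreover have "L2_norm F = L2_norm f" using L2_norm_cong_AE[OF F(2)] L2D(1)[OF fL] by simp
  ultimately show ?thesis by (simp add: H1_norm_def)
qed

section \<open>From classical solutions to equations along characteristics\<close>

lemma has_vector_derivative_iff_quotient:
  fixes h :: "real \<Rightarrow> complex"
  shows "(h has_vector_derivative D) (at t within S) \<longleftrightarrow>
    ((\<lambda>s. (h s - h t) / of_real (s - t)) \<longlongrightarrow> D) (at t within S)"
proof -
  have ev: "\<forall>\<^sub>F s in at t within S. norm ((1 / norm (s - t)) *\<^sub>R (h s - (h t + (s - t) *\<^sub>R D)))
      = norm ((h s - h t) / of_real (s - t) - D)"
    unfolding eventually_at_filter
  proof (intro always_eventually allI impI)
    fix s assume "s \<noteq> t"
    hence "(h s - h t) / of_real (s - t) - D = (h s - (h t + (s - t) *\<^sub>R D)) / of_real (s - t)"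
      by (simp add: field_simps scaleR_conv_of_real)
    thus "norm ((1 / norm (s - t)) *\<^sub>R (h s - (h t + (s - t) *\<^sub>R D))) = norm ((h s - h t) / of_real (s - t) - D)"
      by (simp add: norm_divide del: of_real_diff)
  qed
  have "(h has_vector_derivative D) (at t within S) \<longleftrightarrow>
      ((\<lambda>s. norm ((1 / norm (s - t)) *\<^sub>R (h s - (h t + (s - t) *\<^sub>R D)))) \<longlongrightarrow> 0) (at t within S)"
    unfolding has_vector_derivative_def has_derivative_within tendsto_norm_zero_iff
    by (simp add: bounded_linear_scaleR_left)
  also have "\<dots> \<longleftrightarrow> ((\<lambda>s. norm ((h s - h t) / of_real (s - t) - D)) \<longlongrightarrow> 0) (at t within S)"
    by (rule tendsto_cong[OF ev])
  also have "\<dots> \<longleftrightarrow> ((\<lambda>s. (h s - h t) / of_real (s - t)) \<longlongrightarrow> D) (at t within S)"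
    unfolding tendsto_norm_zero_iff by (rule LIM_zero_iff)
  finally show ?thesis .
qed

lemma integral_lebesgue_eq_integral_support:
  fixes f :: "real \<Rightarrow> complex"
  assumes f: "continuous_on UNIV f" and supp: "\<And>x. x \<notin> {a..b} \<Longrightarrow> f x = 0"
  shows "(\<integral>x. f x \<partial>lebesgue) = integral {a..b} f" "(\<integral>x. f x \<partial>lborel) = integral {a..b} f"
    "integrable lborel f"
proof -
  have [measurable]: "f \<in> borel_measurable borel" using f by (rule borel_measurable_continuous_onI)
  have si: "set_integrable lborel {a..b} f"
    by (rule borel_integrable_atLeastAtMost') (auto intro: continuous_on_subset[OF f])
  have eq: "(\<lambda>x. indicator {a..b} x *\<^sub>R f x) = f"
  proof
    fix x show "indicator {a..b} x *\<^sub>R f x = f x" using supp[of x] by (cases "x \<in> {a..b}") auto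
  qed
  show "integrable lborel f" using si by (simp add: set_integrable_def eq)
  have "(\<integral>x. f x \<partial>lebesgue) = (\<integral>x. f x \<partial>lborel)" by (rule integral_completion) measurable
  moreover show "(\<integral>x. f x \<partial>lborel) = integral {a..b} f"
    using set_borel_integral_eq_integral(2)[OF si] by (simp add: set_lebesgue_integral_def eq)
  ultimately show "(\<integral>x. f x \<partial>lebesgue) = integral {a..b} f" by simp
qed

lemma continuous_on_bump: "continuous_on UNIV (\<lambda>x. complex_of_real (bump n a b x))"
  using Ck_bump Ck_imp_continuous by blast

lemma continuous_compose_bump:
  "continuous_on S f \<Longrightarrow> continuous_on S (\<lambda>x. complex_of_real (bump n a b (f x)))"
  using continuous_on_compose2[OF continuous_on_bump, of S f] by simp

lemma bump_L2: "(\<lambda>x. complex_of_real (bump n a b x)) \<in> L2"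
  by (rule test_function_L2(1)[OF bump_test_function])

lemma bump_L2_norm_le: "L2_norm (\<lambda>x. complex_of_real (bump n a b x)) \<le> sqrt \<bar>b - a\<bar>"
proof (cases "a \<le> b")
  case True
  have "L2_norm (\<lambda>x. complex_of_real (bump n a b x)) \<le> L2_norm (\<lambda>x. of_real (indicator {a..b} x))"
    unfolding L2_norm_def
  proof (intro real_sqrt_le_mono integral_mono)
    fix x show "(cmod (complex_of_real (bump n a b x)))\<^sup>2 \<le> (cmod (complex_of_real (indicat_real {a..b} x)))\<^sup>2"
      using bump_eq_0_iff[of n a b x] bump_le_1[of n a b x] bump_nonneg[of n a b x]
      by (intro power_mono) (auto simp: indicator_def)
  qed (use L2D[OF bump_L2[of n a b]] L2D[OF L2_indicator[of a b]] in auto)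
  thus ?thesis using L2_norm_indicator[OF True] True by simp
next
  case False
  hence "bump n a b x = 0" for x using bump_eq_0_iff[of n a b x] by auto
  thus ?thesis by (simp add: L2_norm_def)
qed

text \<open>The difference quotient splits into three parts: the difference quotient of \<open>u\<close>
  minus its limit, small in \<open>L\<^sup>2\<close> by hypothesis; the time derivative
  \<open>w t\<close> against the moved bump; and \<open>u t\<close> against the difference
  quotient of the moved bump. The last tends to \<open>- \<sigma>\<close> times the pairing
  with the derivative of the bump, which the weak derivative turns into \<open>+
  \<sigma>\<close> times the pairing of \<open>weak_deriv (u t)\<close>.\<close>
lemma pairing_with_moving_bump_derivative:
  fixes n :: nat and a b \<sigma> :: real
  assumes u: "has_L2_time_deriv u w" and H: "\<And>t. t \<ge> 0 \<Longrightarrow> u t \<in> H1" and t: "t \<ge> 0"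
  defines "\<phi> \<equiv> \<lambda>x. complex_of_real (bump n a b x)"
  shows "((\<lambda>t. \<integral>x. u t x * \<phi> (x - \<sigma> * t) \<partial>lebesgue) has_vector_derivative
     (\<integral>x. (w t x + of_real \<sigma> * weak_deriv (u t) x) * \<phi> (x - \<sigma> * t) \<partial>lebesgue)) (at t within {0..})"
proof (rule has_vector_derivative_iff_quotient[THEN iffD2], unfold tendsto_at_iff_sequentially, intro allI impI)
  let ?h = "\<lambda>t. \<integral>x. u t x * \<phi> (x - \<sigma> * t) \<partial>lebesgue"
  let ?D = "\<integral>x. (w t x + of_real \<sigma> * weak_deriv (u t) x) * \<phi> (x - \<sigma> * t) \<partial>lebesgue"
  fix s :: "nat \<Rightarrow> real" assume s: "\<forall>i. s i \<in> {0..} - {t}" and st: "s \<longlonglongrightarrow> t"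
  have s0: "s i \<ge> 0" and sne: "s i \<noteq> t" for i using s by auto
  have uL: "u t \<in> L2" if "t \<ge> 0" for t using u that by (auto simp: has_L2_time_deriv_def)
  have wL: "w t \<in> L2" using u t by (auto simp: has_L2_time_deriv_def)
  have shift: "\<phi> (x - \<sigma> * r) = complex_of_real (bump n (a + \<sigma> * r) (b + \<sigma> * r) x)" for x r
    by (simp add: \<phi>_def bump_shift)
  have \<phi>L: "(\<lambda>x. \<phi> (x - \<sigma> * r)) \<in> L2" for r
    unfolding shift by (rule bump_L2)
  have \<phi>T: "\<phi> \<in> test_functions UNIV" unfolding \<phi>_def by (rule bump_test_function)
  have \<phi>T': "(\<lambda>x. \<phi> (x - \<sigma> * t)) \<in> test_functions UNIV" unfolding shift by (rule bump_test_function)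
  obtain \<phi>' where \<phi>': "\<And>x. (\<phi> has_vector_derivative \<phi>' x) (at x)" "continuous_on UNIV \<phi>'" and \<phi>'0: "\<And>x. x \<notin> {a..b} \<Longrightarrow> \<phi>' x = 0"
  proof -
    have "vector_derivative \<phi> (at x) = 0" if "x \<notin> {a..b}" for x
    proof -
      have "open (- {a..b})" "x \<in> - {a..b}" using that by auto
      have "(\<phi> has_vector_derivative 0) (at x)"
        by (rule has_vector_derivative_transform_within_open[OF has_vector_derivative_const, of "- {a..b}" _ 0])
          (use bump_eq_0_iff that in \<open>auto simp: \<phi>_def\<close>)
      thus ?thesis by (rule vector_derivative_at)
    qed
    with test_function_real_derivative[OF \<phi>T] show ?thesis by (rule that)
  qed
  \<comment> \<open>Dominated convergence needs one Lipschitz constant for the bump and one interval that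
    contains the supports of all moved bumps.\<close>
  obtain L where L: "L \<ge> 0" "\<And>x y. cmod (\<phi> x - \<phi> y) \<le> L * \<bar>x - y\<bar>"
  proof -
    have "bounded (\<phi>' ` {a..b})"
      by (intro compact_imp_bounded compact_continuous_image continuous_on_subset[OF \<phi>'(2)]) auto
    then obtain B where "\<forall>y\<in>\<phi>' ` {a..b}. cmod y \<le> B" unfolding bounded_iff by blast
    hence B: "cmod (\<phi>' x) \<le> B" if "x \<in> {a..b}" for x using that by blast
    have B': "cmod (\<phi>' x) \<le> max B 0" for x using B[of x] \<phi>'0[of x] by (cases "x \<in> {a..b}") auto
    have "norm (\<phi> x - \<phi> y) \<le> max B 0 * norm (x - y)" for x y
    proof (rule differentiable_bound[of UNIV \<phi> "\<lambda>x h. h *\<^sub>R \<phi>' x"])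
      show "(\<phi> has_derivative (\<lambda>h. h *\<^sub>R \<phi>' x)) (at x within UNIV)" for x
        using \<phi>'(1)[of x] by (simp add: has_vector_derivative_def)
      show "onorm (\<lambda>h. h *\<^sub>R \<phi>' x) \<le> max B 0" for x
        by (rule onorm_le) (unfold norm_scaleR mult.commute[of "max B 0"] real_norm_def, intro mult_left_mono B' abs_ge_zero)
    qed auto
    thus ?thesis using that[of "max B 0"] by simp
  qed
  obtain S where S: "\<And>i. \<bar>s i\<bar> \<le> S"
  proof -
    have "Bseq s" using st convergent_imp_Bseq convergentI by blast
    thus ?thesis using that by (auto simp: Bseq_def)
  qed
  hence tS: "\<bar>t\<bar> \<le> S" using LIMSEQ_le_const2[OF tendsto_rabs[OF st]] by blast
  define R where "R = \<bar>a\<bar> + \<bar>b\<bar> + \<bar>\<sigma>\<bar> * S"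
  have out: "x - \<sigma> * r \<notin> {a..b}" if "x \<notin> {-R..R}" "\<bar>r\<bar> \<le> S" for x r
  proof
    assume "x - \<sigma> * r \<in> {a..b}"
    moreover have "\<bar>\<sigma> * r\<bar> \<le> \<bar>\<sigma>\<bar> * S" using that(2) by (simp add: abs_mult mult_left_mono)
    ultimately show False using that(1) by (auto simp: R_def)
  qed
  have \<phi>0: "\<phi> (x - \<sigma> * r) = 0" if "x \<notin> {-R..R}" "\<bar>r\<bar> \<le> S" for x r
    using out[OF that] bump_eq_0_iff[of n a b "x - \<sigma> * r"] by (auto simp: \<phi>_def)
  let ?I = "\<lambda>x. indicat_real {-R..R} x"
  have T1: "(\<lambda>i. \<integral>x. ((u (s i) x - u t x) / of_real (s i - t) - w t x) * \<phi> (x - \<sigma> * s i) \<partial>lebesgue) \<longlonglongrightarrow> 0"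
  proof (rule tendsto_norm_zero_cancel, rule tendsto_sandwich[OF _ _ tendsto_const])
    have "((\<lambda>s. L2_norm (\<lambda>x. (u s x - u t x) / of_real (s - t) - w t x)) \<longlongrightarrow> 0) (at t within {0..})"
      using u t by (auto simp: has_L2_time_deriv_def)
    hence "(\<lambda>i. L2_norm (\<lambda>x. (u (s i) x - u t x) / of_real (s i - t) - w t x)) \<longlonglongrightarrow> 0"
      using s st unfolding tendsto_at_iff_sequentially by (auto simp: o_def)
    from tendsto_mult_right[OF this, of "sqrt \<bar>b - a\<bar>"]
    show "(\<lambda>i. L2_norm (\<lambda>x. (u (s i) x - u t x) / of_real (s i - t) - w t x) * sqrt \<bar>b - a\<bar>) \<longlonglongrightarrow> 0"
      by (simp add: mult.commute)
    show "\<forall>\<^sub>F i in sequentially. cmod (\<integral>x. ((u (s i) x - u t x) / of_real (s i - t) - w t x) * \<phi> (x - \<sigma> * s i) \<partial>lebesgue)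
        \<le> L2_norm (\<lambda>x. (u (s i) x - u t x) / of_real (s i - t) - w t x) * sqrt \<bar>b - a\<bar>"
    proof (rule always_eventually, rule allI)
      fix i
      have L: "(\<lambda>x. (u (s i) x - u t x) / of_real (s i - t) - w t x) \<in> L2"
        using L2_diff[OF L2_scale[OF L2_diff[OF uL[OF s0[of i]] uL[OF t]], of "1 / of_real (s i - t)"] wL] by simp
      have "L2_norm (\<lambda>x. \<phi> (x - \<sigma> * s i)) \<le> sqrt \<bar>b - a\<bar>"
        unfolding shift using bump_L2_norm_le[of n "a + \<sigma> * s i" "b + \<sigma> * s i"] by simp
      with L2_Cauchy_Schwarz[OF L \<phi>L[of "s i"]] L2_norm_nonneg
      show "cmod (\<integral>x. ((u (s i) x - u t x) / of_real (s i - t) - w t x) * \<phi> (x - \<sigma> * s i) \<partial>lebesgue)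
        \<le> L2_norm (\<lambda>x. (u (s i) x - u t x) / of_real (s i - t) - w t x) * sqrt \<bar>b - a\<bar>"
        by (meson mult_left_mono order_trans)
    qed
  qed auto
  have T2: "(\<lambda>i. \<integral>x. w t x * \<phi> (x - \<sigma> * s i) \<partial>lebesgue) \<longlonglongrightarrow> (\<integral>x. w t x * \<phi> (x - \<sigma> * t) \<partial>lebesgue)"
  proof (rule integral_dominated_convergence[where w="\<lambda>x. norm (?I x *\<^sub>R w t x)"])
    show "integrable lebesgue (\<lambda>x. norm (?I x *\<^sub>R w t x))"
      by (intro integrable_norm L2_mult_indicator_integrable wL)
    show "AE x in lebesgue. (\<lambda>i. w t x * \<phi> (x - \<sigma> * s i)) \<longlonglongrightarrow> w t x * \<phi> (x - \<sigma> * t)"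
      unfolding \<phi>_def
      by (intro AE_I2 tendsto_intros continuous_on_tendsto_compose[OF continuous_on_bump] st) auto
    fix i
    show "AE x in lebesgue. norm (w t x * \<phi> (x - \<sigma> * s i)) \<le> norm (?I x *\<^sub>R w t x)"
    proof (rule AE_I2)
      fix x
      have "cmod (\<phi> (x - \<sigma> * s i)) \<le> 1" using bump_le_1 bump_nonneg by (simp add: \<phi>_def)
      thus "norm (w t x * \<phi> (x - \<sigma> * s i)) \<le> norm (?I x *\<^sub>R w t x)"
        using \<phi>0[OF _ S[of i], of x] by (cases "x \<in> {-R..R}") (auto simp: norm_mult mult_left_le)
    qed
  qed (use L2_mult_integrable[OF wL \<phi>L] in auto)
  have T3: "(\<lambda>i. \<integral>x. u t x * ((\<phi> (x - \<sigma> * s i) - \<phi> (x - \<sigma> * t)) / of_real (s i - t)) \<partial>lebesgue)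
      \<longlonglongrightarrow> (\<integral>x. u t x * (- of_real \<sigma> * \<phi>' (x - \<sigma> * t)) \<partial>lebesgue)"
  proof (rule integral_dominated_convergence[where w="\<lambda>x. (L * \<bar>\<sigma>\<bar>) * norm (?I x *\<^sub>R u t x)"])
    show "integrable lebesgue (\<lambda>x. (L * \<bar>\<sigma>\<bar>) * norm (?I x *\<^sub>R u t x))"
      by (intro integrable_mult_right integrable_norm L2_mult_indicator_integrable uL t)
    show "AE x in lebesgue. (\<lambda>i. u t x * ((\<phi> (x - \<sigma> * s i) - \<phi> (x - \<sigma> * t)) / of_real (s i - t))) \<longlonglongrightarrow>
        u t x * (- of_real \<sigma> * \<phi>' (x - \<sigma> * t))"
    proof (rule AE_I2, rule tendsto_mult_left)
      fix x
      have "((\<lambda>r. \<phi> (x - \<sigma> * r)) has_vector_derivative (- \<sigma>) *\<^sub>R \<phi>' (x - \<sigma> * t)) (at t)"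
        using vector_diff_chain_at[of "\<lambda>r. x - \<sigma> * r" "- \<sigma>" t \<phi> "\<phi>' (x - \<sigma> * t)"] \<phi>'(1)
        by (force intro!: derivative_eq_intros simp: o_def has_real_derivative_iff_has_vector_derivative[symmetric])
      hence "((\<lambda>r. (\<phi> (x - \<sigma> * r) - \<phi> (x - \<sigma> * t)) / of_real (r - t)) \<longlongrightarrow> (- \<sigma>) *\<^sub>R \<phi>' (x - \<sigma> * t)) (at t)"
        by (rule has_vector_derivative_iff_quotient[THEN iffD1])
      hence "(\<lambda>i. (\<phi> (x - \<sigma> * s i) - \<phi> (x - \<sigma> * t)) / of_real (s i - t)) \<longlonglongrightarrow> (- \<sigma>) *\<^sub>R \<phi>' (x - \<sigma> * t)"
        using s st unfolding tendsto_at_iff_sequentially by (auto simp: o_def)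
      thus "(\<lambda>i. (\<phi> (x - \<sigma> * s i) - \<phi> (x - \<sigma> * t)) / of_real (s i - t)) \<longlonglongrightarrow> - of_real \<sigma> * \<phi>' (x - \<sigma> * t)"
        by (simp add: scaleR_conv_of_real)
    qed
    have cont: "continuous_on UNIV (\<lambda>x. \<phi>' (x - \<sigma> * t))"
      by (intro continuous_on_compose2[OF \<phi>'(2)] continuous_intros) auto
    have "(\<lambda>x. \<phi>' (x - \<sigma> * t)) \<in> L2"
      by (rule continuous_compact_support_L2[OF cont, of "-R" R]) (use out[OF _ tS] \<phi>'0 in auto)
    from L2_mult_integrable[OF uL[OF t] L2_scale[OF this, of "- of_real \<sigma>"]]
    show "(\<lambda>x. u t x * (- of_real \<sigma> * \<phi>' (x - \<sigma> * t))) \<in> borel_measurable lebesgue" by auto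
    fix i
    show "(\<lambda>x. u t x * ((\<phi> (x - \<sigma> * s i) - \<phi> (x - \<sigma> * t)) / of_real (s i - t))) \<in> borel_measurable lebesgue"
      using L2_mult_integrable[OF uL[OF t] L2_scale[OF L2_diff[OF \<phi>L[of "s i"] \<phi>L[of t]], of "1 / of_real (s i - t)"]] by auto
    show "AE x in lebesgue. norm (u t x * ((\<phi> (x - \<sigma> * s i) - \<phi> (x - \<sigma> * t)) / of_real (s i - t)))
        \<le> (L * \<bar>\<sigma>\<bar>) * norm (?I x *\<^sub>R u t x)"
    proof (rule AE_I2)
      fix x
      have "cmod (\<phi> (x - \<sigma> * s i) - \<phi> (x - \<sigma> * t)) \<le> L * \<bar>(x - \<sigma> * s i) - (x - \<sigma> * t)\<bar>" by (rule L(2))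
      also have "\<bar>(x - \<sigma> * s i) - (x - \<sigma> * t)\<bar> = \<bar>\<sigma>\<bar> * \<bar>s i - t\<bar>"
        by (simp add: abs_mult[symmetric] algebra_simps abs_minus_commute)
      finally have "cmod ((\<phi> (x - \<sigma> * s i) - \<phi> (x - \<sigma> * t)) / of_real (s i - t)) \<le> L * \<bar>\<sigma>\<bar>"
        using sne[of i] by (simp add: norm_divide divide_le_eq mult.assoc del: of_real_diff)
      hence "cmod (u t x) * cmod ((\<phi> (x - \<sigma> * s i) - \<phi> (x - \<sigma> * t)) / of_real (s i - t)) \<le> cmod (u t x) * (L * \<bar>\<sigma>\<bar>)"
        by (intro mult_left_mono) auto
      thus "norm (u t x * ((\<phi> (x - \<sigma> * s i) - \<phi> (x - \<sigma> * t)) / of_real (s i - t)))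
        \<le> (L * \<bar>\<sigma>\<bar>) * norm (?I x *\<^sub>R u t x)"
        using \<phi>0[OF _ S[of i], of x] \<phi>0[OF _ tS, of x]
        by (cases "x \<in> {-R..R}") (simp_all del: of_real_diff add: norm_mult norm_divide mult.commute)
    qed
  qed
  have quot: "(?h (s i) - ?h t) / of_real (s i - t) =
     (\<integral>x. ((u (s i) x - u t x) / of_real (s i - t) - w t x) * \<phi> (x - \<sigma> * s i) \<partial>lebesgue)
     + (\<integral>x. w t x * \<phi> (x - \<sigma> * s i) \<partial>lebesgue)
     + (\<integral>x. u t x * ((\<phi> (x - \<sigma> * s i) - \<phi> (x - \<sigma> * t)) / of_real (s i - t)) \<partial>lebesgue)" for i
  proof -
    let ?r = "complex_of_real (s i - t)"
    have nz: "?r \<noteq> 0" using sne by simp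
    have split: "(a * p' - b * p) / r = ((a - b) / r - c) * p' + c * p' + b * ((p' - p) / r)"
      if "r \<noteq> 0" for a b c p p' r :: complex using that by (simp add: field_simps)
    have L: "(\<lambda>x. (u (s i) x - u t x) / ?r - w t x) \<in> L2"
      using L2_diff[OF L2_scale[OF L2_diff[OF uL[OF s0[of i]] uL[OF t]], of "1 / ?r"] wL] by simp
    have L': "(\<lambda>x. (\<phi> (x - \<sigma> * s i) - \<phi> (x - \<sigma> * t)) / ?r) \<in> L2"
      using L2_scale[OF L2_diff[OF \<phi>L[of "s i"] \<phi>L[of t]], of "1 / ?r"] by simp
    note ints = L2_mult_integrable[OF L \<phi>L[of "s i"]] L2_mult_integrable[OF wL \<phi>L[of "s i"]] L2_mult_integrable[OF uL[OF t] L']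
      L2_mult_integrable[OF uL[OF s0[of i]] \<phi>L[of "s i"]] L2_mult_integrable[OF uL[OF t] \<phi>L[of t]]
    have "(?h (s i) - ?h t) / ?r = (\<integral>x. (u (s i) x * \<phi> (x - \<sigma> * s i) - u t x * \<phi> (x - \<sigma> * t)) / ?r \<partial>lebesgue)"
      using ints by simp
    also have "\<dots> = (\<integral>x. ((u (s i) x - u t x) / ?r - w t x) * \<phi> (x - \<sigma> * s i)
        + w t x * \<phi> (x - \<sigma> * s i) + u t x * ((\<phi> (x - \<sigma> * s i) - \<phi> (x - \<sigma> * t)) / ?r) \<partial>lebesgue)"
      by (intro Bochner_Integration.integral_cong refl split[OF nz])
    finally show ?thesis using ints by (simp only: Bochner_Integration.integral_add Bochner_Integration.integrable_add)
  qed
  have "(\<lambda>i. (?h (s i) - ?h t) / of_real (s i - t)) \<longlonglongrightarrow>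
     0 + (\<integral>x. w t x * \<phi> (x - \<sigma> * t) \<partial>lebesgue) + (\<integral>x. u t x * (- of_real \<sigma> * \<phi>' (x - \<sigma> * t)) \<partial>lebesgue)"
    unfolding quot by (intro tendsto_add T1 T2 T3)
  moreover have "(\<integral>x. u t x * (- of_real \<sigma> * \<phi>' (x - \<sigma> * t)) \<partial>lebesgue) = of_real \<sigma> * (\<integral>x. weak_deriv (u t) x * \<phi> (x - \<sigma> * t) \<partial>lebesgue)"
  proof -
    have "vector_derivative (\<lambda>x. \<phi> (x - \<sigma> * t)) (at x) = \<phi>' (x - \<sigma> * t)" for x
    proof (rule vector_derivative_at)
      show "((\<lambda>x. \<phi> (x - \<sigma> * t)) has_vector_derivative \<phi>' (x - \<sigma> * t)) (at x)"
        using vector_diff_chain_at[of "\<lambda>x. x - \<sigma> * t" 1 x \<phi> "\<phi>' (x - \<sigma> * t)"] \<phi>'(1)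
        by (force intro!: derivative_eq_intros simp: o_def has_real_derivative_iff_has_vector_derivative[symmetric])
    qed
    with weak_deriv_H1(2)[OF H[OF t]] \<phi>T'
    have "(\<integral>x. u t x * \<phi>' (x - \<sigma> * t) \<partial>lebesgue) = - (\<integral>x. weak_deriv (u t) x * \<phi> (x - \<sigma> * t) \<partial>lebesgue)"
      by (force simp: has_weak_deriv_def)
    moreover have "(\<integral>x. u t x * (- of_real \<sigma> * \<phi>' (x - \<sigma> * t)) \<partial>lebesgue) = (\<integral>x. - of_real \<sigma> * (u t x * \<phi>' (x - \<sigma> * t)) \<partial>lebesgue)"
      by (intro Bochner_Integration.integral_cong refl) (simp only: mult.left_commute)
    ultimately show ?thesis by simp
  qed
  moreover have "?D = (\<integral>x. w t x * \<phi> (x - \<sigma> * t) \<partial>lebesgue) + of_real \<sigma> * (\<integral>x. weak_deriv (u t) x * \<phi> (x - \<sigma> * t) \<partial>lebesgue)"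
    using L2_mult_integrable[OF wL \<phi>L[of t]] L2_mult_integrable[OF weak_deriv_H1(1)[OF H[OF t]] \<phi>L[of t]]
    by (simp add: distrib_right mult.assoc)
  ultimately show "((\<lambda>s. (?h s - ?h t) / of_real (s - t)) \<circ> s) \<longlonglongrightarrow> ?D"
    by (simp only: o_def add_0_left)
qed

text \<open>The equation \<open>u\<^sub>t + \<sigma> u\<^sub>x = g\<close> for \<open>t \<ge> 0\<close>,
  read along the characteristics of speed \<open>\<sigma>\<close>; neither partial derivative
  of \<open>u\<close> needs to exist.\<close>
definition transported :: "real \<Rightarrow> (real \<Rightarrow> real \<Rightarrow> complex) \<Rightarrow> (real \<Rightarrow> real \<Rightarrow> complex) \<Rightarrow> bool" where
  "transported \<sigma> u g \<longleftrightarrow> (\<forall>t\<ge>0. \<forall>x.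
     ((\<lambda>s. u s (x + \<sigma> * s)) has_vector_derivative g t (x + \<sigma> * t)) (at t within {0..}))"

lemma continuous_along_curve:
  fixes f :: "real \<Rightarrow> real \<Rightarrow> 'b::topological_space"
  assumes "continuous_on UNIV (\<lambda>(t, x). f t x)" "continuous_on S p" "continuous_on S q"
  shows "continuous_on S (\<lambda>z. f (p z) (q z))"
  using continuous_on_compose2[OF assms(1) continuous_on_Pair[OF assms(2,3)]] by simp

text \<open>Pair the \<open>L\<^sup>2\<close>-valued map with a bump that moves at speed
  \<open>\<sigma>\<close>. The time derivative of the pairing is the pairing of
  \<open>G\<close>; integrating in time and exchanging the integrals shows that the continuous
  function \<open>U T (x + \<sigma> T) - U 0 x - \<integral> G t (x + \<sigma> t) dt\<close>
  is orthogonal to all bumps, hence zero for every \<open>x\<close>. The fundamental theorem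
  of calculus then gives the differential equation.\<close>
lemma transportedI_weak:
  fixes u w :: "real \<Rightarrow> real \<Rightarrow> complex"
  assumes u: "has_L2_time_deriv u w" and H: "\<And>t. t \<ge> 0 \<Longrightarrow> u t \<in> H1"
    and U: "continuous_on UNIV (\<lambda>(t, x). U t x)" "\<And>t. t \<ge> 0 \<Longrightarrow> AE x in lebesgue. u t x = U t x"
    and G: "continuous_on UNIV (\<lambda>(t, x). G t x)"
      "\<And>t. t \<ge> 0 \<Longrightarrow> AE x in lebesgue. w t x + of_real \<sigma> * weak_deriv (u t) x = G t x"
  shows "transported \<sigma> U G"
proof -
  note [continuous_intros] = continuous_along_curve[OF U(1)] continuous_along_curve[OF G(1)]
  have key: "U T (x + \<sigma> * T) - U 0 x = integral {0..T} (\<lambda>t. G t (x + \<sigma> * t))" if T: "T \<ge> 0" for T x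
  proof -
    define E where "E x = U T (x + \<sigma> * T) - U 0 x - integral {0..T} (\<lambda>t. G t (x + \<sigma> * t))" for x
    have "continuous_on UNIV (\<lambda>x. integral (cbox 0 T) (\<lambda>t. G t (x + \<sigma> * t)))"
      by (rule integral_continuous_on_param) (auto intro!: continuous_intros simp: case_prod_unfold)
    hence Ic: "continuous_on UNIV (\<lambda>x. integral {0..T} (\<lambda>t. G t (x + \<sigma> * t)))" by simp
    have Ec: "continuous_on UNIV E" unfolding E_def by (intro continuous_intros Ic)
    have "AE x in lborel. E x = 0"
    proof (rule AE_zero_if_bump_integrals_zero)
      show "E \<in> borel_measurable borel" using Ec by (rule borel_measurable_continuous_onI)
      fix R show "integrable lborel (\<lambda>x. indicat_real {- R..R} x *\<^sub>R E x)"
        using borel_integrable_atLeastAtMost'[of "-R" R E] continuous_on_subset[OF Ec] by (simp add: set_integrable_def)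
    next
      fix n a b
      let ?\<phi> = "\<lambda>x. complex_of_real (bump n a b x)"
      have \<phi>0: "?\<phi> x = 0" if "x \<notin> {a..b}" for x using that bump_eq_0_iff[of n a b x] by auto
      define h where "h t = (\<integral>x. u t x * ?\<phi> (x - \<sigma> * t) \<partial>lebesgue)" for t
      have conv: "(\<integral>x. f x * ?\<phi> (x - \<sigma> * t) \<partial>lebesgue) = integral {a..b} (\<lambda>x. F t (x + \<sigma> * t) * ?\<phi> x)"
        if F: "continuous_on UNIV (\<lambda>(t, x). F t x)" and ae: "AE x in lebesgue. f x = F t x"
          and m: "(\<lambda>x. f x * ?\<phi> (x - \<sigma> * t)) \<in> borel_measurable lebesgue" for F f t
      proof -
        note [continuous_intros] = continuous_along_curve[OF F]
        have "(\<integral>x. f x * ?\<phi> (x - \<sigma> * t) \<partial>lebesgue) = (\<integral>x. F t x * ?\<phi> (x - \<sigma> * t) \<partial>lebesgue)"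
        proof -
          have ae': "AE x in lebesgue. f x * ?\<phi> (x - \<sigma> * t) = F t x * ?\<phi> (x - \<sigma> * t)"
            using ae by eventually_elim simp
          show ?thesis by (rule integral_cong_AE[OF m borel_measurable_AE[OF m ae'] ae'])
        qed
        also have "\<dots> = (\<integral>x. F t x * ?\<phi> (x - \<sigma> * t) \<partial>lborel)"
          by (rule integral_completion)
            (auto intro!: borel_measurable_continuous_onI continuous_intros continuous_compose_bump)
        also have "\<dots> = (\<integral>x. F t (\<sigma> * t + 1 * x) * ?\<phi> ((\<sigma> * t + 1 * x) - \<sigma> * t) \<partial>lborel)"
          by (subst lborel_integral_real_affine[of 1 _ "\<sigma> * t"]) auto
        also have "\<dots> = (\<integral>x. F t (x + \<sigma> * t) * ?\<phi> x \<partial>lborel)" by (simp add: add.commute)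
        also have "\<dots> = integral {a..b} (\<lambda>x. F t (x + \<sigma> * t) * ?\<phi> x)"
          by (rule integral_lebesgue_eq_integral_support(2))
            (use \<phi>0 in \<open>auto intro!: continuous_intros continuous_compose_bump\<close>)
        finally show ?thesis .
      qed
      have bs: "?\<phi> (x - \<sigma> * t) = complex_of_real (bump n (a + \<sigma> * t) (b + \<sigma> * t) x)" for x t
        by (simp add: bump_shift)
      have \<phi>L: "(\<lambda>x. ?\<phi> (x - \<sigma> * t)) \<in> L2" for t unfolding bs by (rule bump_L2)
      have uL: "u t \<in> L2" and wL: "w t \<in> L2" if "t \<ge> 0" for t using u that by (auto simp: has_L2_time_deriv_def)
      have hU: "h t = integral {a..b} (\<lambda>x. U t (x + \<sigma> * t) * ?\<phi> x)" if "t \<ge> 0" for t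
        unfolding h_def using L2_mult_integrable[OF uL[OF that] \<phi>L] by (intro conv U that) auto
      have "(h has_vector_derivative integral {a..b} (\<lambda>x. G t (x + \<sigma> * t) * ?\<phi> x)) (at t within {0..T})" if "t \<in> {0..T}" for t
      proof (rule has_vector_derivative_within_subset)
        have t: "t \<ge> 0" using that by simp
        have gL: "(\<lambda>x. w t x + of_real \<sigma> * weak_deriv (u t) x) \<in> L2"
          using t by (intro L2_add L2_scale wL weak_deriv_H1 H)
        have "(\<integral>x. (w t x + of_real \<sigma> * weak_deriv (u t) x) * ?\<phi> (x - \<sigma> * t) \<partial>lebesgue)
           = integral {a..b} (\<lambda>x. G t (x + \<sigma> * t) * ?\<phi> x)"
          using L2_mult_integrable[OF gL \<phi>L] by (intro conv G t) auto
        thus "(h has_vector_derivative integral {a..b} (\<lambda>x. G t (x + \<sigma> * t) * ?\<phi> x)) (at t within {0..})"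
          using pairing_with_moving_bump_derivative[OF u H t, where n=n and a=a and b=b and \<sigma>=\<sigma>] by (simp add: h_def[abs_def])
      qed auto
      hence "((\<lambda>t. integral {a..b} (\<lambda>x. G t (x + \<sigma> * t) * ?\<phi> x)) has_integral (h T - h 0)) {0..T}"
        using T by (intro fundamental_theorem_of_calculus) auto
      hence "h T - h 0 = integral (cbox 0 T) (\<lambda>t. integral (cbox a b) (\<lambda>x. G t (x + \<sigma> * t) * ?\<phi> x))"
        by (simp add: integral_unique)
      also have "\<dots> = integral (cbox a b) (\<lambda>x. integral (cbox 0 T) (\<lambda>t. G t (x + \<sigma> * t) * ?\<phi> x))"
        by (rule integral_swap_continuous)
          (auto intro!: continuous_intros continuous_compose_bump simp: case_prod_unfold)
      also have "\<dots> = integral {a..b} (\<lambda>x. integral {0..T} (\<lambda>t. G t (x + \<sigma> * t)) * ?\<phi> x)"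
        by simp
      finally have hh: "h T - h 0 = integral {a..b} (\<lambda>x. integral {0..T} (\<lambda>t. G t (x + \<sigma> * t)) * ?\<phi> x)" .
      have "(\<integral>x. E x * ?\<phi> x \<partial>lborel) = integral {a..b} (\<lambda>x. E x * ?\<phi> x)"
        by (rule integral_lebesgue_eq_integral_support(2))
          (use \<phi>0 in \<open>auto intro!: continuous_intros continuous_compose_bump Ec\<close>)
      also have "\<dots> = integral {a..b} (\<lambda>x. U T (x + \<sigma> * T) * ?\<phi> x) - integral {a..b} (\<lambda>x. U 0 x * ?\<phi> x)
          - integral {a..b} (\<lambda>x. integral {0..T} (\<lambda>t. G t (x + \<sigma> * t)) * ?\<phi> x)"
        unfolding E_def left_diff_distrib
        by (subst Henstock_Kurzweil_Integration.integral_diff,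
            (intro integrable_continuous_interval continuous_intros continuous_compose_bump continuous_on_subset[OF Ic]; simp)+)+
           simp
      also have "\<dots> = 0" using hh hU[OF T] hU[of 0] by simp
      finally show "(\<integral>x. E x * ?\<phi> x \<partial>lborel) = 0" .
    qed
    hence "AE x in lebesgue. E x = 0" by (rule AE_completion)
    hence "E = (\<lambda>x. 0)" by (intro continuous_AE_eq_imp_eq Ec continuous_on_const)
    hence "E x = 0" by metis
    thus ?thesis by (simp add: E_def)
  qed
  show ?thesis unfolding transported_def
  proof (intro allI impI)
    fix t x :: real assume t: "t \<ge> 0"
    have "((\<lambda>s. integral {0..s} (\<lambda>t. G t (x + \<sigma> * t))) has_vector_derivative G t (x + \<sigma> * t)) (at t within {0..t+1})"
      using t by (intro integral_has_vector_derivative continuous_intros) auto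
    hence "((\<lambda>s. U 0 x + integral {0..s} (\<lambda>t. G t (x + \<sigma> * t))) has_vector_derivative G t (x + \<sigma> * t)) (at t within {0..t+1})"
      by (auto intro!: derivative_eq_intros)
    moreover have "at t within {0..t+1} = at t within {0..}"
      by (rule at_within_nhd[of _ "{..<t+1}"]) auto
    ultimately have "((\<lambda>s. U 0 x + integral {0..s} (\<lambda>t. G t (x + \<sigma> * t))) has_vector_derivative G t (x + \<sigma> * t)) (at t within {0..})"
      by simp
    thus "((\<lambda>s. U s (x + \<sigma> * s)) has_vector_derivative G t (x + \<sigma> * t)) (at t within {0..})"
      by (rule has_vector_derivative_transform[rotated 2]) (use key t in \<open>auto simp: algebra_simps\<close>)
  qed
qed

lemma transported_integral:
  assumes "transported \<sigma> u g" "0 \<le> r" "r \<le> t"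
  shows "((\<lambda>s. g s (x + \<sigma> * s)) has_integral u t (x + \<sigma> * t) - u r (x + \<sigma> * r)) {r..t}"
proof (rule fundamental_theorem_of_calculus)
  fix s assume "s \<in> {r..t}"
  with assms have "((\<lambda>s. u s (x + \<sigma> * s)) has_vector_derivative g s (x + \<sigma> * s)) (at s within {0..})"
    by (auto simp: transported_def)
  thus "((\<lambda>s. u s (x + \<sigma> * s)) has_vector_derivative g s (x + \<sigma> * s)) (at s within {r..t})"
    by (rule has_vector_derivative_within_subset) (use assms in auto)
qed (use assms in auto)

lemma L2_norm_add_power2:
  assumes "f \<in> L2" "g \<in> L2"
  shows "(L2_norm (\<lambda>x. f x + g x))\<^sup>2 \<le> 2 * (L2_norm f)\<^sup>2 + 2 * (L2_norm g)\<^sup>2"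
proof -
  have "(L2_norm (\<lambda>x. f x + g x))\<^sup>2 \<le> (\<integral>x. 2 * (cmod (f x))\<^sup>2 + 2 * (cmod (g x))\<^sup>2 \<partial>lebesgue)"
    unfolding L2_norm_power2
    by (rule integral_mono) (use L2D(2)[OF L2_add[OF assms]] L2D(2)[OF assms(1)] L2D(2)[OF assms(2)] cmod_add_power2_le in auto)
  also have "\<dots> = 2 * (L2_norm f)\<^sup>2 + 2 * (L2_norm g)\<^sup>2"
    using L2D(2)[OF assms(1)] L2D(2)[OF assms(2)] by (simp add: L2_norm_power2)
  finally show ?thesis .
qed

lemma L2_norm_le_H1_norm: "L2_norm f \<le> H1_norm f"
  unfolding H1_norm_def using L2_norm_nonneg by (intro real_le_rsqrt) simp

text \<open>Compactness of the interval, in the form of repeated bisection.\<close>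
lemma locally_bounded_imp_bounded_on_interval:
  fixes f :: "real \<Rightarrow> real"
  assumes loc: "\<And>t. t \<ge> 0 \<Longrightarrow> \<exists>d>0. \<exists>K. \<forall>s\<ge>0. \<bar>s - t\<bar> < d \<longrightarrow> f s \<le> K"
  shows "\<exists>K. \<forall>t\<in>{0..T}. f t \<le> K"
proof (cases "0 \<le> T")
  case True
  have "\<exists>K. \<forall>t\<in>{0..T}. 0 \<le> t \<longrightarrow> f t \<le> K"
  proof (rule Bolzano[OF True, of "\<lambda>a b. \<exists>K. \<forall>t\<in>{a..b}. 0 \<le> t \<longrightarrow> f t \<le> K"])
    fix a b c :: real
    assume "\<exists>K. \<forall>t\<in>{a..b}. 0 \<le> t \<longrightarrow> f t \<le> K" "\<exists>K. \<forall>t\<in>{b..c}. 0 \<le> t \<longrightarrow> f t \<le> K"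
    then obtain K L where KL: "\<forall>t\<in>{a..b}. 0 \<le> t \<longrightarrow> f t \<le> K" "\<forall>t\<in>{b..c}. 0 \<le> t \<longrightarrow> f t \<le> L" by blast
    have "f t \<le> max K L" if "t \<in> {a..c}" "0 \<le> t" for t
      using KL that by (cases "t \<le> b") (auto simp: le_max_iff_disj)
    thus "\<exists>K. \<forall>t\<in>{a..c}. 0 \<le> t \<longrightarrow> f t \<le> K" by blast
  next
    fix t :: real assume "0 \<le> t"
    then obtain d K where d: "d > 0" "\<forall>s\<ge>0. \<bar>s - t\<bar> < d \<longrightarrow> f s \<le> K" using loc by blast
    have "f s \<le> K" if "a \<le> t" "t \<le> b" "b - a < d" "s \<in> {a..b}" "0 \<le> s" for a b s
      using that by (intro d(2)[rule_format]) auto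
    thus "\<exists>d>0. \<forall>a b. a \<le> t \<and> t \<le> b \<and> b - a < d \<longrightarrow> (\<exists>K. \<forall>t\<in>{a..b}. 0 \<le> t \<longrightarrow> f t \<le> K)"
      using d(1) by blast
  qed
  thus ?thesis by auto
qed auto

text \<open>By the Sobolev embedding, continuity in time with values in \<open>H\<^sup>1\<close> makes
  the representatives vary continuously in the uniform norm, which together with their
  continuity in \<open>x\<close> gives joint continuity.\<close>
lemma H1_path_continuous_representative:
  assumes u: "u \<in> cont_time H1 H1_norm"
  obtains U where "continuous_on UNIV (\<lambda>(t, x). U t x)" "\<And>t. t \<ge> 0 \<Longrightarrow> AE x in lebesgue. u t x = U t x"
    "\<And>T. \<exists>K. \<forall>t\<in>{0..T}. (\<forall>x. cmod (U t x) \<le> K) \<and> (L2_norm (U t))\<^sup>2 \<le> K"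
proof -
  have H: "u t \<in> H1" if "t \<ge> 0" for t using u that by (auto simp: cont_time_def)
  hence "\<forall>t\<in>{0..}. \<exists>F. continuous_on UNIV F \<and> (AE x in lebesgue. u t x = F x)"
    by (metis H1_continuous_representative atLeast_iff)
  then obtain R where R: "\<And>t. t \<ge> 0 \<Longrightarrow> continuous_on UNIV (R t)" "\<And>t. t \<ge> 0 \<Longrightarrow> AE x in lebesgue. u t x = R t x"
    by (metis atLeast_iff)
  have near: "\<exists>d>0. \<forall>s\<ge>0. \<bar>s - t\<bar> < d \<longrightarrow> s \<noteq> t \<longrightarrow> H1_norm (\<lambda>x. u s x - u t x) < e" if "t \<ge> 0" "e > 0" for t e
  proof -
    have "((\<lambda>s. H1_norm (\<lambda>x. u s x - u t x)) \<longlongrightarrow> 0) (at t within {0..})" using u that by (auto simp: cont_time_def)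
    hence "\<forall>\<^sub>F s in at t within {0..}. H1_norm (\<lambda>x. u s x - u t x) < e"
      using \<open>e > 0\<close> by (rule order_tendstoD(2))
    thus ?thesis by (auto simp: eventually_at dist_real_def)
  qed
  have unif: "\<exists>d>0. \<forall>s\<ge>0. \<bar>s - t\<bar> < d \<longrightarrow> (\<forall>y. cmod (R s y - R t y) < e)" if "t \<ge> 0" "e > 0" for t e
  proof -
    have "e / 2 > 0" using that by simp
    from near[OF that(1) this] obtain d where d: "d > 0" "\<And>s. s \<ge> 0 \<Longrightarrow> \<bar>s - t\<bar> < d \<Longrightarrow> s \<noteq> t \<Longrightarrow> H1_norm (\<lambda>x. u s x - u t x) < e / 2" by blast
    have "cmod (R s y - R t y) < e" if s: "s \<ge> 0" "\<bar>s - t\<bar> < d" for s y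
    proof (cases "s = t")
      case False
      let ?N = "H1_norm (\<lambda>x. u s x - u t x)"
      have "AE x in lebesgue. u s x - u t x = R s x - R t x"
        using R(2)[OF s(1)] R(2)[OF \<open>t \<ge> 0\<close>] by eventually_elim simp
      from H1_sup_bound[OF H1_diff[OF H[OF s(1)] H[OF \<open>t \<ge> 0\<close>]] _ this]
      have "(cmod (R s y - R t y))\<^sup>2 \<le> 2 * ?N\<^sup>2"
        using R(1) s \<open>t \<ge> 0\<close> by (auto intro!: continuous_intros)
      also have "\<dots> < e\<^sup>2"
      proof -
        have "0 \<le> ?N" by (simp add: H1_norm_def)
        hence "?N\<^sup>2 < (e / 2)\<^sup>2" using d(2)[OF s False] by (intro power_strict_mono) auto
        moreover have "(e / 2)\<^sup>2 = e\<^sup>2 / 4" by (simp add: power_divide)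
        moreover have "0 \<le> ?N\<^sup>2" by simp
        ultimately show ?thesis by linarith
      qed
      finally show ?thesis using \<open>e > 0\<close> by (simp add: power_less_imp_less_base)
    qed (use \<open>e > 0\<close> in simp)
    thus ?thesis using d(1) by blast
  qed
  \<comment> \<open>Constant extension to negative times keeps the continuity statement on the whole
    plane.\<close>
  define U where "U t = R (max t 0)" for t
  have "continuous_on UNIV (\<lambda>(t, x). U t x)"
  proof (unfold continuous_on_iff, intro ballI allI impI, clarify)
    fix t x e :: real assume "e > 0"
    let ?t = "max t 0"
    obtain d where d: "d > 0" "\<And>s y. s \<ge> 0 \<Longrightarrow> \<bar>s - ?t\<bar> < d \<Longrightarrow> cmod (R s y - R ?t y) < e / 2"
      using unif[of ?t "e / 2"] \<open>e > 0\<close> by auto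
    obtain d' where d': "d' > 0" "\<And>y. dist y x < d' \<Longrightarrow> dist (R ?t y) (R ?t x) < e / 2"
      using R(1)[of ?t, unfolded continuous_on_iff, rule_format, of x "e / 2"] \<open>e > 0\<close> by auto
    show "\<exists>d>0. \<forall>x'\<in>UNIV. dist x' (t, x) < d \<longrightarrow> dist (case x' of (t, x) \<Rightarrow> U t x) (U t x) < e"
    proof (intro exI[of _ "min d d'"] conjI ballI impI)
      fix p :: "real \<times> real" assume p: "dist p (t, x) < min d d'"
      obtain s y where [simp]: "p = (s, y)" by (cases p)
      have "\<bar>s - t\<bar> < d" "dist y x < d'" using p dist_fst_le[of p "(t, x)"] dist_snd_le[of p "(t, x)"] by (auto simp: dist_real_def)
      moreover have "\<bar>max s 0 - ?t\<bar> \<le> \<bar>s - t\<bar>" by auto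
      ultimately have "dist (R (max s 0) y) (R ?t y) < e / 2" "dist (R ?t y) (R ?t x) < e / 2"
        using d(2)[of "max s 0" y] d'(2)[of y] by (auto simp: dist_norm)
      thus "dist (case p of (t, x) \<Rightarrow> U t x) (U t x) < e"
        using dist_triangle[of "R (max s 0) y" "R ?t x" "R ?t y"] by (simp add: U_def)
    qed (use d d' in auto)
  qed
  moreover have "AE x in lebesgue. u t x = U t x" if "t \<ge> 0" for t
    using R(2)[OF that] that by (simp add: U_def max_def)
  moreover have "\<exists>K. \<forall>t\<in>{0..T}. (\<forall>x. cmod (U t x) \<le> K) \<and> (L2_norm (U t))\<^sup>2 \<le> K" for T
  proof -
    let ?f = "\<lambda>t. (SUP x. cmod (R t x))"
    have pw: "cmod (R t x) \<le> sqrt (2 * (H1_norm (u t))\<^sup>2)" if "t \<ge> 0" for t x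
      using H1_sup_bound[OF H[OF that] R(1)[OF that] R(2)[OF that]] by (rule real_le_rsqrt)
    have bdd: "bdd_above (range (\<lambda>x. cmod (R t x)))" if "t \<ge> 0" for t
      using pw[OF that] by (intro bdd_aboveI) auto
    have 1: "\<exists>K. \<forall>t\<in>{0..T}. ?f t \<le> K"
    proof (rule locally_bounded_imp_bounded_on_interval)
      fix t :: real assume t: "t \<ge> 0"
      obtain d where d: "d > 0" "\<And>s y. s \<ge> 0 \<Longrightarrow> \<bar>s - t\<bar> < d \<Longrightarrow> cmod (R s y - R t y) < 1"
        using unif[OF t, of 1] by auto
      have "?f s \<le> sqrt (2 * (H1_norm (u t))\<^sup>2) + 1" if "s \<ge> 0" "\<bar>s - t\<bar> < d" for s
      proof (rule cSUP_least)
        fix x show "cmod (R s x) \<le> sqrt (2 * (H1_norm (u t))\<^sup>2) + 1"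
          using d(2)[OF that, of x] pw[OF t, of x] norm_triangle_sub[of "R s x" "R t x"] by linarith
      qed auto
      thus "\<exists>d>0. \<exists>K. \<forall>s\<ge>0. \<bar>s - t\<bar> < d \<longrightarrow> ?f s \<le> K" using d(1) by blast
    qed
    have 2: "\<exists>K. \<forall>t\<in>{0..T}. (L2_norm (u t))\<^sup>2 \<le> K"
    proof (rule locally_bounded_imp_bounded_on_interval)
      fix t :: real assume t: "t \<ge> 0"
      obtain d where d: "d > 0" "\<And>s. s \<ge> 0 \<Longrightarrow> \<bar>s - t\<bar> < d \<Longrightarrow> s \<noteq> t \<Longrightarrow> H1_norm (\<lambda>x. u s x - u t x) < 1"
        using near[OF t, of 1] by auto
      have "(L2_norm (u s))\<^sup>2 \<le> 2 * (L2_norm (u t))\<^sup>2 + 2" if s: "s \<ge> 0" "\<bar>s - t\<bar> < d" for s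
      proof (cases "s = t")
        case False
        have L: "u s \<in> L2" "u t \<in> L2" using H s t by (auto simp: H1_def)
        have "L2_norm (\<lambda>x. u s x - u t x) \<le> 1" using d(2)[OF s False] L2_norm_le_H1_norm[of "\<lambda>x. u s x - u t x"] by linarith
        hence "(L2_norm (\<lambda>x. u s x - u t x))\<^sup>2 \<le> 1\<^sup>2" using L2_norm_nonneg by (intro power_mono) auto
        thus ?thesis using L2_norm_add_power2[OF L(2) L2_diff[OF L]] by simp
      qed simp
      thus "\<exists>d>0. \<exists>K. \<forall>s\<ge>0. \<bar>s - t\<bar> < d \<longrightarrow> (L2_norm (u s))\<^sup>2 \<le> K" using d(1) by blast
    qed
    obtain K K' where K: "\<And>t. t \<in> {0..T} \<Longrightarrow> ?f t \<le> K" "\<And>t. t \<in> {0..T} \<Longrightarrow> (L2_norm (u t))\<^sup>2 \<le> K'" using 1 2 by blast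
    have "cmod (U t x) \<le> max K K'" "(L2_norm (U t))\<^sup>2 \<le> max K K'" if "t \<in> {0..T}" for t x
    proof -
      have [simp]: "max t 0 = t" using that by auto
      have "cmod (R t x) \<le> ?f t" using bdd that by (intro cSUP_upper) auto
      thus "cmod (U t x) \<le> max K K'" using K(1)[OF that] by (simp add: U_def)
      have "L2_norm (u t) = L2_norm (R t)" using R(2)[of t] H[of t] that by (intro L2_norm_cong_AE) (auto simp: H1_def L2_def)
      thus "(L2_norm (U t))\<^sup>2 \<le> max K K'" using K(2)[OF that] by (simp add: U_def)
    qed
    thus ?thesis by blast
  qed
  ultimately show ?thesis by (rule that)
qed

text \<open>The rate of change of the transported unknown \<open>a\<close>, that is, the equation
  divided by \<open>\<i>\<close>. The second equation has the same form with the roles of the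
  unknowns exchanged, since \<open>N2\<close> is \<open>N1\<close> with its arguments swapped.\<close>
definition rhs :: "real \<Rightarrow> (nat \<Rightarrow> complex) \<Rightarrow> complex \<Rightarrow> complex \<Rightarrow> complex" where
  "rhs m \<alpha> a b = \<i> * of_real m * b - \<i> * N1 \<alpha> a b"

lemma N2_eq_N1: "N2 \<beta> u v = N1 \<beta> v u"
  unfolding N1_def N2_def by (rule refl)

lemma continuous_on_rhs:
  assumes "continuous_on S f" "continuous_on S g"
  shows "continuous_on S (\<lambda>z. rhs m \<alpha> (f z) (g z))"
  unfolding rhs_def N1_def by (intro continuous_intros assms)

text \<open>What is kept of a classical solution. The last clause, boundedness on strips, justifies the
  exchanges of integrals and makes the envelopes square integrable.\<close>
definition characteristic_solution ::
    "real \<Rightarrow> (nat \<Rightarrow> complex) \<Rightarrow> (nat \<Rightarrow> complex) \<Rightarrow> (real \<Rightarrow> real \<Rightarrow> complex) \<Rightarrow> (real \<Rightarrow> real \<Rightarrow> complex) \<Rightarrow> bool" where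
  "characteristic_solution m \<alpha> \<beta> u v \<longleftrightarrow>
     continuous_on UNIV (\<lambda>(t, x). u t x) \<and> continuous_on UNIV (\<lambda>(t, x). v t x) \<and>
     transported 1 u (\<lambda>t x. rhs m \<alpha> (u t x) (v t x)) \<and>
     transported (-1) v (\<lambda>t x. rhs m \<beta> (v t x) (u t x)) \<and>
     (\<forall>t\<ge>0. u t \<in> L2 \<and> v t \<in> L2) \<and>
     (\<forall>T. \<exists>K. \<forall>t\<in>{0..T}. (\<forall>x. cmod (u t x) \<le> K \<and> cmod (v t x) \<le> K) \<and>
        (L2_norm (u t))\<^sup>2 \<le> K \<and> (L2_norm (v t))\<^sup>2 \<le> K)"

theorem classical_solution_has_characteristic_representative:
  assumes sol: "classical_solution m \<alpha> \<beta> u0 v0 u v"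
  obtains U V where "characteristic_solution m \<alpha> \<beta> U V"
    "\<And>t. t \<ge> 0 \<Longrightarrow> AE x in lebesgue. u t x = U t x" "\<And>t. t \<ge> 0 \<Longrightarrow> AE x in lebesgue. v t x = V t x"
proof -
  have uc: "u \<in> cont_time H1 H1_norm" and vc: "v \<in> cont_time H1 H1_norm"
    using sol by (auto simp: classical_solution_def)
  obtain ut vt where d: "has_L2_time_deriv u ut" "has_L2_time_deriv v vt"
    and eq1: "\<And>t. t \<ge> 0 \<Longrightarrow> AE x in lebesgue. \<i> * (ut t x + weak_deriv (u t) x) = - of_real m * v t x + N1 \<alpha> (u t x) (v t x)"
    and eq2: "\<And>t. t \<ge> 0 \<Longrightarrow> AE x in lebesgue. \<i> * (vt t x - weak_deriv (v t) x) = - of_real m * u t x + N2 \<beta> (u t x) (v t x)"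
    using sol unfolding classical_solution_def by blast
  obtain U where U: "continuous_on UNIV (\<lambda>(t, x). U t x)" "\<And>t. t \<ge> 0 \<Longrightarrow> AE x in lebesgue. u t x = U t x"
    "\<And>T. \<exists>K. \<forall>t\<in>{0..T}. (\<forall>x. cmod (U t x) \<le> K) \<and> (L2_norm (U t))\<^sup>2 \<le> K"
    by (rule H1_path_continuous_representative[OF uc]) (rule that)
  obtain V where V: "continuous_on UNIV (\<lambda>(t, x). V t x)" "\<And>t. t \<ge> 0 \<Longrightarrow> AE x in lebesgue. v t x = V t x"
    "\<And>T. \<exists>K. \<forall>t\<in>{0..T}. (\<forall>x. cmod (V t x) \<le> K) \<and> (L2_norm (V t))\<^sup>2 \<le> K"
    by (rule H1_path_continuous_representative[OF vc]) (rule that)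
  have H: "u t \<in> H1" "v t \<in> H1" if "t \<ge> 0" for t using uc vc that by (auto simp: cont_time_def)
  have rot: "z = \<i> * of_real m * b - \<i> * w" if "\<i> * z = - of_real m * b + w" for z b w :: complex
  proof -
    have "z = - \<i> * (\<i> * z)" by simp
    also have "\<dots> = \<i> * of_real m * b - \<i> * w" unfolding that by (simp add: algebra_simps)
    finally show ?thesis .
  qed
  have t1: "transported 1 U (\<lambda>t x. rhs m \<alpha> (U t x) (V t x))"
  proof (rule transportedI_weak[OF d(1) H(1) U(1,2)])
    show "continuous_on UNIV (\<lambda>(t, x). rhs m \<alpha> (U t x) (V t x))"
      unfolding case_prod_unfold using U(1) V(1) by (intro continuous_on_rhs) (simp_all add: case_prod_unfold)
    fix t :: real assume t: "t \<ge> 0"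
    show "AE x in lebesgue. ut t x + of_real 1 * weak_deriv (u t) x = rhs m \<alpha> (U t x) (V t x)"
      using eq1[OF t] U(2)[OF t] V(2)[OF t]
      by eventually_elim (simp add: rhs_def rot)
  qed
  have t2: "transported (-1) V (\<lambda>t x. rhs m \<beta> (V t x) (U t x))"
  proof (rule transportedI_weak[OF d(2) H(2) V(1,2)])
    show "continuous_on UNIV (\<lambda>(t, x). rhs m \<beta> (V t x) (U t x))"
      unfolding case_prod_unfold using U(1) V(1) by (intro continuous_on_rhs) (simp_all add: case_prod_unfold)
    fix t :: real assume t: "t \<ge> 0"
    show "AE x in lebesgue. vt t x + of_real (-1) * weak_deriv (v t) x = rhs m \<beta> (V t x) (U t x)"
      using eq2[OF t] U(2)[OF t] V(2)[OF t]
      by eventually_elim (simp add: rhs_def rot N2_eq_N1)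
  qed
  have "\<exists>K. \<forall>t\<in>{0..T}. (\<forall>x. cmod (U t x) \<le> K \<and> cmod (V t x) \<le> K) \<and> (L2_norm (U t))\<^sup>2 \<le> K \<and> (L2_norm (V t))\<^sup>2 \<le> K" for T
  proof -
    obtain K1 K2 where "\<forall>t\<in>{0..T}. (\<forall>x. cmod (U t x) \<le> K1) \<and> (L2_norm (U t))\<^sup>2 \<le> K1"
      "\<forall>t\<in>{0..T}. (\<forall>x. cmod (V t x) \<le> K2) \<and> (L2_norm (V t))\<^sup>2 \<le> K2" using U(3) V(3) by meson
    thus ?thesis by (intro exI[of _ "max K1 K2"]) (auto simp: le_max_iff_disj)
  qed
  moreover have "U t \<in> L2" "V t \<in> L2" if "t \<ge> 0" for t
    using L2_cong_AE[OF U(2)[OF that]] L2_cong_AE[OF V(2)[OF that]] H[OF that] by (auto simp: H1_def)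
  ultimately have "characteristic_solution m \<alpha> \<beta> U V"
    unfolding characteristic_solution_def using U(1) V(1) t1 t2 by blast
  from this U(2) V(2) show ?thesis by (rule that)
qed

section \<open>Crossing characteristics\<close>

text \<open>The squared \<open>L\<^sup>2\<close> norm with values in the extended half line, so that an
  estimate can be stated before its left-hand side is known to be finite.\<close>
definition sqint :: "(real \<Rightarrow> real) \<Rightarrow> ennreal" where
  "sqint f = (\<integral>\<^sup>+x. ennreal ((f x)\<^sup>2) \<partial>lborel)"

lemma sqint_mono:
  assumes "\<And>x. 0 \<le> f x" "\<And>x. f x \<le> g x"
  shows "sqint f \<le> sqint g"
  unfolding sqint_def using assms by (intro nn_integral_mono ennreal_leI power_mono) auto

lemma sqint_shift:
  assumes "f \<in> borel_measurable borel"
  shows "sqint (\<lambda>x. f (x + c)) = sqint f"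
  unfolding sqint_def using assms
  by (subst (2) nn_integral_real_affine[of _ 1 c]) (auto simp: add.commute)

lemma nn_integral_Icc_eq_integral:
  fixes f :: "real \<Rightarrow> real"
  assumes "continuous_on {a..b} f" "\<And>x. x \<in> {a..b} \<Longrightarrow> 0 \<le> f x"
  shows "(\<integral>\<^sup>+x. ennreal (f x) * indicator {a..b} x \<partial>lborel) = ennreal (integral {a..b} f)"
proof -
  have si: "set_integrable lborel {a..b} f" by (rule borel_integrable_atLeastAtMost'[OF assms(1)])
  have "(\<integral>\<^sup>+x. ennreal (f x) * indicator {a..b} x \<partial>lborel) = (\<integral>\<^sup>+x. ennreal (indicator {a..b} x *\<^sub>R f x) \<partial>lborel)"
    by (rule nn_integral_cong) (auto simp: indicator_def)
  also have "\<dots> = ennreal (\<integral>x. indicator {a..b} x *\<^sub>R f x \<partial>lborel)"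
    by (rule nn_integral_eq_integral) (use si assms(2) in \<open>auto simp: set_integrable_def indicator_def\<close>)
  also have "(\<integral>x. indicator {a..b} x *\<^sub>R f x \<partial>lborel) = integral {a..b} f"
    using set_borel_integral_eq_integral(2)[OF si] by (simp add: set_lebesgue_integral_def)
  finally show ?thesis .
qed

lemma integral_Cauchy_Schwarz:
  fixes f g :: "real \<Rightarrow> real"
  assumes f: "continuous_on {a..b} f" and g: "continuous_on {a..b} g"
    and nn: "\<And>x. x \<in> {a..b} \<Longrightarrow> 0 \<le> f x" "\<And>x. x \<in> {a..b} \<Longrightarrow> 0 \<le> g x"
  shows "(integral {a..b} (\<lambda>x. f x * g x))\<^sup>2 \<le> integral {a..b} (\<lambda>x. (f x)\<^sup>2) * integral {a..b} (\<lambda>x. (g x)\<^sup>2)"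
proof -
  let ?F = "\<lambda>x. ennreal (f x) * indicator {a..b} x" and ?G = "\<lambda>x. ennreal (g x) * indicator {a..b} x"
  have m: "(\<lambda>x. ennreal (h x) * indicator {a..b} x) \<in> borel_measurable lborel" if "continuous_on {a..b} h" for h :: "real \<Rightarrow> real"
  proof -
    have "(\<lambda>x. indicator {a..b} x *\<^sub>R h x) \<in> borel_measurable borel"
      using that by (intro borel_measurable_continuous_on_indicator) auto
    hence "(\<lambda>x. ennreal (indicator {a..b} x *\<^sub>R h x)) \<in> borel_measurable borel" by measurable
    also have "(\<lambda>x. ennreal (indicator {a..b} x *\<^sub>R h x)) = (\<lambda>x. ennreal (h x) * indicator {a..b} x)"
      by (auto simp: indicator_def)
    finally show ?thesis by simp
  qed
  have "(ennreal (integral {a..b} (\<lambda>x. f x * g x)))\<^sup>2 = (\<integral>\<^sup>+x. ennreal (f x * g x) * indicator {a..b} x \<partial>lborel)\<^sup>2"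
    using nn by (subst nn_integral_Icc_eq_integral) (auto intro!: continuous_intros f g)
  also have "(\<integral>\<^sup>+x. ennreal (f x * g x) * indicator {a..b} x \<partial>lborel) = (\<integral>\<^sup>+x. ?F x * ?G x \<partial>lborel)"
    using nn by (intro nn_integral_cong) (auto simp: indicator_def ennreal_mult)
  also have "(\<integral>\<^sup>+x. ?F x * ?G x \<partial>lborel)\<^sup>2 \<le> (\<integral>\<^sup>+x. (?F x)\<^sup>2 \<partial>lborel) * (\<integral>\<^sup>+x. (?G x)\<^sup>2 \<partial>lborel)"
    by (intro Cauchy_Schwarz_nn_integral m f g)
  also have "(\<integral>\<^sup>+x. (?F x)\<^sup>2 \<partial>lborel) = (\<integral>\<^sup>+x. ennreal ((f x)\<^sup>2) * indicator {a..b} x \<partial>lborel)"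
    using nn by (intro nn_integral_cong) (auto simp: indicator_def ennreal_power)
  also have "\<dots> = ennreal (integral {a..b} (\<lambda>x. (f x)\<^sup>2))"
    by (rule nn_integral_Icc_eq_integral) (auto intro!: continuous_intros f)
  also have "(\<integral>\<^sup>+x. (?G x)\<^sup>2 \<partial>lborel) = (\<integral>\<^sup>+x. ennreal ((g x)\<^sup>2) * indicator {a..b} x \<partial>lborel)"
    using nn by (intro nn_integral_cong) (auto simp: indicator_def ennreal_power)
  also have "\<dots> = ennreal (integral {a..b} (\<lambda>x. (g x)\<^sup>2))"
    by (rule nn_integral_Icc_eq_integral) (auto intro!: continuous_intros g)
  finally have "(ennreal (integral {a..b} (\<lambda>x. f x * g x)))\<^sup>2
      \<le> ennreal (integral {a..b} (\<lambda>x. (f x)\<^sup>2)) * ennreal (integral {a..b} (\<lambda>x. (g x)\<^sup>2))" .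
  moreover have "0 \<le> integral {a..b} (\<lambda>x. f x * g x)" "0 \<le> integral {a..b} (\<lambda>x. (f x)\<^sup>2)" "0 \<le> integral {a..b} (\<lambda>x. (g x)\<^sup>2)"
    using nn by (auto intro!: integral_nonneg integrable_continuous_interval continuous_intros f g)
  ultimately show ?thesis by (simp add: ennreal_power ennreal_mult[symmetric])
qed

text \<open>Cauchy-Schwarz in time gives one factor \<open>T\<close>, Fubini and translation invariance
  the other. This is the source of the factor \<open>T\<^sup>2\<close> in front of the mass
  term.\<close>
lemma sqint_integral_along_line_le:
  fixes f :: "real \<Rightarrow> real \<Rightarrow> real"
  assumes f: "continuous_on UNIV (\<lambda>(s, x). f s x)" "\<And>s x. 0 \<le> f s x" and T: "T \<ge> 0"
    and b: "\<And>s. s \<in> {0..T} \<Longrightarrow> sqint (f s) \<le> ennreal b" and "b \<ge> 0"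
  shows "sqint (\<lambda>x. integral {0..T} (\<lambda>s. f s (x + \<sigma> * s))) \<le> ennreal (T\<^sup>2 * b)"
proof -
  note [continuous_intros] = continuous_along_curve[OF f(1)]
  let ?F = "\<lambda>s x. ennreal ((f s (x + \<sigma> * s))\<^sup>2) * indicator {0..T} s"
  have [measurable]: "(\<lambda>p. f (fst p) (snd p + \<sigma> * fst p)) \<in> borel_measurable (borel \<Otimes>\<^sub>M borel)"
    "(\<lambda>p. f (snd p) (fst p + \<sigma> * snd p)) \<in> borel_measurable (borel \<Otimes>\<^sub>M borel)"
    unfolding borel_prod by (intro borel_measurable_continuous_onI continuous_intros)+
  have [measurable]: "(indicator {0..T} :: real \<Rightarrow> ennreal) \<in> borel_measurable borel" by simp
  have fm: "f s \<in> borel_measurable borel" for s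
    by (intro borel_measurable_continuous_onI continuous_intros)
  have pw: "ennreal ((integral {0..T} (\<lambda>s. f s (x + \<sigma> * s)))\<^sup>2) \<le> ennreal T * (\<integral>\<^sup>+s. ?F s x \<partial>lborel)" for x
  proof -
    have "(integral {0..T} (\<lambda>s. f s (x + \<sigma> * s)))\<^sup>2 \<le> T * integral {0..T} (\<lambda>s. (f s (x + \<sigma> * s))\<^sup>2)"
      using integral_Cauchy_Schwarz[of 0 T "\<lambda>s. 1" "\<lambda>s. f s (x + \<sigma> * s)"] f(2) T
      by (simp add: continuous_intros)
    hence "ennreal ((integral {0..T} (\<lambda>s. f s (x + \<sigma> * s)))\<^sup>2) \<le> ennreal T * ennreal (integral {0..T} (\<lambda>s. (f s (x + \<sigma> * s))\<^sup>2))"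
      using T by (simp add: ennreal_mult[symmetric] integral_nonneg integrable_continuous_interval continuous_intros ennreal_leI)
    also have "ennreal (integral {0..T} (\<lambda>s. (f s (x + \<sigma> * s))\<^sup>2)) = (\<integral>\<^sup>+s. ?F s x \<partial>lborel)"
      by (subst nn_integral_Icc_eq_integral) (auto intro!: continuous_intros)
    finally show ?thesis .
  qed
  have "(\<integral>\<^sup>+x. (\<integral>\<^sup>+s. ?F s x \<partial>lborel) \<partial>lborel) = (\<integral>\<^sup>+s. (\<integral>\<^sup>+x. ?F s x \<partial>lborel) \<partial>lborel)"
    by (rule lborel_pair.Fubini') measurable
  also have "\<dots> = (\<integral>\<^sup>+s. sqint (f s) * indicator {0..T} s \<partial>lborel)"
  proof (rule nn_integral_cong)
    fix s :: real
    have "(\<integral>\<^sup>+x. ?F s x \<partial>lborel) = (\<integral>\<^sup>+x. ennreal ((f s (x + \<sigma> * s))\<^sup>2) \<partial>lborel) * indicator {0..T} s"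
    proof (rule nn_integral_multc)
      have [measurable]: "(\<lambda>x. f s (x + \<sigma> * s)) \<in> borel_measurable borel"
        by (intro borel_measurable_continuous_onI continuous_intros)
      show "(\<lambda>x. ennreal ((f s (x + \<sigma> * s))\<^sup>2)) \<in> borel_measurable lborel" by measurable
    qed
    also have "(\<integral>\<^sup>+x. ennreal ((f s (x + \<sigma> * s))\<^sup>2) \<partial>lborel) = sqint (f s)"
      using sqint_shift[OF fm[of s], of "\<sigma> * s"] by (simp add: sqint_def)
    finally show "(\<integral>\<^sup>+x. ?F s x \<partial>lborel) = sqint (f s) * indicator {0..T} s" .
  qed
  also have "\<dots> \<le> (\<integral>\<^sup>+s. ennreal b * indicator {0..T} s \<partial>lborel)"
    using b by (intro nn_integral_mono) (auto simp: indicator_def)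
  also have "\<dots> = ennreal b * ennreal T" using T by (simp add: nn_integral_cmult_indicator)
  finally have inner: "(\<integral>\<^sup>+x. (\<integral>\<^sup>+s. ?F s x \<partial>lborel) \<partial>lborel) \<le> ennreal b * ennreal T" .
  have "sqint (\<lambda>x. integral {0..T} (\<lambda>s. f s (x + \<sigma> * s))) \<le> (\<integral>\<^sup>+x. ennreal T * (\<integral>\<^sup>+s. ?F s x \<partial>lborel) \<partial>lborel)"
    unfolding sqint_def by (rule nn_integral_mono) (rule pw)
  also have "\<dots> = ennreal T * (\<integral>\<^sup>+x. (\<integral>\<^sup>+s. ?F s x \<partial>lborel) \<partial>lborel)"
    by (rule nn_integral_cmult) measurable
  also have "\<dots> \<le> ennreal T * (ennreal b * ennreal T)"
    by (rule mult_left_mono[OF inner]) simp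
  also have "\<dots> = ennreal (T\<^sup>2 * b)"
    using T \<open>b \<ge> 0\<close> by (simp add: ennreal_mult[symmetric] power2_eq_square mult_ac)
  finally show ?thesis .
qed

text \<open>A characteristic of one family meets those of the other at speed 2, so the substitution
  \<open>y = x + 2 \<sigma> s\<close> costs a factor \<open>1 / 2\<close>. The bound does not
  depend on \<open>x\<close> or on \<open>T\<close>.\<close>
lemma integral_square_across_le:
  fixes B :: "real \<Rightarrow> real"
  assumes B: "continuous_on UNIV B" "sqint B \<le> ennreal \<beta>" and "\<beta> \<ge> 0" and \<sigma>: "\<bar>\<sigma>\<bar> = 1"
  shows "integral {0..T} (\<lambda>s. (B (x + 2 * \<sigma> * s))\<^sup>2) \<le> \<beta> / 2"
proof -
  have c: "continuous_on S (\<lambda>s. (B (x + 2 * \<sigma> * s))\<^sup>2)" for S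
    by (intro continuous_intros continuous_on_compose2[OF B(1)]) auto
  have [measurable]: "B \<in> borel_measurable borel" using B(1) by (rule borel_measurable_continuous_onI)
  let ?I = "integral {0..T} (\<lambda>s. (B (x + 2 * \<sigma> * s))\<^sup>2)"
  have I0: "0 \<le> ?I" by (intro integral_nonneg integrable_continuous_interval c) auto
  have "ennreal (2 * ?I) = 2 * (\<integral>\<^sup>+s. ennreal ((B (x + 2 * \<sigma> * s))\<^sup>2) * indicator {0..T} s \<partial>lborel)"
    using I0 by (subst nn_integral_Icc_eq_integral) (auto intro!: c simp: ennreal_mult)
  also have "\<dots> \<le> 2 * (\<integral>\<^sup>+s. ennreal ((B (x + (2 * \<sigma>) * s))\<^sup>2) \<partial>lborel)"
    by (intro mult_left_mono nn_integral_mono) (auto simp: indicator_def)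
  also have "\<dots> = sqint B"
  proof -
    have "2 * \<sigma> \<noteq> 0" "\<bar>2 * \<sigma>\<bar> = 2" using \<sigma> by auto
    thus ?thesis unfolding sqint_def
      by (subst nn_integral_real_affine[of "\<lambda>x. ennreal ((B x)\<^sup>2)" "2 * \<sigma>" x]) auto
  qed
  also have "\<dots> \<le> ennreal \<beta>" by fact
  finally show ?thesis using \<open>\<beta> \<ge> 0\<close> by simp
qed

text \<open>The estimate for one of the two families, for moduli only. In the application
  \<open>P\<close> and \<open>R\<close> are the differences of the two transported unknowns
  and of the two crossing unknowns, \<open>w\<close> is the difference of the right-hand
  sides, \<open>q\<close> and \<open>q'\<close> are the crossing unknowns, and
  \<open>p'\<close> is a transported unknown; \<open>A\<close>, \<open>A'\<close>,
  \<open>B\<close>, \<open>B'\<close>, \<open>D\<close> are envelopes.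

  On the characteristic through \<open>x\<close> the factors \<open>P\<close> and
  \<open>p'\<close> are replaced by the constants \<open>A x\<close> and \<open>A' x\<close>.
  The remaining integrals run across the other family: \<open>\<integral> q\<^sup>2 \<le>
  \<epsilon> / 2\<close>, so \<open>c * \<epsilon> \<le> 1\<close> lets the term with \<open>A
  x\<close> be absorbed into half of the left-hand side, and \<open>\<integral> (q + q') R
  \<le> sqrt (\<epsilon> d)\<close> by Cauchy-Schwarz.\<close>
lemma envelope_estimate:
  fixes w P R p' q q' :: "real \<Rightarrow> real \<Rightarrow> real" and A A' B B' D :: "real \<Rightarrow> real"
  assumes \<sigma>: "\<bar>\<sigma>\<bar> = 1" and T: "T \<ge> 0"
    and cont: "continuous_on UNIV (\<lambda>(s, x). w s x)" "continuous_on UNIV (\<lambda>(s, x). P s x)"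
      "continuous_on UNIV (\<lambda>(s, x). R s x)" "continuous_on UNIV (\<lambda>(s, x). p' s x)"
      "continuous_on UNIV (\<lambda>(s, x). q s x)" "continuous_on UNIV (\<lambda>(s, x). q' s x)"
    and contE: "continuous_on UNIV A'" "continuous_on UNIV B" "continuous_on UNIV B'" "continuous_on UNIV D"
    and nn: "\<And>s x. 0 \<le> w s x" "\<And>s x. 0 \<le> P s x" "\<And>s x. 0 \<le> R s x" "\<And>s x. 0 \<le> p' s x"
      "\<And>s x. 0 \<le> q s x" "\<And>s x. 0 \<le> q' s x"
    and A: "\<And>x. A x = P 0 x + integral {0..T} (\<lambda>s. w s (x + \<sigma> * s))"
    and bounds: "\<And>s x. s \<in> {0..T} \<Longrightarrow> P s (x + \<sigma> * s) \<le> A x"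
      "\<And>s x. s \<in> {0..T} \<Longrightarrow> p' s (x + \<sigma> * s) \<le> A' x"
      "\<And>s x. s \<in> {0..T} \<Longrightarrow> q s (x - \<sigma> * s) \<le> B x"
      "\<And>s x. s \<in> {0..T} \<Longrightarrow> q' s (x - \<sigma> * s) \<le> B' x"
      "\<And>s x. s \<in> {0..T} \<Longrightarrow> R s (x - \<sigma> * s) \<le> D x"
    and ineq: "\<And>s x. w s x \<le> m * R s x + c * (P s x * (q s x)\<^sup>2 + p' s x * ((q s x + q' s x) * R s x))"
    and small: "sqint A' \<le> ennreal \<epsilon>" "sqint B \<le> ennreal \<epsilon>" "sqint B' \<le> ennreal \<epsilon>" "sqint D \<le> ennreal d"
    and pos: "m \<ge> 0" "c \<ge> 0" "\<epsilon> \<ge> 0" "d \<ge> 0" and c\<epsilon>: "c * \<epsilon> \<le> 1"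
  shows "sqint A \<le> 12 * sqint (P 0) + ennreal (12 * m\<^sup>2 * T\<^sup>2 * d + 12 * c\<^sup>2 * \<epsilon>\<^sup>2 * d)"
proof -
  note [continuous_intros] = cont[THEN continuous_along_curve]
  let ?S = "\<lambda>x. integral {0..T} (\<lambda>s. R s (x + \<sigma> * s))"
  have across: "q s (x + \<sigma> * s) \<le> B (x + 2 * \<sigma> * s)" "q' s (x + \<sigma> * s) \<le> B' (x + 2 * \<sigma> * s)"
     "R s (x + \<sigma> * s) \<le> D (x + 2 * \<sigma> * s)" if "s \<in> {0..T}" for s x
    using bounds(3-5)[OF that, of "x + 2 * \<sigma> * s"] by (simp_all add: algebra_simps)
  have sqb: "integral {0..T} (\<lambda>s. (f s (x + \<sigma> * s))\<^sup>2) \<le> \<beta> / 2"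
    if "continuous_on UNIV (\<lambda>(s, x). f s x)" "\<And>s x. 0 \<le> f s x" "\<And>s x. s \<in> {0..T} \<Longrightarrow> f s (x + \<sigma> * s) \<le> E (x + 2 * \<sigma> * s)"
      "continuous_on UNIV E" "sqint E \<le> ennreal \<beta>" "\<beta> \<ge> 0" for f E \<beta> x
  proof -
    have "integral {0..T} (\<lambda>s. (f s (x + \<sigma> * s))\<^sup>2) \<le> integral {0..T} (\<lambda>s. (E (x + 2 * \<sigma> * s))\<^sup>2)"
      using that(2,3)
      by (intro integral_le integrable_continuous_interval continuous_intros continuous_along_curve[OF that(1)]
          continuous_on_compose2[OF that(4)] power_mono) auto
    also have "\<dots> \<le> \<beta> / 2" by (rule integral_square_across_le[OF that(4-6) \<sigma>])
    finally show ?thesis .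
  qed
  note qb = sqb[OF cont(5) nn(5) across(1) contE(2) small(2) pos(3)]
    and q'b = sqb[OF cont(6) nn(6) across(2) contE(3) small(3) pos(3)]
    and Rb = sqb[OF cont(3) nn(3) across(3) contE(4) small(4) pos(4)]
  have A0: "0 \<le> A x" for x
    unfolding A using nn by (intro add_nonneg_nonneg integral_nonneg integrable_continuous_interval continuous_intros) auto
  have pw: "A x \<le> 2 * P 0 x + 2 * m * ?S x + 2 * c * A' x * sqrt (\<epsilon> * d)" for x
  proof -
    let ?c = "\<lambda>s. x + \<sigma> * s"
    let ?J = "integral {0..T} (\<lambda>s. (q s (?c s) + q' s (?c s)) * R s (?c s))"
    have J: "?J \<le> sqrt (\<epsilon> * d)"
    proof (rule real_le_rsqrt)
      have "?J\<^sup>2 \<le> integral {0..T} (\<lambda>s. (q s (?c s) + q' s (?c s))\<^sup>2) * integral {0..T} (\<lambda>s. (R s (?c s))\<^sup>2)"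
        using nn by (intro integral_Cauchy_Schwarz continuous_intros) auto
      also have "\<dots> \<le> (2 * \<epsilon>) * (d / 2)"
      proof (rule mult_mono)
        have "integral {0..T} (\<lambda>s. (q s (?c s) + q' s (?c s))\<^sup>2)
          \<le> integral {0..T} (\<lambda>s. 2 * (q s (?c s))\<^sup>2 + 2 * (q' s (?c s))\<^sup>2)"
          by (intro integral_le integrable_continuous_interval continuous_intros) (auto intro: power2_add_le)
        also have "\<dots> = 2 * integral {0..T} (\<lambda>s. (q s (?c s))\<^sup>2) + 2 * integral {0..T} (\<lambda>s. (q' s (?c s))\<^sup>2)"
          by (subst Henstock_Kurzweil_Integration.integral_add) (auto intro!: integrable_continuous_interval continuous_intros)
        also have "\<dots> \<le> 2 * \<epsilon>" using qb[of x] q'b[of x] by linarith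
        finally show "integral {0..T} (\<lambda>s. (q s (?c s) + q' s (?c s))\<^sup>2) \<le> 2 * \<epsilon>" .
        show "integral {0..T} (\<lambda>s. (R s (?c s))\<^sup>2) \<le> d / 2" by (rule Rb)
      qed (use pos in \<open>auto intro!: integral_nonneg integrable_continuous_interval continuous_intros\<close>)
      finally show "?J\<^sup>2 \<le> \<epsilon> * d" by simp
    qed
    have "integral {0..T} (\<lambda>s. w s (?c s)) \<le> integral {0..T} (\<lambda>s. m * R s (?c s)
        + (c * A x * (q s (?c s))\<^sup>2 + c * A' x * ((q s (?c s) + q' s (?c s)) * R s (?c s))))"
    proof (intro integral_le integrable_continuous_interval continuous_intros)
      fix s assume s: "s \<in> {0..T}"
      have "P s (?c s) * (q s (?c s))\<^sup>2 \<le> A x * (q s (?c s))\<^sup>2" using bounds(1)[OF s] by (intro mult_right_mono) auto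
      moreover have "p' s (?c s) * ((q s (?c s) + q' s (?c s)) * R s (?c s)) \<le> A' x * ((q s (?c s) + q' s (?c s)) * R s (?c s))"
        using bounds(2)[OF s] nn by (intro mult_right_mono) auto
      ultimately have "c * (P s (?c s) * (q s (?c s))\<^sup>2 + p' s (?c s) * ((q s (?c s) + q' s (?c s)) * R s (?c s)))
         \<le> c * (A x * (q s (?c s))\<^sup>2 + A' x * ((q s (?c s) + q' s (?c s)) * R s (?c s)))"
        using pos by (intro mult_left_mono add_mono) auto
      with ineq[of s "?c s"] show "w s (?c s) \<le> m * R s (?c s)
        + (c * A x * (q s (?c s))\<^sup>2 + c * A' x * ((q s (?c s) + q' s (?c s)) * R s (?c s)))"
        by (simp add: distrib_left mult.assoc)
    qed
    also have "\<dots> = m * ?S x + (c * A x * integral {0..T} (\<lambda>s. (q s (?c s))\<^sup>2) + c * A' x * ?J)"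
      by (subst Henstock_Kurzweil_Integration.integral_add, (intro integrable_continuous_interval continuous_intros)+)+ simp
    also have "\<dots> \<le> m * ?S x + (c * A x * (\<epsilon> / 2) + c * A' x * sqrt (\<epsilon> * d))"
    proof -
      have "0 \<le> A' x" using bounds(2)[of 0 x] nn(4)[of 0 x] T by auto
      thus ?thesis using J qb[of x] A0[of x] pos by (intro add_left_mono add_mono mult_left_mono) auto
    qed
    also have "c * A x * (\<epsilon> / 2) \<le> A x / 2"
      using mult_right_mono[OF c\<epsilon> A0[of x]] by (simp add: field_simps)
    finally have "A x \<le> P 0 x + (m * ?S x + (A x / 2 + c * A' x * sqrt (\<epsilon> * d)))"
      using A[of x] by simp
    hence "A x \<le> 2 * P 0 x + 2 * (m * ?S x) + 2 * (c * A' x * sqrt (\<epsilon> * d))" by linarith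
    thus ?thesis by (simp only: mult.assoc)
  qed
  \<comment> \<open>The constant 12 is 3, from squaring a sum of three terms, times 4, from the factor 2
    lost by the absorption.\<close>
  have sq: "(A x)\<^sup>2 \<le> 12 * (P 0 x)\<^sup>2 + (12 * m\<^sup>2 * (?S x)\<^sup>2 + (12 * c\<^sup>2 * \<epsilon> * d) * (A' x)\<^sup>2)" for x
  proof -
    have three: "(a + b + e)\<^sup>2 \<le> 3 * (a\<^sup>2 + b\<^sup>2 + e\<^sup>2)" for a b e :: real
      using sum_squares_bound[of a b] sum_squares_bound[of b e] sum_squares_bound[of a e]
      by (simp add: power2_eq_square algebra_simps)
    have "(A x)\<^sup>2 \<le> (2 * P 0 x + 2 * m * ?S x + 2 * c * A' x * sqrt (\<epsilon> * d))\<^sup>2"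
      using pw[of x] A0[of x] by (intro power_mono)
    also have "\<dots> \<le> 3 * ((2 * P 0 x)\<^sup>2 + (2 * m * ?S x)\<^sup>2 + (2 * c * A' x * sqrt (\<epsilon> * d))\<^sup>2)" by (rule three)
    also have "\<dots> = 12 * (P 0 x)\<^sup>2 + (12 * m\<^sup>2 * (?S x)\<^sup>2 + (12 * c\<^sup>2 * \<epsilon> * d) * (A' x)\<^sup>2)"
      using pos by (simp add: power_mult_distrib algebra_simps)
    finally show ?thesis .
  qed
  have Sc: "continuous_on UNIV ?S"
  proof -
    have "continuous_on UNIV (\<lambda>x. integral (cbox 0 T) (\<lambda>s. R s (x + \<sigma> * s)))"
      by (rule integral_continuous_on_param) (auto intro!: continuous_intros simp: case_prod_unfold)
    thus ?thesis by simp
  qed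
  have [measurable]: "?S \<in> borel_measurable borel" "A' \<in> borel_measurable borel" "P 0 \<in> borel_measurable borel"
    by (intro borel_measurable_continuous_onI Sc contE continuous_intros)+
  have "sqint A \<le> (\<integral>\<^sup>+x. 12 * ennreal ((P 0 x)\<^sup>2) + (ennreal (12 * m\<^sup>2) * ennreal ((?S x)\<^sup>2) + ennreal (12 * c\<^sup>2 * \<epsilon> * d) * ennreal ((A' x)\<^sup>2)) \<partial>lborel)"
    unfolding sqint_def
  proof (rule nn_integral_mono)
    fix x
    have "ennreal ((A x)\<^sup>2) \<le> ennreal (12 * (P 0 x)\<^sup>2 + (12 * m\<^sup>2 * (?S x)\<^sup>2 + (12 * c\<^sup>2 * \<epsilon> * d) * (A' x)\<^sup>2))"
      by (rule ennreal_leI[OF sq])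
    also have "\<dots> = 12 * ennreal ((P 0 x)\<^sup>2) + (ennreal (12 * m\<^sup>2) * ennreal ((?S x)\<^sup>2) + ennreal (12 * c\<^sup>2 * \<epsilon> * d) * ennreal ((A' x)\<^sup>2))"
      using pos by (simp add: ennreal_plus ennreal_mult del: ennreal_plus[symmetric])
    finally show "ennreal ((A x)\<^sup>2) \<le> 12 * ennreal ((P 0 x)\<^sup>2) + (ennreal (12 * m\<^sup>2) * ennreal ((?S x)\<^sup>2) + ennreal (12 * c\<^sup>2 * \<epsilon> * d) * ennreal ((A' x)\<^sup>2))" .
  qed
  also have "\<dots> = 12 * sqint (P 0) + (ennreal (12 * m\<^sup>2) * sqint ?S + ennreal (12 * c\<^sup>2 * \<epsilon> * d) * sqint A')"
    unfolding sqint_def by (simp add: nn_integral_add nn_integral_cmult)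
  also have "\<dots> \<le> 12 * sqint (P 0) + (ennreal (12 * m\<^sup>2) * ennreal (T\<^sup>2 * d) + ennreal (12 * c\<^sup>2 * \<epsilon> * d) * ennreal \<epsilon>)"
  proof (intro add_left_mono add_mono mult_left_mono small(1) sqint_integral_along_line_le cont(3) nn(3) T pos(4))
    fix s assume s: "s \<in> {0..T}"
    have "sqint (R s) \<le> sqint (\<lambda>x. D (x + \<sigma> * s))"
      using bounds(5)[OF s, of "_ + \<sigma> * s"] nn(3) by (intro sqint_mono) auto
    also have "\<dots> = sqint D" using contE(4) by (intro sqint_shift borel_measurable_continuous_onI)
    finally show "sqint (R s) \<le> ennreal d" using small(4) by simp
  qed auto
  also have "ennreal (12 * m\<^sup>2) * ennreal (T\<^sup>2 * d) + ennreal (12 * c\<^sup>2 * \<epsilon> * d) * ennreal \<epsilon>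
      = ennreal (12 * m\<^sup>2 * T\<^sup>2 * d + 12 * c\<^sup>2 * \<epsilon>\<^sup>2 * d)"
  proof -
    have "ennreal (12 * m\<^sup>2) * ennreal (T\<^sup>2 * d) = ennreal (12 * m\<^sup>2 * T\<^sup>2 * d)"
      using pos by (subst ennreal_mult[symmetric]) (auto simp: mult.assoc)
    moreover have "ennreal (12 * c\<^sup>2 * \<epsilon> * d) * ennreal \<epsilon> = ennreal (12 * c\<^sup>2 * \<epsilon>\<^sup>2 * d)"
      using pos by (subst ennreal_mult[symmetric]) (auto simp: power2_eq_square mult_ac)
    ultimately show ?thesis using pos by (simp only:) (subst ennreal_plus[symmetric], auto)
  qed
  finally show ?thesis .
qed

section \<open>Envelopes\<close>

definition envelope :: "real \<Rightarrow> real \<Rightarrow> (real \<Rightarrow> real \<Rightarrow> complex) \<Rightarrow> (real \<Rightarrow> real \<Rightarrow> complex) \<Rightarrow> real \<Rightarrow> real" where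
  "envelope \<sigma> T u g x = cmod (u 0 x) + integral {0..T} (\<lambda>s. cmod (g s (x + \<sigma> * s)))"

lemma continuous_on_envelope:
  assumes u: "continuous_on UNIV (\<lambda>(t, x). u t x)" and g: "continuous_on UNIV (\<lambda>(t, x). g t x)"
  shows "continuous_on UNIV (envelope \<sigma> T u g)"
proof -
  note [continuous_intros] = continuous_along_curve[OF u] continuous_along_curve[OF g]
  have "continuous_on UNIV (\<lambda>x. integral (cbox 0 T) (\<lambda>s. cmod (g s (x + \<sigma> * s))))"
    by (rule integral_continuous_on_param) (auto intro!: continuous_intros simp: case_prod_unfold)
  thus ?thesis unfolding envelope_def[abs_def] by (auto intro!: continuous_intros)
qed

context
  fixes u g :: "real \<Rightarrow> real \<Rightarrow> complex"
  assumes g: "continuous_on UNIV (\<lambda>(t, x). g t x)"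
begin

lemma envelope_integrable: "(\<lambda>s. cmod (g s (x + \<sigma> * s))) integrable_on {a..b}"
  by (intro integrable_continuous_interval continuous_intros continuous_along_curve[OF g])

lemma envelope_nonneg: "0 \<le> envelope \<sigma> T u g x"
  unfolding envelope_def by (intro add_nonneg_nonneg integral_nonneg envelope_integrable) auto

lemma envelope_mono: "S \<le> T \<Longrightarrow> envelope \<sigma> S u g x \<le> envelope \<sigma> T u g x"
  unfolding envelope_def
  by (intro add_left_mono integral_subset_le envelope_integrable) auto

text \<open>The fundamental theorem of calculus along the characteristic.\<close>
lemma transported_le_envelope:
  assumes tr: "transported \<sigma> u g" and s: "s \<in> {0..T}"
  shows "cmod (u s (x + \<sigma> * s)) \<le> envelope \<sigma> T u g x"
proof -
  have I: "((\<lambda>r. g r (x + \<sigma> * r)) has_integral u s (x + \<sigma> * s) - u 0 (x + \<sigma> * 0)) {0..s}"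
    using s by (intro transported_integral[OF tr]) auto
  have "cmod (u s (x + \<sigma> * s) - u 0 x) = cmod (integral {0..s} (\<lambda>r. g r (x + \<sigma> * r)))"
    using integral_unique[OF I] by simp
  also have "\<dots> \<le> integral {0..s} (\<lambda>r. cmod (g r (x + \<sigma> * r)))"
    using I by (intro integral_norm_bound_integral envelope_integrable) auto
  finally have "cmod (u s (x + \<sigma> * s)) \<le> envelope \<sigma> s u g x"
    using norm_triangle_sub[of "u s (x + \<sigma> * s)" "u 0 x"] by (simp add: envelope_def)
  also have "\<dots> \<le> envelope \<sigma> T u g x" using s by (intro envelope_mono) auto
  finally show ?thesis .
qed

end

lemma transported_diff:
  assumes "transported \<sigma> u g" "transported \<sigma> u' g'"
  shows "transported \<sigma> (\<lambda>t x. u t x - u' t x) (\<lambda>t x. g t x - g' t x)"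
  using assms unfolding transported_def by (auto intro!: has_vector_derivative_diff)

lemma continuous_on_diff2:
  fixes u u' :: "real \<Rightarrow> real \<Rightarrow> complex"
  assumes "continuous_on UNIV (\<lambda>(t, x). u t x)" "continuous_on UNIV (\<lambda>(t, x). u' t x)"
  shows "continuous_on UNIV (\<lambda>(t, x). u t x - u' t x)"
  using continuous_on_diff[OF assms] by (simp add: case_prod_unfold)

lemma continuous_on_cmod2:
  fixes u :: "real \<Rightarrow> real \<Rightarrow> complex"
  assumes "continuous_on UNIV (\<lambda>(t, x). u t x)"
  shows "continuous_on UNIV (\<lambda>(t, x). cmod (u t x))"
  using continuous_on_norm[OF assms] by (simp add: case_prod_unfold)

lemma continuous_on_rhs2:
  assumes "continuous_on UNIV (\<lambda>(t, x). u t x)" "continuous_on UNIV (\<lambda>(t, x). v t x)"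
  shows "continuous_on UNIV (\<lambda>(t, x). rhs m \<alpha> (u t x) (v t x))"
  using assms unfolding case_prod_unfold by (rule continuous_on_rhs)

lemma envelope_diff_le:
  assumes g: "continuous_on UNIV (\<lambda>(t, x). g t x)" "continuous_on UNIV (\<lambda>(t, x). g' t x)"
  shows "envelope \<sigma> T (\<lambda>t x. u t x - u' t x) (\<lambda>t x. g t x - g' t x) x
    \<le> envelope \<sigma> T u g x + envelope \<sigma> T u' g' x"
proof -
  note [continuous_intros] = continuous_along_curve[OF g(1)] continuous_along_curve[OF g(2)]
  have "integral {0..T} (\<lambda>s. cmod (g s (x + \<sigma> * s) - g' s (x + \<sigma> * s)))
    \<le> integral {0..T} (\<lambda>s. cmod (g s (x + \<sigma> * s)) + cmod (g' s (x + \<sigma> * s)))"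
    by (intro integral_le integrable_continuous_interval continuous_intros norm_triangle_ineq4)
  also have "\<dots> = integral {0..T} (\<lambda>s. cmod (g s (x + \<sigma> * s))) + integral {0..T} (\<lambda>s. cmod (g' s (x + \<sigma> * s)))"
    by (intro Henstock_Kurzweil_Integration.integral_add integrable_continuous_interval continuous_intros)
  finally show ?thesis using norm_triangle_ineq4[of "u 0 x" "u' 0 x"] by (simp add: envelope_def)
qed

lemma sqint_add_le:
  assumes [measurable]: "f \<in> borel_measurable borel" "g \<in> borel_measurable borel"
    and nn: "\<And>x. 0 \<le> h x" "\<And>x. h x \<le> f x + g x"
  shows "sqint h \<le> 2 * sqint f + 2 * sqint g"
proof -
  have "sqint h \<le> (\<integral>\<^sup>+x. 2 * ennreal ((f x)\<^sup>2) + 2 * ennreal ((g x)\<^sup>2) \<partial>lborel)"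
    unfolding sqint_def
  proof (rule nn_integral_mono)
    fix x
    have "(h x)\<^sup>2 \<le> (f x + g x)\<^sup>2" using nn by (intro power_mono) auto
    also have "\<dots> \<le> 2 * (f x)\<^sup>2 + 2 * (g x)\<^sup>2" by (rule power2_add_le)
    finally have "ennreal ((h x)\<^sup>2) \<le> ennreal (2 * (f x)\<^sup>2 + 2 * (g x)\<^sup>2)" by (rule ennreal_leI)
    thus "ennreal ((h x)\<^sup>2) \<le> 2 * ennreal ((f x)\<^sup>2) + 2 * ennreal ((g x)\<^sup>2)"
      by (simp add: ennreal_plus ennreal_mult del: ennreal_plus[symmetric])
  qed
  also have "\<dots> = 2 * sqint f + 2 * sqint g"
    unfolding sqint_def by (simp add: nn_integral_add nn_integral_cmult)
  finally show ?thesis .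
qed

section \<open>The nonlinearity\<close>

definition cubic_const :: "(nat \<Rightarrow> complex) \<Rightarrow> real" where
  "cubic_const \<alpha> = (cmod (\<alpha> 1) + cmod (\<alpha> 2)) * (cmod (\<alpha> 3) + cmod (\<alpha> 4) + cmod (\<alpha> 5))"

text \<open>Each term keeps the product structure, one factor from the first argument and two from the
  second: the difference in the first argument is multiplied by \<open>|b|\<^sup>2\<close>,
  the difference in the second only by \<open>|a'|\<close> and one power of \<open>b\<close>
  or \<open>b'\<close>. The envelope estimate relies on precisely this structure.\<close>
lemma N1_Lipschitz:
  "cmod (N1 \<alpha> a b - N1 \<alpha> a' b') \<le> cubic_const \<alpha> *
     (cmod (a - a') * (cmod b)\<^sup>2 + cmod a' * ((cmod b + cmod b') * cmod (b - b')))"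
proof -
  define L where "L z = \<alpha> 1 * z + \<alpha> 2 * cnj z" for z
  define Q where "Q z = \<alpha> 3 * of_real ((cmod z)\<^sup>2) + \<alpha> 4 * z\<^sup>2 + \<alpha> 5 * (cnj z)\<^sup>2" for z
  let ?l = "cmod (\<alpha> 1) + cmod (\<alpha> 2)" and ?q = "cmod (\<alpha> 3) + cmod (\<alpha> 4) + cmod (\<alpha> 5)"
  have N: "N1 \<alpha> z w = L z * Q w" for z w by (simp add: N1_def L_def Q_def)
  have Lb: "cmod (L z) \<le> ?l * cmod z" for z
    unfolding L_def using norm_triangle_ineq[of "\<alpha> 1 * z" "\<alpha> 2 * cnj z"] by (simp add: norm_mult distrib_right)
  have Ld: "L a - L a' = L (a - a')" by (simp add: L_def algebra_simps)
  have three: "cmod (\<alpha> 3 * x + \<alpha> 4 * y + \<alpha> 5 * z) \<le> ?q * k" if "cmod x \<le> k" "cmod y \<le> k" "cmod z \<le> k" for x y z k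
  proof -
    have "cmod (\<alpha> 3 * x + \<alpha> 4 * y + \<alpha> 5 * z) \<le> cmod (\<alpha> 3 * x) + cmod (\<alpha> 4 * y) + cmod (\<alpha> 5 * z)"
      by (intro order_trans[OF norm_triangle_ineq] add_right_mono norm_triangle_ineq)
    also have "\<dots> \<le> cmod (\<alpha> 3) * k + cmod (\<alpha> 4) * k + cmod (\<alpha> 5) * k"
      unfolding norm_mult using that by (intro add_mono mult_left_mono) auto
    finally show ?thesis by (simp add: distrib_right)
  qed
  have Qb: "cmod (Q z) \<le> ?q * (cmod z)\<^sup>2" for z
    unfolding Q_def by (rule three) (auto simp: norm_power norm_mult)
  have Qd: "cmod (Q b - Q b') \<le> ?q * ((cmod b + cmod b') * cmod (b - b'))"
  proof -
    have sq: "cmod (z\<^sup>2 - w\<^sup>2) \<le> (cmod z + cmod w) * cmod (z - w)" for z w :: complex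
    proof -
      have "z\<^sup>2 - w\<^sup>2 = (z + w) * (z - w)" by (simp add: power2_eq_square algebra_simps)
      thus ?thesis using mult_right_mono[OF norm_triangle_ineq[of z w], of "cmod (z - w)"] by (simp add: norm_mult)
    qed
    have ab: "\<bar>(cmod b)\<^sup>2 - (cmod b')\<^sup>2\<bar> \<le> (cmod b + cmod b') * cmod (b - b')"
    proof -
      have "\<bar>(cmod b)\<^sup>2 - (cmod b')\<^sup>2\<bar> = (cmod b + cmod b') * \<bar>cmod b - cmod b'\<bar>"
        by (simp add: power2_eq_square square_diff_square_factored abs_mult)
      thus ?thesis using norm_triangle_ineq3[of b b'] by (simp add: mult_left_mono)
    qed
    have "Q b - Q b' = \<alpha> 3 * of_real ((cmod b)\<^sup>2 - (cmod b')\<^sup>2) + \<alpha> 4 * (b\<^sup>2 - b'\<^sup>2) + \<alpha> 5 * ((cnj b)\<^sup>2 - (cnj b')\<^sup>2)"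
      by (simp add: Q_def algebra_simps)
    also have "cmod \<dots> \<le> ?q * ((cmod b + cmod b') * cmod (b - b'))"
    proof (rule three)
      show "cmod ((cnj b)\<^sup>2 - (cnj b')\<^sup>2) \<le> (cmod b + cmod b') * cmod (b - b')"
        using sq[of "cnj b" "cnj b'"] by (simp flip: complex_cnj_diff)
      show "cmod (of_real ((cmod b)\<^sup>2 - (cmod b')\<^sup>2)) \<le> (cmod b + cmod b') * cmod (b - b')"
        unfolding norm_of_real by (rule ab)
    qed (rule sq)
    finally show ?thesis .
  qed
  have "N1 \<alpha> a b - N1 \<alpha> a' b' = L (a - a') * Q b + L a' * (Q b - Q b')"
    by (simp add: N Ld[symmetric] algebra_simps)
  hence "cmod (N1 \<alpha> a b - N1 \<alpha> a' b') \<le> cmod (L (a - a')) * cmod (Q b) + cmod (L a') * cmod (Q b - Q b')"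
    using norm_triangle_ineq[of "L (a - a') * Q b" "L a' * (Q b - Q b')"] by (simp add: norm_mult)
  also have "\<dots> \<le> (?l * cmod (a - a')) * (?q * (cmod b)\<^sup>2) + (?l * cmod a') * (?q * ((cmod b + cmod b') * cmod (b - b')))"
    by (intro add_mono mult_mono Lb Qb Qd) auto
  also have "\<dots> = cubic_const \<alpha> * (cmod (a - a') * (cmod b)\<^sup>2 + cmod a' * ((cmod b + cmod b') * cmod (b - b')))"
    unfolding cubic_const_def by (simp only: distrib_left mult_ac)
  finally show ?thesis .
qed

lemma rhs_Lipschitz:
  assumes "m \<ge> 0" "cubic_const \<alpha> \<le> c"
  shows "cmod (rhs m \<alpha> a b - rhs m \<alpha> a' b') \<le> m * cmod (b - b') + c *
     (cmod (a - a') * (cmod b)\<^sup>2 + cmod a' * ((cmod b + cmod b') * cmod (b - b')))"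
proof -
  have "rhs m \<alpha> a b - rhs m \<alpha> a' b' = \<i> * (of_real m * (b - b') - (N1 \<alpha> a b - N1 \<alpha> a' b'))"
    by (simp add: rhs_def algebra_simps)
  hence "cmod (rhs m \<alpha> a b - rhs m \<alpha> a' b') \<le> m * cmod (b - b') + cmod (N1 \<alpha> a b - N1 \<alpha> a' b')"
    using norm_triangle_ineq4[of "of_real m * (b - b')" "N1 \<alpha> a b - N1 \<alpha> a' b'"] assms(1) by (simp add: norm_mult)
  also have "cmod (N1 \<alpha> a b - N1 \<alpha> a' b') \<le> c * (cmod (a - a') * (cmod b)\<^sup>2 + cmod a' * ((cmod b + cmod b') * cmod (b - b')))"
    by (rule order_trans[OF N1_Lipschitz]) (intro mult_right_mono assms; auto)
  finally show ?thesis by simp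
qed

section \<open>Stability on one window\<close>

text \<open>Here \<open>T\<close> is the length of a window, \<open>\<epsilon>\<close> the size allowed
  for the squared envelopes, and \<open>c\<close> a bound for both nonlinear terms. The two
  numbers \<open>1 / 4\<close> add up to the coefficient \<open>1 / 2\<close> with which the
  two families are coupled in the stability estimate.\<close>
locale small_window =
  fixes m :: real and \<alpha> \<beta> :: "nat \<Rightarrow> complex" and c \<epsilon> T :: real
  assumes m: "0 \<le> m" and c: "cubic_const \<alpha> \<le> c" "cubic_const \<beta> \<le> c" "0 \<le> c"
    and \<epsilon>: "0 < \<epsilon>" "c * \<epsilon> \<le> 1" "12 * c\<^sup>2 * \<epsilon>\<^sup>2 \<le> 1 / 4"
    and T: "0 < T" "12 * m\<^sup>2 * T\<^sup>2 \<le> 1 / 4"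
begin

abbreviation "G1 u v \<equiv> \<lambda>t x. rhs m \<alpha> (u t x) (v t x)"
abbreviation "G2 u v \<equiv> \<lambda>t x. rhs m \<beta> (v t x) (u t x)"

abbreviation "sol \<equiv> characteristic_solution m \<alpha> \<beta>"

lemma solD:
  assumes "sol u v"
  shows "continuous_on UNIV (\<lambda>(t, x). u t x)" "continuous_on UNIV (\<lambda>(t, x). v t x)"
    "continuous_on UNIV (\<lambda>(t, x). G1 u v t x)" "continuous_on UNIV (\<lambda>(t, x). G2 u v t x)"
    "transported 1 u (G1 u v)" "transported (-1) v (G2 u v)"
  using assms continuous_on_rhs2[of u v m \<alpha>] continuous_on_rhs2[of v u m \<beta>]
  unfolding characteristic_solution_def by blast+

lemma envelope_measurable:
  assumes "continuous_on UNIV (\<lambda>(t, x). u t x)" "continuous_on UNIV (\<lambda>(t, x). g t x)"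
  shows "envelope \<sigma> S u g \<in> borel_measurable borel"
  by (intro borel_measurable_continuous_onI continuous_on_envelope assms)

text \<open>The envelope of the difference in one family, in terms of that in the other family; the
  coupling coefficient is \<open>1 / 2\<close>.\<close>
lemma half_step:
  assumes S: "0 \<le> S" "S \<le> T" and \<sigma>: "\<bar>\<sigma>\<bar> = 1" and \<gamma>: "cubic_const \<gamma> \<le> c"
    and cu: "continuous_on UNIV (\<lambda>(t, x). u t x)" "continuous_on UNIV (\<lambda>(t, x). v t x)"
    and cu': "continuous_on UNIV (\<lambda>(t, x). u' t x)" "continuous_on UNIV (\<lambda>(t, x). v' t x)"
    and ch: "continuous_on UNIV (\<lambda>(t, x). h t x)" "continuous_on UNIV (\<lambda>(t, x). h' t x)"
    and tu: "transported \<sigma> u (\<lambda>t x. rhs m \<gamma> (u t x) (v t x))" "transported \<sigma> u' (\<lambda>t x. rhs m \<gamma> (u' t x) (v' t x))"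
    and tv: "transported (- \<sigma>) v h" "transported (- \<sigma>) v' h'"
    and e: "sqint (envelope \<sigma> S u' (\<lambda>t x. rhs m \<gamma> (u' t x) (v' t x))) \<le> ennreal \<epsilon>"
      "sqint (envelope (- \<sigma>) S v h) \<le> ennreal \<epsilon>" "sqint (envelope (- \<sigma>) S v' h') \<le> ennreal \<epsilon>"
    and d: "sqint (envelope (- \<sigma>) S (\<lambda>t x. v t x - v' t x) (\<lambda>t x. h t x - h' t x)) \<le> ennreal d" "d \<ge> 0"
  shows "sqint (envelope \<sigma> S (\<lambda>t x. u t x - u' t x) (\<lambda>t x. rhs m \<gamma> (u t x) (v t x) - rhs m \<gamma> (u' t x) (v' t x)))
     \<le> 12 * sqint (\<lambda>x. cmod (u 0 x - u' 0 x)) + ennreal (d / 2)"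
proof -
  let ?g = "\<lambda>t x. rhs m \<gamma> (u t x) (v t x)" and ?g' = "\<lambda>t x. rhs m \<gamma> (u' t x) (v' t x)"
  have cg: "continuous_on UNIV (\<lambda>(t, x). ?g t x)" "continuous_on UNIV (\<lambda>(t, x). ?g' t x)"
    by (intro continuous_on_rhs2 cu cu')+
  note cd = continuous_on_diff2[OF cu(1) cu'(1)] continuous_on_diff2[OF cu(2) cu'(2)]
    continuous_on_diff2[OF cg] continuous_on_diff2[OF ch]
  have "sqint (envelope \<sigma> S (\<lambda>t x. u t x - u' t x) (\<lambda>t x. ?g t x - ?g' t x))
    \<le> 12 * sqint (\<lambda>x. cmod (u 0 x - u' 0 x)) + ennreal (12 * m\<^sup>2 * S\<^sup>2 * d + 12 * c\<^sup>2 * \<epsilon>\<^sup>2 * d)"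
  proof (rule envelope_estimate[where P = "\<lambda>t x. cmod (u t x - u' t x)" and R = "\<lambda>t x. cmod (v t x - v' t x)"
        and w = "\<lambda>t x. cmod (?g t x - ?g' t x)" and p' = "\<lambda>t x. cmod (u' t x)" and q = "\<lambda>t x. cmod (v t x)"
        and q' = "\<lambda>t x. cmod (v' t x)" and \<sigma> = \<sigma> and T = S
        and A = "envelope \<sigma> S (\<lambda>t x. u t x - u' t x) (\<lambda>t x. ?g t x - ?g' t x)"
        and A' = "envelope \<sigma> S u' ?g'" and B = "envelope (- \<sigma>) S v h" and B' = "envelope (- \<sigma>) S v' h'"
        and D = "envelope (- \<sigma>) S (\<lambda>t x. v t x - v' t x) (\<lambda>t x. h t x - h' t x)",
        OF \<sigma> S(1) cd(3)[THEN continuous_on_cmod2] cd(1)[THEN continuous_on_cmod2] cd(2)[THEN continuous_on_cmod2]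
          cu'(1)[THEN continuous_on_cmod2] cu(2)[THEN continuous_on_cmod2] cu'(2)[THEN continuous_on_cmod2]
          continuous_on_envelope[OF cu'(1) cg(2)] continuous_on_envelope[OF cu(2) ch(1)]
          continuous_on_envelope[OF cu'(2) ch(2)] continuous_on_envelope[OF cd(2) cd(4)]
          _ _ _ _ _ _ envelope_def _ _ _ _ _ _ e d(1) m c(3) less_imp_le[OF \<epsilon>(1)] d(2) \<epsilon>(2)])
    fix s x assume s: "s \<in> {0..S}"
    show "cmod (u s (x + \<sigma> * s) - u' s (x + \<sigma> * s)) \<le> envelope \<sigma> S (\<lambda>t x. u t x - u' t x) (\<lambda>t x. ?g t x - ?g' t x) x"
      using transported_le_envelope[OF cd(3) transported_diff[OF tu] s, of x] .
    show "cmod (u' s (x + \<sigma> * s)) \<le> envelope \<sigma> S u' ?g' x"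
      using transported_le_envelope[OF cg(2) tu(2) s, of x] .
    show "cmod (v s (x - \<sigma> * s)) \<le> envelope (- \<sigma>) S v h x"
      using transported_le_envelope[OF ch(1) tv(1) s, of x] by simp
    show "cmod (v' s (x - \<sigma> * s)) \<le> envelope (- \<sigma>) S v' h' x"
      using transported_le_envelope[OF ch(2) tv(2) s, of x] by simp
    show "cmod (v s (x - \<sigma> * s) - v' s (x - \<sigma> * s)) \<le> envelope (- \<sigma>) S (\<lambda>t x. v t x - v' t x) (\<lambda>t x. h t x - h' t x) x"
      using transported_le_envelope[OF cd(4) transported_diff[OF tv] s, of x] by simp
  qed (use rhs_Lipschitz[OF m \<gamma>] in auto)
  also have "\<dots> \<le> 12 * sqint (\<lambda>x. cmod (u 0 x - u' 0 x)) + ennreal (d / 2)"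
  proof (intro add_left_mono ennreal_leI)
    have "12 * m\<^sup>2 * S\<^sup>2 \<le> 12 * m\<^sup>2 * T\<^sup>2" using S by (intro mult_left_mono power_mono) auto
    hence "12 * m\<^sup>2 * S\<^sup>2 \<le> 1 / 4" using T(2) by linarith
    from mult_right_mono[OF this d(2)] mult_right_mono[OF \<epsilon>(3) d(2)]
    show "12 * m\<^sup>2 * S\<^sup>2 * d + 12 * c\<^sup>2 * \<epsilon>\<^sup>2 * d \<le> d / 2" by simp
  qed
  finally show ?thesis .
qed

definition total_envelope where
  "total_envelope S u v g h = sqint (envelope 1 S u g) + sqint (envelope (-1) S v h)"

text \<open>The two half steps read \<open>a \<le> 12 p + d / 2\<close> and \<open>d \<le> 12 r + a /
  2\<close>; adding them and absorbing gives \<open>a + d \<le> 24 (p + r)\<close>. Absorption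
  needs \<open>a\<close> and \<open>d\<close> to be finite, which follows from the finiteness
  of the four envelopes of the solutions.\<close>
lemma window_stability:
  assumes S: "0 \<le> S" "S \<le> T"
    and c1: "continuous_on UNIV (\<lambda>(t, x). u t x)" "continuous_on UNIV (\<lambda>(t, x). v t x)"
    and c2: "continuous_on UNIV (\<lambda>(t, x). u' t x)" "continuous_on UNIV (\<lambda>(t, x). v' t x)"
    and t1: "transported 1 u (G1 u v)" "transported (-1) v (G2 u v)"
    and t2: "transported 1 u' (G1 u' v')" "transported (-1) v' (G2 u' v')"
    and e1: "total_envelope S u v (G1 u v) (G2 u v) \<le> ennreal \<epsilon>"
    and e2: "total_envelope S u' v' (G1 u' v') (G2 u' v') \<le> ennreal \<epsilon>"
  shows "total_envelope S (\<lambda>t x. u t x - u' t x) (\<lambda>t x. v t x - v' t x)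
      (\<lambda>t x. G1 u v t x - G1 u' v' t x) (\<lambda>t x. G2 u v t x - G2 u' v' t x)
    \<le> 24 * (sqint (\<lambda>x. cmod (u 0 x - u' 0 x)) + sqint (\<lambda>x. cmod (v 0 x - v' 0 x)))"
proof -
  note cG = continuous_on_rhs2[OF c1, of m \<alpha>] continuous_on_rhs2[OF c1(2,1), of m \<beta>]
  note cG' = continuous_on_rhs2[OF c2, of m \<alpha>] continuous_on_rhs2[OF c2(2,1), of m \<beta>]
  let ?A = "sqint (envelope 1 S (\<lambda>t x. u t x - u' t x) (\<lambda>t x. G1 u v t x - G1 u' v' t x))"
  let ?D = "sqint (envelope (-1) S (\<lambda>t x. v t x - v' t x) (\<lambda>t x. G2 u v t x - G2 u' v' t x))"
  let ?p = "sqint (\<lambda>x. cmod (u 0 x - u' 0 x))" and ?r = "sqint (\<lambda>x. cmod (v 0 x - v' 0 x))"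
  have e: "sqint (envelope 1 S u (G1 u v)) \<le> ennreal \<epsilon>" "sqint (envelope (-1) S v (G2 u v)) \<le> ennreal \<epsilon>"
    "sqint (envelope 1 S u' (G1 u' v')) \<le> ennreal \<epsilon>" "sqint (envelope (-1) S v' (G2 u' v')) \<le> ennreal \<epsilon>"
    using e1 e2 unfolding total_envelope_def by (auto intro: order_trans[rotated])
  have fin: "2 * ennreal \<epsilon> + 2 * ennreal \<epsilon> < top" by (simp add: ennreal_mult_less_top)
  have "?A \<le> 2 * sqint (envelope 1 S u (G1 u v)) + 2 * sqint (envelope 1 S u' (G1 u' v'))"
    by (intro sqint_add_le envelope_measurable c1 c2 cG cG' envelope_diff_le envelope_nonneg continuous_on_diff2)
  also have "\<dots> \<le> 2 * ennreal \<epsilon> + 2 * ennreal \<epsilon>" by (intro add_mono mult_left_mono e) auto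
  finally have "?A < top" using fin by (rule le_less_trans)
  then obtain a where a: "?A = ennreal a" "a \<ge> 0" by (cases ?A) auto
  have "?D \<le> 2 * sqint (envelope (-1) S v (G2 u v)) + 2 * sqint (envelope (-1) S v' (G2 u' v'))"
    by (intro sqint_add_le envelope_measurable c1 c2 cG cG' envelope_diff_le envelope_nonneg continuous_on_diff2)
  also have "\<dots> \<le> 2 * ennreal \<epsilon> + 2 * ennreal \<epsilon>" by (intro add_mono mult_left_mono e) auto
  finally have "?D < top" using fin by (rule le_less_trans)
  then obtain d where d: "?D = ennreal d" "d \<ge> 0" by (cases ?D) auto
  have 1: "?A \<le> 12 * ?p + ennreal (d / 2)"
    by (rule half_step[OF S _ c(1) c1 c2 cG(2) cG'(2) t1(1) t2(1)]) (use t1 t2 e d in auto)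
  have 2: "?D \<le> 12 * ?r + ennreal (a / 2)"
    by (rule half_step[OF S _ c(2) c1(2,1) c2(2,1) cG(1) cG'(1) t1(2) t2(2)]) (use t1 t2 e a in auto)
  show ?thesis
  proof (cases "?p < top \<and> ?r < top")
    case True
    then obtain p r where pr: "?p = ennreal p" "p \<ge> 0" "?r = ennreal r" "r \<ge> 0" by (cases ?p; cases ?r) auto
    have "ennreal a \<le> ennreal (12 * p + d / 2)" "ennreal d \<le> ennreal (12 * r + a / 2)"
      using 1 2 a d pr by (simp_all add: ennreal_plus ennreal_mult del: ennreal_plus[symmetric])
    hence "a \<le> 12 * p + d / 2" "d \<le> 12 * r + a / 2" using a d pr by (simp_all del: ennreal_plus)
    hence "2 * a \<le> 24 * p + d" "2 * d \<le> 24 * r + a" by simp_all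
    hence "a + d \<le> 24 * p + 24 * r" by linarith
    hence "a + d \<le> 24 * (p + r)" by (simp add: distrib_left)
    hence "ennreal (a + d) \<le> ennreal (24 * (p + r))" by (rule ennreal_leI)
    thus ?thesis using a d pr by (simp add: total_envelope_def ennreal_plus ennreal_mult del: ennreal_plus[symmetric])
  next
    case False
    hence "?p + ?r = top" by (auto simp: less_top[symmetric])
    hence "24 * (?p + ?r) = top" by (simp only:) (simp add: ennreal_mult_top)
    thus ?thesis by (simp only: top_greatest)
  qed
qed

end

section \<open>Conservation of charge\<close>

lemma sqint_cmod_eq_L2_norm:
  assumes "continuous_on UNIV f" "f \<in> L2"
  shows "sqint (\<lambda>x. cmod (f x)) = ennreal ((L2_norm f)\<^sup>2)"
proof -
  have [measurable]: "f \<in> borel_measurable borel" using assms(1) by (rule borel_measurable_continuous_onI)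
  have "sqint (\<lambda>x. cmod (f x)) = (\<integral>\<^sup>+x. ennreal ((cmod (f x))\<^sup>2) \<partial>lebesgue)"
    unfolding sqint_def by (rule nn_integral_completion[symmetric])
  also have "\<dots> = ennreal ((L2_norm f)\<^sup>2)"
    unfolding L2_norm_power2 by (rule nn_integral_eq_integral) (use L2D(2)[OF assms(2)] in auto)
  finally show ?thesis .
qed

lemma slice_continuous:
  fixes u :: "real \<Rightarrow> real \<Rightarrow> complex"
  shows "continuous_on UNIV (\<lambda>(t, x). u t x) \<Longrightarrow> continuous_on UNIV (u t)"
  using continuous_along_curve[of u UNIV "\<lambda>x. t" "\<lambda>x. x"] by (simp add: continuous_intros)

lemma transported_shift:
  assumes tr: "transported \<sigma> u g" and r: "r \<ge> 0"
  shows "transported \<sigma> (\<lambda>t. u (r + t)) (\<lambda>t. g (r + t))"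
  unfolding transported_def
proof (intro allI impI)
  fix t x :: real assume t: "t \<ge> 0"
  have "((\<lambda>s. u s ((x - \<sigma> * r) + \<sigma> * s)) has_vector_derivative g (r + t) ((x - \<sigma> * r) + \<sigma> * (r + t))) (at (r + t) within {0..})"
    using tr t r unfolding transported_def by auto
  hence "((\<lambda>s. u s ((x - \<sigma> * r) + \<sigma> * s)) has_vector_derivative g (r + t) ((x - \<sigma> * r) + \<sigma> * (r + t))) (at (r + t) within (\<lambda>s. r + s) ` {0..})"
    by (rule has_vector_derivative_within_subset) (use r in auto)
  moreover have "((\<lambda>s. r + s) has_vector_derivative 1) (at t within {0..})"
    by (auto intro!: derivative_eq_intros)
  ultimately have "((\<lambda>s. u s ((x - \<sigma> * r) + \<sigma> * s)) \<circ> (\<lambda>s. r + s) has_vector_derivative 1 *\<^sub>R g (r + t) ((x - \<sigma> * r) + \<sigma> * (r + t))) (at t within {0..})"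
    by (intro vector_diff_chain_within)
  thus "((\<lambda>s. u (r + s) (x + \<sigma> * s)) has_vector_derivative g (r + t) (x + \<sigma> * t)) (at t within {0..})"
    by (simp add: o_def algebra_simps)
qed

lemma continuous_on_time_shift:
  fixes u :: "real \<Rightarrow> real \<Rightarrow> complex"
  assumes "continuous_on UNIV (\<lambda>(t, x). u t x)"
  shows "continuous_on UNIV (\<lambda>(t, x). u (r + t) x)"
  unfolding case_prod_unfold by (intro continuous_along_curve[OF assms] continuous_intros)

lemma characteristic_solution_shift:
  assumes s: "characteristic_solution m \<alpha> \<beta> u v" and r: "r \<ge> 0"
  shows "characteristic_solution m \<alpha> \<beta> (\<lambda>t. u (r + t)) (\<lambda>t. v (r + t))"
  unfolding characteristic_solution_def
proof (intro conjI allI)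
  fix S
  obtain K where "\<forall>t\<in>{0..r + S}. (\<forall>x. cmod (u t x) \<le> K \<and> cmod (v t x) \<le> K) \<and> (L2_norm (u t))\<^sup>2 \<le> K \<and> (L2_norm (v t))\<^sup>2 \<le> K"
    using s unfolding characteristic_solution_def by meson
  thus "\<exists>K. \<forall>t\<in>{0..S}. (\<forall>x. cmod (u (r + t) x) \<le> K \<and> cmod (v (r + t) x) \<le> K) \<and> (L2_norm (u (r + t)))\<^sup>2 \<le> K \<and> (L2_norm (v (r + t)))\<^sup>2 \<le> K"
    using r by (intro exI[of _ K] ballI) auto
qed (use s r continuous_on_time_shift[of u r] continuous_on_time_shift[of v r]
      transported_shift[of 1 u "\<lambda>t x. rhs m \<alpha> (u t x) (v t x)" r]
      transported_shift[of "-1" v "\<lambda>t x. rhs m \<beta> (v t x) (u t x)" r] in \<open>auto simp: characteristic_solution_def\<close>)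

text \<open>Along a characteristic the derivative of \<open>|u|\<^sup>2\<close> is \<open>2 Re (cnj u
  g)\<close>. Integrate over the characteristic segment and over all starting points, and
  exchange the integrals; at a fixed time the shift by \<open>\<sigma> s\<close> does not
  affect the integral over the line.\<close>
lemma transported_square_balance:
  assumes tr: "transported \<sigma> u g" and cu: "continuous_on UNIV (\<lambda>(t, x). u t x)" and cg: "continuous_on UNIV (\<lambda>(t, x). g t x)"
    and S: "S \<ge> 0" and bounds: "\<forall>t\<in>{0..S}. u t \<in> L2 \<and> g t \<in> L2 \<and> (L2_norm (u t))\<^sup>2 \<le> K \<and> (L2_norm (g t))\<^sup>2 \<le> K"
  shows "integrable lborel (\<lambda>s. indicat_real {0..S} s * (\<integral>x. 2 * Re (cnj (u s x) * g s x) \<partial>lborel))"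
    and "(L2_norm (u S))\<^sup>2 - (L2_norm (u 0))\<^sup>2 = (\<integral>s. indicat_real {0..S} s * (\<integral>x. 2 * Re (cnj (u s x) * g s x) \<partial>lborel) \<partial>lborel)"
proof -
  note [continuous_intros] = continuous_along_curve[OF cu] continuous_along_curve[OF cg]
  note L = bounds[rule_format]
  define h where "h s x = 2 * Re (cnj (u s x) * g s x)" for s x
  \<comment> \<open>The integrand in characteristic coordinates, where Fubini separates starting points
    and times.\<close>
  define F where "F = (\<lambda>s x. indicat_real {0..S} s * h s (x + \<sigma> * s))"
  have hcont: "continuous_on X (\<lambda>z. h (p z) (q z))" if "continuous_on X p" "continuous_on X q" for X :: "'b::topological_space set" and p q
    unfolding h_def by (intro continuous_intros that)
  have Fm: "(\<lambda>(s, x). F s x) \<in> borel_measurable (lborel \<Otimes>\<^sub>M lborel)"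
  proof -
    have [measurable]: "(\<lambda>p. h (fst p) (snd p + \<sigma> * fst p)) \<in> borel_measurable (borel \<Otimes>\<^sub>M borel)"
      unfolding borel_prod by (intro borel_measurable_continuous_onI hcont continuous_intros)
    have [measurable]: "(indicator {0..S} :: real \<Rightarrow> real) \<in> borel_measurable borel" by simp
    show ?thesis unfolding F_def case_prod_unfold by measurable
  qed
  have hb: "\<bar>h s x\<bar> \<le> (cmod (u s x))\<^sup>2 + (cmod (g s x))\<^sup>2" for s x
  proof -
    have "\<bar>h s x\<bar> \<le> 2 * (cmod (u s x) * cmod (g s x))"
      unfolding h_def using abs_Re_le_cmod[of "cnj (u s x) * g s x"] by (simp add: norm_mult)
    thus ?thesis using sum_squares_bound[of "cmod (u s x)" "cmod (g s x)"] by (simp add: mult.assoc)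
  qed
  have K: "0 \<le> K" using L[of 0] S by (auto intro: order_trans[OF zero_le_power2])
  have um: "(\<lambda>x. cmod (u s x)) \<in> borel_measurable borel" "(\<lambda>x. cmod (g s x)) \<in> borel_measurable borel" for s
    by (intro borel_measurable_continuous_onI continuous_intros)+
  have Fint: "integrable (lborel \<Otimes>\<^sub>M lborel) (\<lambda>(s, x). F s x)"
  proof (rule integrableI_bounded[OF Fm])
    have "(\<integral>\<^sup>+p. ennreal (norm (case p of (s, x) \<Rightarrow> F s x)) \<partial>(lborel \<Otimes>\<^sub>M lborel)) = (\<integral>\<^sup>+s. (\<integral>\<^sup>+x. ennreal (norm (F s x)) \<partial>lborel) \<partial>lborel)"
      using Fm by (subst lborel.nn_integral_fst[symmetric]) auto
    also have "\<dots> \<le> (\<integral>\<^sup>+s. ennreal (2 * K) * indicator {0..S} s \<partial>lborel)"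
    proof (rule nn_integral_mono)
      fix s
      show "(\<integral>\<^sup>+x. ennreal (norm (F s x)) \<partial>lborel) \<le> ennreal (2 * K) * indicator {0..S} s"
      proof (cases "s \<in> {0..S}")
        case True
        have "(\<integral>\<^sup>+x. ennreal (norm (F s x)) \<partial>lborel) \<le> (\<integral>\<^sup>+x. ennreal ((cmod (u s (x + \<sigma> * s)))\<^sup>2) + ennreal ((cmod (g s (x + \<sigma> * s)))\<^sup>2) \<partial>lborel)"
          using True hb by (intro nn_integral_mono) (auto simp: F_def ennreal_plus[symmetric] simp del: ennreal_plus intro!: ennreal_leI)
        also have "\<dots> = sqint (\<lambda>x. cmod (u s (x + \<sigma> * s))) + sqint (\<lambda>x. cmod (g s (x + \<sigma> * s)))"
          unfolding sqint_def
        proof (rule nn_integral_add)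
          have "(\<lambda>x. (cmod (u s (x + \<sigma> * s)))\<^sup>2) \<in> borel_measurable borel" "(\<lambda>x. (cmod (g s (x + \<sigma> * s)))\<^sup>2) \<in> borel_measurable borel"
            by (intro borel_measurable_continuous_onI continuous_intros)+
          thus "(\<lambda>x. ennreal ((cmod (u s (x + \<sigma> * s)))\<^sup>2)) \<in> borel_measurable lborel" "(\<lambda>x. ennreal ((cmod (g s (x + \<sigma> * s)))\<^sup>2)) \<in> borel_measurable lborel"
            by auto
        qed
        also have "\<dots> = sqint (\<lambda>x. cmod (u s x)) + sqint (\<lambda>x. cmod (g s x))"
          using sqint_shift[OF um(1)] sqint_shift[OF um(2)] by simp
        also have "\<dots> = ennreal ((L2_norm (u s))\<^sup>2) + ennreal ((L2_norm (g s))\<^sup>2)"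
          using L[OF True] by (simp add: sqint_cmod_eq_L2_norm slice_continuous[OF cu] slice_continuous[OF cg])
        also have "\<dots> \<le> ennreal (2 * K)" using L[OF True]
          by (auto simp: ennreal_plus[symmetric] simp del: ennreal_plus intro!: ennreal_leI)
        finally show ?thesis using True by simp
      qed (simp add: F_def)
    qed
    also have "\<dots> < \<infinity>" using S by (simp add: nn_integral_cmult_indicator ennreal_mult_less_top)
    finally show "(\<integral>\<^sup>+p. ennreal (norm (case p of (s, x) \<Rightarrow> F s x)) \<partial>(lborel \<Otimes>\<^sub>M lborel)) < \<infinity>" .
  qed
  have inner: "(\<integral>x. F s x \<partial>lborel) = indicat_real {0..S} s * (\<integral>x. h s x \<partial>lborel)" for s
  proof -
    have "(\<integral>x. h s x \<partial>lborel) = (\<integral>x. h s (x + \<sigma> * s) \<partial>lborel)"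
      by (subst lborel_integral_real_affine[of 1 _ "\<sigma> * s"]) (auto simp: add.commute)
    thus ?thesis by (simp add: F_def)
  qed
  have outer: "(\<integral>s. F s x \<partial>lborel) = (cmod (u S (x + \<sigma> * S)))\<^sup>2 - (cmod (u 0 x))\<^sup>2" for x
  proof -
    have "((\<lambda>s. h s (x + \<sigma> * s)) has_integral (cmod (u S (x + \<sigma> * S)))\<^sup>2 - (cmod (u 0 (x + \<sigma> * 0)))\<^sup>2) {0..S}"
    proof (rule fundamental_theorem_of_calculus[OF S])
      fix s assume s: "s \<in> {0..S}"
      have "((\<lambda>s. u s (x + \<sigma> * s)) has_vector_derivative g s (x + \<sigma> * s)) (at s within {0..S})"
        by (rule has_vector_derivative_within_subset[of _ _ _ "{0..}"]) (use tr s in \<open>auto simp: transported_def\<close>)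
      hence D: "((\<lambda>s. u s (x + \<sigma> * s)) has_derivative (\<lambda>r. r *\<^sub>R g s (x + \<sigma> * s))) (at s within {0..S})"
        by (simp add: has_vector_derivative_def)
      have "(\<lambda>r. u s (x + \<sigma> * s) \<bullet> r *\<^sub>R g s (x + \<sigma> * s) + r *\<^sub>R g s (x + \<sigma> * s) \<bullet> u s (x + \<sigma> * s))
          = (\<lambda>r. r *\<^sub>R h s (x + \<sigma> * s))"
        by (simp add: fun_eq_iff h_def inner_complex_def algebra_simps)
      with has_derivative_inner[OF D D]
      show "((\<lambda>s. (cmod (u s (x + \<sigma> * s)))\<^sup>2) has_vector_derivative h s (x + \<sigma> * s)) (at s within {0..S})"
        by (simp add: has_vector_derivative_def power2_norm_eq_inner)
    qed
    moreover have "set_integrable lborel {0..S} (\<lambda>s. h s (x + \<sigma> * s))"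
      by (intro borel_integrable_atLeastAtMost' hcont continuous_intros)
    ultimately show ?thesis
      using set_borel_integral_eq_integral(2)[of "{0..S}" "\<lambda>s. h s (x + \<sigma> * s)"]
      by (simp add: set_lebesgue_integral_def F_def integral_unique)
  qed
  have "integrable lborel (\<lambda>s. \<integral>x. F s x \<partial>lborel)" by (rule lborel_pair.integrable_fst[OF Fint])
  thus "integrable lborel (\<lambda>s. indicat_real {0..S} s * (\<integral>x. 2 * Re (cnj (u s x) * g s x) \<partial>lborel))"
    unfolding inner by (simp only: h_def[abs_def])
  have "(\<integral>x. (\<integral>s. F s x \<partial>lborel) \<partial>lborel) = (\<integral>s. (\<integral>x. F s x \<partial>lborel) \<partial>lborel)"
    by (rule lborel_pair.Fubini_integral[OF Fint])
  moreover have "(\<integral>x. (\<integral>s. F s x \<partial>lborel) \<partial>lborel) = (L2_norm (u S))\<^sup>2 - (L2_norm (u 0))\<^sup>2"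
  proof -
    have sq: "(\<integral>x. (cmod (u t x))\<^sup>2 \<partial>lborel) = (L2_norm (u t))\<^sup>2" "integrable lborel (\<lambda>x. (cmod (u t x))\<^sup>2)" if "t \<in> {0..S}" for t
    proof -
      have m: "(\<lambda>x. (cmod (u t x))\<^sup>2) \<in> borel_measurable lborel" using um(1)[of t] by simp
      show "(\<integral>x. (cmod (u t x))\<^sup>2 \<partial>lborel) = (L2_norm (u t))\<^sup>2"
        unfolding L2_norm_power2 by (rule integral_completion[OF m, symmetric])
      show "integrable lborel (\<lambda>x. (cmod (u t x))\<^sup>2)"
        using L[OF that] L2D(2)[of "u t"] integrable_completion[OF m] by auto
    qed
    have sh: "(\<integral>x. (cmod (u S (x + \<sigma> * S)))\<^sup>2 \<partial>lborel) = (\<integral>x. (cmod (u S x))\<^sup>2 \<partial>lborel)"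
      by (subst (2) lborel_integral_real_affine[of 1 _ "\<sigma> * S"]) (auto simp: add.commute)
    have "integrable lborel (\<lambda>x. (cmod (u S (\<sigma> * S + 1 * x)))\<^sup>2)"
      using sq(2)[of S] S by (intro lborel_integrable_real_affine) auto
    hence "integrable lborel (\<lambda>x. (cmod (u S (x + \<sigma> * S)))\<^sup>2)" by (simp add: add.commute)
    thus ?thesis unfolding outer using sq[of 0] sq(1)[of S] S sh by simp
  qed
  ultimately show "(L2_norm (u S))\<^sup>2 - (L2_norm (u 0))\<^sup>2 = (\<integral>s. indicat_real {0..S} s * (\<integral>x. 2 * Re (cnj (u s x) * g s x) \<partial>lborel) \<partial>lborel)"
    unfolding inner by (simp only: h_def[abs_def])
qed

lemma rhs_linear_bound:
  assumes "m \<ge> 0" "cmod a \<le> K" "cmod b \<le> K"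
  shows "cmod (rhs m \<gamma> a b) \<le> (m + cubic_const \<gamma> * K\<^sup>2) * cmod b"
proof -
  have k: "0 \<le> cubic_const \<gamma>" by (simp add: cubic_const_def)
  have "cmod (rhs m \<gamma> a b - rhs m \<gamma> 0 0) \<le> m * cmod (b - 0) + cubic_const \<gamma> * (cmod (a - 0) * (cmod b)\<^sup>2 + cmod (0::complex) * ((cmod b + cmod (0::complex)) * cmod (b - 0)))"
    by (rule rhs_Lipschitz) (use assms in auto)
  hence "cmod (rhs m \<gamma> a b) \<le> m * cmod b + cubic_const \<gamma> * (cmod a * (cmod b)\<^sup>2)"
    by (simp add: rhs_def N1_def)
  also have "cmod a * (cmod b)\<^sup>2 \<le> (K * K) * cmod b"
    unfolding power2_eq_square mult.assoc[symmetric] using assms(2,3) by (intro mult_right_mono mult_mono) (auto intro: order_trans[OF norm_ge_zero])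
  finally show ?thesis using k
    by (simp add: distrib_right power2_eq_square mult.assoc mult_left_mono)
qed

lemma characteristic_solution_bounds:
  assumes s: "characteristic_solution m \<alpha> \<beta> u v" and m: "m \<ge> 0"
  obtains K where "K \<ge> 0" "\<And>t. t \<in> {0..S} \<Longrightarrow> (L2_norm (u t))\<^sup>2 \<le> K" "\<And>t. t \<in> {0..S} \<Longrightarrow> (L2_norm (v t))\<^sup>2 \<le> K"
    "\<And>t. t \<in> {0..S} \<Longrightarrow> (\<lambda>x. rhs m \<alpha> (u t x) (v t x)) \<in> L2 \<and> (L2_norm (\<lambda>x. rhs m \<alpha> (u t x) (v t x)))\<^sup>2 \<le> K"
    "\<And>t. t \<in> {0..S} \<Longrightarrow> (\<lambda>x. rhs m \<beta> (v t x) (u t x)) \<in> L2 \<and> (L2_norm (\<lambda>x. rhs m \<beta> (v t x) (u t x)))\<^sup>2 \<le> K"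
proof -
  have cu: "continuous_on UNIV (\<lambda>(t, x). u t x)" "continuous_on UNIV (\<lambda>(t, x). v t x)"
    and L: "\<And>t. t \<ge> 0 \<Longrightarrow> u t \<in> L2 \<and> v t \<in> L2"
    using s by (auto simp: characteristic_solution_def)
  obtain K where K: "\<And>t x. t \<in> {0..S} \<Longrightarrow> cmod (u t x) \<le> K \<and> cmod (v t x) \<le> K"
     "\<And>t. t \<in> {0..S} \<Longrightarrow> (L2_norm (u t))\<^sup>2 \<le> K \<and> (L2_norm (v t))\<^sup>2 \<le> K"
    using s unfolding characteristic_solution_def by meson
  define c where "c = max (cubic_const \<alpha>) (cubic_const \<beta>)"
  have c0: "0 \<le> c" by (simp add: c_def cubic_const_def le_max_iff_disj)
  define M where "M = m + c * K\<^sup>2"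
  have aux: "(\<lambda>x. rhs m \<gamma> (a x) (b x)) \<in> L2 \<and> (L2_norm (\<lambda>x. rhs m \<gamma> (a x) (b x)))\<^sup>2 \<le> max K (M\<^sup>2 * K)"
    if "cubic_const \<gamma> \<le> c" "continuous_on UNIV a" "continuous_on UNIV b" "b \<in> L2" "(L2_norm b)\<^sup>2 \<le> K"
      "\<And>x. cmod (a x) \<le> K" "\<And>x. cmod (b x) \<le> K" for \<gamma> a b
  proof -
    have pw: "cmod (rhs m \<gamma> (a x) (b x)) \<le> M * cmod (b x)" for x
      by (rule order_trans[OF rhs_linear_bound[OF m that(6,7)]])
         (use that(1) in \<open>auto simp: M_def intro!: mult_right_mono add_left_mono\<close>)
    hence pw2: "(cmod (rhs m \<gamma> (a x) (b x)))\<^sup>2 \<le> M\<^sup>2 * (cmod (b x))\<^sup>2" for x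
      using power_mono[OF pw[of x], of 2] by (simp add: power_mult_distrib)
    have cont: "continuous_on UNIV (\<lambda>x. rhs m \<gamma> (a x) (b x))" by (intro continuous_on_rhs that)
    have meas: "(\<lambda>x. rhs m \<gamma> (a x) (b x)) \<in> borel_measurable lebesgue"
      using borel_measurable_continuous_onI[OF cont] by (simp add: measurable_completion)
    have int: "integrable lebesgue (\<lambda>x. (cmod (rhs m \<gamma> (a x) (b x)))\<^sup>2)"
    proof (rule Bochner_Integration.integrable_bound)
      show "integrable lebesgue (\<lambda>x. M\<^sup>2 * (cmod (b x))\<^sup>2)" using L2D(2)[OF that(4)] by simp
    qed (use meas pw2 in auto)
    have "(L2_norm (\<lambda>x. rhs m \<gamma> (a x) (b x)))\<^sup>2 \<le> (\<integral>x. M\<^sup>2 * (cmod (b x))\<^sup>2 \<partial>lebesgue)"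
      unfolding L2_norm_power2 by (rule integral_mono) (use int pw2 L2D(2)[OF that(4)] in auto)
    also have "\<dots> = M\<^sup>2 * (L2_norm b)\<^sup>2" by (simp add: L2_norm_power2)
    also have "\<dots> \<le> M\<^sup>2 * K" using that(5) by (intro mult_left_mono) auto
    finally show ?thesis using int meas by (simp add: L2_def)
  qed
  have c': "cubic_const \<alpha> \<le> c" "cubic_const \<beta> \<le> c" by (auto simp: c_def)
  show ?thesis
  proof (rule that[of "max 0 (max K (M\<^sup>2 * K))"])
    fix t assume t: "t \<in> {0..S}"
    show "(L2_norm (u t))\<^sup>2 \<le> max 0 (max K (M\<^sup>2 * K))" "(L2_norm (v t))\<^sup>2 \<le> max 0 (max K (M\<^sup>2 * K))"
      using K(2)[OF t] by auto
    show "(\<lambda>x. rhs m \<alpha> (u t x) (v t x)) \<in> L2 \<and> (L2_norm (\<lambda>x. rhs m \<alpha> (u t x) (v t x)))\<^sup>2 \<le> max 0 (max K (M\<^sup>2 * K))"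
      using aux[OF c'(1) slice_continuous[OF cu(1)] slice_continuous[OF cu(2)], of t t] K t L[of t] by auto
    show "(\<lambda>x. rhs m \<beta> (v t x) (u t x)) \<in> L2 \<and> (L2_norm (\<lambda>x. rhs m \<beta> (v t x) (u t x)))\<^sup>2 \<le> max 0 (max K (M\<^sup>2 * K))"
      using aux[OF c'(2) slice_continuous[OF cu(2)] slice_continuous[OF cu(1)], of t t] K t L[of t] by auto
  qed simp
qed

text \<open>Adding the balances of \<open>u\<close> and \<open>v\<close>, the mass terms combine to
  \<open>\<i> m\<close> times a real number and have real part zero, and the cubic terms
  cancel by the hypothesis on \<open>N1\<close> and \<open>N2\<close>. Conservation needs both
  families together: charge moves between \<open>u\<close> and \<open>v\<close> through the
  coupling.\<close>
theorem charge_conservation: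
  assumes s: "characteristic_solution m \<alpha> \<beta> u v" and m: "m \<ge> 0"
    and A2: "\<And>a b. Re (\<i> * cnj a * N1 \<alpha> a b + \<i> * cnj b * N2 \<beta> a b) = 0" and t: "t \<ge> 0"
  shows "(L2_norm (u t))\<^sup>2 + (L2_norm (v t))\<^sup>2 = (L2_norm (u 0))\<^sup>2 + (L2_norm (v 0))\<^sup>2"
proof -
  let ?g = "\<lambda>t x. rhs m \<alpha> (u t x) (v t x)" and ?h = "\<lambda>t x. rhs m \<beta> (v t x) (u t x)"
  have cu: "continuous_on UNIV (\<lambda>(t, x). u t x)" "continuous_on UNIV (\<lambda>(t, x). v t x)"
    and L: "\<And>t. t \<ge> 0 \<Longrightarrow> u t \<in> L2" "\<And>t. t \<ge> 0 \<Longrightarrow> v t \<in> L2"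
    and tr: "transported 1 u ?g" "transported (-1) v ?h"
    using s by (auto simp: characteristic_solution_def)
  obtain K where K: "\<And>r. r \<in> {0..t} \<Longrightarrow> (L2_norm (u r))\<^sup>2 \<le> K" "\<And>r. r \<in> {0..t} \<Longrightarrow> (L2_norm (v r))\<^sup>2 \<le> K"
    "\<And>r. r \<in> {0..t} \<Longrightarrow> ?g r \<in> L2 \<and> (L2_norm (?g r))\<^sup>2 \<le> K"
    "\<And>r. r \<in> {0..t} \<Longrightarrow> ?h r \<in> L2 \<and> (L2_norm (?h r))\<^sup>2 \<le> K"
    by (rule characteristic_solution_bounds[OF s m, of t]) (rule that)
  have Lu: "\<forall>r\<in>{0..t}. u r \<in> L2 \<and> ?g r \<in> L2 \<and> (L2_norm (u r))\<^sup>2 \<le> K \<and> (L2_norm (?g r))\<^sup>2 \<le> K"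
    and Lv: "\<forall>r\<in>{0..t}. v r \<in> L2 \<and> ?h r \<in> L2 \<and> (L2_norm (v r))\<^sup>2 \<le> K \<and> (L2_norm (?h r))\<^sup>2 \<le> K"
    using K L by auto
  note bu = transported_square_balance[OF tr(1) cu(1) continuous_on_rhs2[OF cu] t Lu]
  note bv = transported_square_balance[OF tr(2) cu(2) continuous_on_rhs2[OF cu(2,1)] t Lv]
  have zero: "2 * Re (cnj a * rhs m \<alpha> a b) + 2 * Re (cnj b * rhs m \<beta> b a) = 0" for a b
  proof -
    have "cnj a * rhs m \<alpha> a b + cnj b * rhs m \<beta> b a
       = \<i> * of_real m * (cnj a * b + cnj (cnj a * b)) - (\<i> * cnj a * N1 \<alpha> a b + \<i> * cnj b * N2 \<beta> a b)"
      by (simp add: rhs_def N2_eq_N1 algebra_simps)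
    also have "cnj a * b + cnj (cnj a * b) = of_real (2 * Re (cnj a * b))" by (rule complex_add_cnj)
    finally have "Re (cnj a * rhs m \<alpha> a b + cnj b * rhs m \<beta> b a) = Re (\<i> * of_real m * of_real (2 * Re (cnj a * b))) - 0"
      using A2[of a b] by simp
    thus ?thesis by simp
  qed
  have int: "integrable lborel (\<lambda>x. 2 * Re (cnj (a x) * b x))"
    if "continuous_on UNIV a" "continuous_on UNIV b" "a \<in> L2" "b \<in> L2" for a b
  proof -
    have m: "(\<lambda>x. cnj (a x) * b x) \<in> borel_measurable borel"
      by (intro borel_measurable_continuous_onI continuous_intros that)
    have "(\<lambda>x. cnj (a x)) \<in> borel_measurable borel"
      by (intro borel_measurable_continuous_onI continuous_intros that)
    hence "(\<lambda>x. cnj (a x)) \<in> L2" using that(3) by (simp add: L2_def measurable_completion)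
    from L2_mult_integrable[OF this that(4)] have "integrable lborel (\<lambda>x. cnj (a x) * b x)"
      using m by (simp add: integrable_completion)
    thus ?thesis by (intro integrable_mult_right integrable_Re)
  qed
  have "((L2_norm (u t))\<^sup>2 - (L2_norm (u 0))\<^sup>2) + ((L2_norm (v t))\<^sup>2 - (L2_norm (v 0))\<^sup>2)
    = (\<integral>s. indicat_real {0..t} s * (\<integral>x. 2 * Re (cnj (u s x) * ?g s x) \<partial>lborel) + indicat_real {0..t} s * (\<integral>x. 2 * Re (cnj (v s x) * ?h s x) \<partial>lborel) \<partial>lborel)"
    unfolding bu(2) bv(2) by (rule Bochner_Integration.integral_add[symmetric, OF bu(1) bv(1)])
  also have "\<dots> = (\<integral>(s::real). (0::real) \<partial>lborel)"
  proof (rule Bochner_Integration.integral_cong[OF refl])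
    fix s
    show "indicat_real {0..t} s * (\<integral>x. 2 * Re (cnj (u s x) * ?g s x) \<partial>lborel) + indicat_real {0..t} s * (\<integral>x. 2 * Re (cnj (v s x) * ?h s x) \<partial>lborel) = 0"
    proof (cases "s \<in> {0..t}")
      case True
      have "(\<integral>x. 2 * Re (cnj (u s x) * ?g s x) \<partial>lborel) + (\<integral>x. 2 * Re (cnj (v s x) * ?h s x) \<partial>lborel)
         = (\<integral>x. 2 * Re (cnj (u s x) * ?g s x) + 2 * Re (cnj (v s x) * ?h s x) \<partial>lborel)"
        using True K(3,4)[OF True] L[of s]
        by (intro Bochner_Integration.integral_add[symmetric] int slice_continuous[OF cu(1)] slice_continuous[OF cu(2)]
            continuous_on_rhs) auto
      also have "\<dots> = 0" by (simp only: zero Bochner_Integration.integral_zero)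
      finally show ?thesis using True by simp
    qed simp
  qed
  finally show ?thesis by simp
qed

section \<open>Iteration over windows\<close>

lemma sqint_envelope_finite:
  assumes cu: "continuous_on UNIV (\<lambda>(t, x). u t x)" and cg: "continuous_on UNIV (\<lambda>(t, x). g t x)"
    and S: "S \<ge> 0" and u0: "u 0 \<in> L2" and K: "K \<ge> 0"
    and g: "\<And>t. t \<in> {0..S} \<Longrightarrow> g t \<in> L2 \<and> (L2_norm (g t))\<^sup>2 \<le> K"
  shows "sqint (envelope \<sigma> S u g) < top"
proof -
  let ?J = "\<lambda>x. integral {0..S} (\<lambda>s. cmod (g s (x + \<sigma> * s)))"
  have eJ: "?J = envelope \<sigma> S (\<lambda>t x. 0) g" by (simp add: envelope_def fun_eq_iff)
  have "continuous_on UNIV ?J" unfolding eJ by (intro continuous_on_envelope cg) (simp add: case_prod_unfold)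
  hence m: "?J \<in> borel_measurable borel" by (rule borel_measurable_continuous_onI)
  have m0: "(\<lambda>x. cmod (u 0 x)) \<in> borel_measurable borel"
    by (intro borel_measurable_continuous_onI continuous_on_norm slice_continuous[OF cu])
  have "sqint (envelope \<sigma> S u g) \<le> 2 * sqint (\<lambda>x. cmod (u 0 x)) + 2 * sqint ?J"
    by (intro sqint_add_le m m0 envelope_nonneg cg) (simp add: envelope_def)
  also have "\<dots> \<le> 2 * ennreal ((L2_norm (u 0))\<^sup>2) + 2 * ennreal (S\<^sup>2 * K)"
  proof (intro add_mono mult_left_mono)
    show "sqint (\<lambda>x. cmod (u 0 x)) \<le> ennreal ((L2_norm (u 0))\<^sup>2)"
      using sqint_cmod_eq_L2_norm[OF slice_continuous[OF cu] u0] by simp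
    show "sqint ?J \<le> ennreal (S\<^sup>2 * K)"
    proof (rule sqint_integral_along_line_le[OF continuous_on_cmod2[OF cg] _ S _ K])
      fix s assume s: "s \<in> {0..S}"
      show "sqint (\<lambda>x. cmod (g s x)) \<le> ennreal K"
        using g[OF s] by (simp add: sqint_cmod_eq_L2_norm[OF slice_continuous[OF cg]] ennreal_leI)
    qed simp
  qed auto
  also have "\<dots> < top" by (simp add: ennreal_mult_less_top)
  finally show ?thesis .
qed

text \<open>Dominated convergence: envelopes increase with the length of the window, so the longest one
  dominates.\<close>
lemma continuous_on_sqint_envelope:
  assumes cu: "continuous_on UNIV (\<lambda>(t, x). u t x)" and cg: "continuous_on UNIV (\<lambda>(t, x). g t x)"
    and fin: "sqint (envelope \<sigma> T u g) < top"
  shows "continuous_on {0..T} (\<lambda>S. sqint (envelope \<sigma> S u g))"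
  unfolding continuous_on_sequentially
proof (intro allI ballI impI, elim conjE)
  fix X :: "nat \<Rightarrow> real" and S assume S: "S \<in> {0..T}" and X: "\<forall>n. X n \<in> {0..T}" "X \<longlonglongrightarrow> S"
  have m: "envelope \<sigma> R u g \<in> borel_measurable borel" for R
    by (intro borel_measurable_continuous_onI continuous_on_envelope cu cg)
  have "(\<lambda>n. \<integral>\<^sup>+x. ennreal ((envelope \<sigma> (X n) u g x)\<^sup>2) \<partial>lborel) \<longlonglongrightarrow> (\<integral>\<^sup>+x. ennreal ((envelope \<sigma> S u g x)\<^sup>2) \<partial>lborel)"
  proof (rule nn_integral_dominated_convergence[where w="\<lambda>x. ennreal ((envelope \<sigma> T u g x)\<^sup>2)"])
    show "(\<integral>\<^sup>+x. ennreal ((envelope \<sigma> T u g x)\<^sup>2) \<partial>lborel) < \<infinity>" using fin by (simp add: sqint_def)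
    show "AE x in lborel. ennreal ((envelope \<sigma> (X n) u g x)\<^sup>2) \<le> ennreal ((envelope \<sigma> T u g x)\<^sup>2)" for n
      using X(1) by (intro AE_I2 ennreal_leI power_mono envelope_mono envelope_nonneg cg) auto
    show "AE x in lborel. (\<lambda>n. ennreal ((envelope \<sigma> (X n) u g x)\<^sup>2)) \<longlonglongrightarrow> ennreal ((envelope \<sigma> S u g x)\<^sup>2)"
    proof (intro AE_I2 tendsto_ennrealI tendsto_power)
      fix x
      have "continuous_on {0..T} (\<lambda>R. envelope \<sigma> R u g x)"
        unfolding envelope_def
        by (intro continuous_intros indefinite_integral_continuous_1 envelope_integrable[OF cg])
      from continuous_on_tendsto_compose[OF this X(2) S] X(1)
      show "(\<lambda>n. envelope \<sigma> (X n) u g x) \<longlonglongrightarrow> envelope \<sigma> S u g x" by simp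
    qed
  qed (use m in auto)
  thus "((\<lambda>S. sqint (envelope \<sigma> S u g)) \<circ> X) \<longlonglongrightarrow> sqint (envelope \<sigma> S u g)"
    by (simp add: sqint_def o_def)
qed

context small_window
begin

text \<open>The number 48 is twice the constant of the stability estimate; it leaves room for the
  continuity argument that bounds the envelopes.\<close>
definition charge_small where
  "charge_small u v \<longleftrightarrow> (\<forall>t\<ge>0. (L2_norm (u t))\<^sup>2 + (L2_norm (v t))\<^sup>2 \<le> \<epsilon> / 48)"

text \<open>A continuity argument in the length \<open>S\<close> of the window. If the total envelope
  exceeded \<open>\<epsilon>\<close> it would be equal to \<open>\<epsilon>\<close> for some
  \<open>S\<close>. For this \<open>S\<close> the stability estimate against the zero solution
  is available and gives at most \<open>24 * \<epsilon> / 48 = \<epsilon> / 2\<close>.\<close>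
lemma a_priori_envelope:
  assumes s: "sol u v" and small: "(L2_norm (u 0))\<^sup>2 + (L2_norm (v 0))\<^sup>2 \<le> \<epsilon> / 48"
  shows "total_envelope T u v (G1 u v) (G2 u v) \<le> ennreal \<epsilon>"
proof (rule ccontr)
  assume contra: "\<not> total_envelope T u v (G1 u v) (G2 u v) \<le> ennreal \<epsilon>"
  define f where "f S = total_envelope S u v (G1 u v) (G2 u v)" for S
  note d = solD[OF s]
  have L: "u 0 \<in> L2" "v 0 \<in> L2" using s by (auto simp: characteristic_solution_def)
  obtain K where K: "K \<ge> 0" "\<And>r. r \<in> {0..T} \<Longrightarrow> G1 u v r \<in> L2 \<and> (L2_norm (G1 u v r))\<^sup>2 \<le> K"
    "\<And>r. r \<in> {0..T} \<Longrightarrow> G2 u v r \<in> L2 \<and> (L2_norm (G2 u v r))\<^sup>2 \<le> K"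
    by (rule characteristic_solution_bounds[OF s m, of T]) (rule that)
  have T0: "0 \<le> T" using T(1) by simp
  have cont: "continuous_on {0..T} f"
    unfolding f_def total_envelope_def
    by (intro continuous_on_add_ennreal continuous_on_sqint_envelope d
        sqint_envelope_finite[OF d(1) d(3) T0 L(1) K(1,2)] sqint_envelope_finite[OF d(2) d(4) T0 L(2) K(1,3)])
  have f0: "sqint (\<lambda>x. cmod (u 0 x)) + sqint (\<lambda>x. cmod (v 0 x)) \<le> ennreal (\<epsilon> / 48)"
    using small by (simp add: sqint_cmod_eq_L2_norm[OF slice_continuous[OF d(1)] L(1)]
        sqint_cmod_eq_L2_norm[OF slice_continuous[OF d(2)] L(2)] ennreal_leI ennreal_plus[symmetric] del: ennreal_plus)
  have "f 0 = sqint (\<lambda>x. cmod (u 0 x)) + sqint (\<lambda>x. cmod (v 0 x))"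
    by (simp add: f_def total_envelope_def envelope_def[abs_def])
  also have "\<dots> \<le> ennreal \<epsilon>" by (rule order_trans[OF f0]) (use \<epsilon>(1) in \<open>auto intro!: ennreal_leI\<close>)
  finally have "f 0 \<le> ennreal \<epsilon>" .
  moreover have "ennreal \<epsilon> \<le> f T" using contra by (simp add: f_def)
  ultimately obtain S where S: "S \<in> {0..T}" "f S = ennreal \<epsilon>"
    using IVT'[of f 0 "ennreal \<epsilon>" T] cont T0 by auto
  have z: "rhs m \<gamma> 0 0 = 0" for \<gamma> by (simp add: rhs_def N1_def)
  have "f S \<le> 24 * (sqint (\<lambda>x. cmod (u 0 x)) + sqint (\<lambda>x. cmod (v 0 x)))"
    using window_stability[of S u v "\<lambda>t x. 0" "\<lambda>t x. 0"] S d
    by (simp add: f_def z transported_def case_prod_unfold total_envelope_def envelope_def sqint_def)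
  also have "\<dots> \<le> 24 * ennreal (\<epsilon> / 48)" by (rule mult_left_mono[OF f0]) simp
  also have "\<dots> = ennreal (\<epsilon> / 2)" using \<epsilon>(1) by (simp add: ennreal_mult'[symmetric] flip: ennreal_numeral)
  finally show False using S(2) \<epsilon>(1) by simp
qed

definition deviation where
  "deviation u v u' v' t = sqint (\<lambda>x. cmod (u t x - u' t x)) + sqint (\<lambda>x. cmod (v t x - v' t x))"

abbreviation "envelope_u u v u' v' r \<equiv> envelope 1 T (\<lambda>t x. u (r + t) x - u' (r + t) x) (\<lambda>t x. G1 u v (r + t) x - G1 u' v' (r + t) x)"
abbreviation "envelope_v u v u' v' r \<equiv> envelope (-1) T (\<lambda>t x. v (r + t) x - v' (r + t) x) (\<lambda>t x. G2 u v (r + t) x - G2 u' v' (r + t) x)"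

text \<open>Solutions may be restarted at any time \<open>r\<close>, and the charge at time
  \<open>r\<close> is still small.\<close>
lemma stability_after_time:
  assumes s: "sol u v" "sol u' v'" and small: "charge_small u v" "charge_small u' v'" and r: "r \<ge> 0"
  shows "sqint (envelope_u u v u' v' r) + sqint (envelope_v u v u' v' r) \<le> 24 * deviation u v u' v' r"
proof -
  note sh = characteristic_solution_shift[OF s(1) r] characteristic_solution_shift[OF s(2) r]
  note d = solD[OF sh(1)] and d' = solD[OF sh(2)]
  have e: "total_envelope T (\<lambda>t. u (r + t)) (\<lambda>t. v (r + t)) (G1 (\<lambda>t. u (r + t)) (\<lambda>t. v (r + t))) (G2 (\<lambda>t. u (r + t)) (\<lambda>t. v (r + t))) \<le> ennreal \<epsilon>"
    using small(1) r by (intro a_priori_envelope sh) (simp add: charge_small_def)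
  have e': "total_envelope T (\<lambda>t. u' (r + t)) (\<lambda>t. v' (r + t)) (G1 (\<lambda>t. u' (r + t)) (\<lambda>t. v' (r + t))) (G2 (\<lambda>t. u' (r + t)) (\<lambda>t. v' (r + t))) \<le> ennreal \<epsilon>"
    using small(2) r by (intro a_priori_envelope sh) (simp add: charge_small_def)
  show ?thesis
    using window_stability[OF less_imp_le[OF T(1)] order_refl d(1,2) d'(1,2) d(5,6) d'(5,6) e e']
    by (simp add: total_envelope_def deviation_def)
qed

lemma deviation_growth_window:
  assumes s: "sol u v" "sol u' v'" and small: "charge_small u v" "charge_small u' v'"
    and r: "r \<ge> 0" and t: "t \<in> {0..T}"
  shows "deviation u v u' v' (r + t) \<le> 24 * deviation u v u' v' r"
proof -
  note sh = characteristic_solution_shift[OF s(1) r] characteristic_solution_shift[OF s(2) r]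
  note d = solD[OF sh(1)] and d' = solD[OF sh(2)]
  have one: "sqint (\<lambda>x. cmod (a t x - a' t x)) \<le> sqint (envelope \<sigma> T (\<lambda>t x. a t x - a' t x) (\<lambda>t x. g t x - g' t x))"
    if "transported \<sigma> a g" "transported \<sigma> a' g'" "continuous_on UNIV (\<lambda>(t, x). g t x)" "continuous_on UNIV (\<lambda>(t, x). g' t x)"
      "continuous_on UNIV (\<lambda>(t, x). a t x)" "continuous_on UNIV (\<lambda>(t, x). a' t x)" for \<sigma> a a' g g'
  proof -
    have m: "(\<lambda>x. cmod (a t x - a' t x)) \<in> borel_measurable borel"
      using that by (intro borel_measurable_continuous_onI continuous_intros slice_continuous)
    have "sqint (\<lambda>x. cmod (a t x - a' t x)) = sqint (\<lambda>x. cmod (a t (x + \<sigma> * t) - a' t (x + \<sigma> * t)))"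
      using sqint_shift[OF m] by simp
    also have "\<dots> \<le> sqint (envelope \<sigma> T (\<lambda>t x. a t x - a' t x) (\<lambda>t x. g t x - g' t x))"
      using transported_le_envelope[OF continuous_on_diff2[OF that(3,4)] transported_diff[OF that(1,2)] t]
      by (intro sqint_mono) auto
    finally show ?thesis .
  qed
  have "deviation u v u' v' (r + t) \<le> sqint (envelope_u u v u' v' r) + sqint (envelope_v u v u' v' r)"
    unfolding deviation_def
    by (intro add_mono one[OF d(5) d'(5) d(3) d'(3) d(1) d'(1)] one[OF d(6) d'(6) d(4) d'(4) d(2) d'(2)])
  also have "\<dots> \<le> 24 * deviation u v u' v' r" by (rule stability_after_time[OF s small r])
  finally show ?thesis .
qed

lemma deviation_growth:
  assumes s: "sol u v" "sol u' v'" and small: "charge_small u v" "charge_small u' v'"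
    and t: "0 \<le> t" "t \<le> real n * T"
  shows "deviation u v u' v' t \<le> 24 ^ n * deviation u v u' v' 0"
  using t
proof (induction n arbitrary: t)
  case (Suc n)
  have one: "(1::ennreal) \<le> 24" by simp
  show ?case
  proof (cases "t \<le> real n * T")
    case True
    have "deviation u v u' v' t \<le> 1 * (24 ^ n * deviation u v u' v' 0)" using Suc.IH Suc.prems True by simp
    also have "\<dots> \<le> 24 * (24 ^ n * deviation u v u' v' 0)" by (rule mult_right_mono[OF one]) simp
    finally show ?thesis by (simp add: mult.assoc)
  next
    case False
    define r where "r = real n * T"
    have r: "r \<ge> 0" using T(1) by (simp add: r_def)
    have "t - r \<in> {0..T}" using False Suc.prems by (auto simp: r_def distrib_right)
    from deviation_growth_window[OF s small r this]
    have "deviation u v u' v' t \<le> 24 * deviation u v u' v' r" by simp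
    also have "\<dots> \<le> 24 * (24 ^ n * deviation u v u' v' 0)"
      using Suc.IH[OF r] by (intro mult_left_mono) (auto simp: r_def)
    finally show ?thesis by (simp add: mult.assoc)
  qed
qed simp

end

section \<open>Integrals over boxes\<close>

text \<open>Iterated in this order, time last, because both the bounds on windows and the convergence at
  almost every \<open>x\<close> are available for each fixed time.\<close>
definition box_integral :: "real \<Rightarrow> real \<Rightarrow> (real \<Rightarrow> real \<Rightarrow> real) \<Rightarrow> ennreal" where
  "box_integral \<rho> S f = (\<integral>\<^sup>+s. (\<integral>\<^sup>+y. ennreal (f s y) * indicator {-\<rho>..\<rho>} y \<partial>lborel) * indicator {0..S} s \<partial>lborel)"

text \<open>A box lies in the union of the characteristic segments that start within distance
  \<open>T\<close> of its base.\<close>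
lemma box_integral_window_le:
  fixes f :: "real \<Rightarrow> real \<Rightarrow> real"
  assumes f: "continuous_on UNIV (\<lambda>(s, x). f s x)" "\<And>s x. 0 \<le> f s x" and \<sigma>: "\<bar>\<sigma>\<bar> = 1" and T: "T \<ge> 0"
  shows "box_integral \<rho> T f \<le> (\<integral>\<^sup>+x. ennreal (integral {0..T} (\<lambda>s. f s (x + \<sigma> * s))) * indicator {-(\<rho> + T)..\<rho> + T} x \<partial>lborel)"
proof -
  note [continuous_intros] = continuous_along_curve[OF f(1)]
  let ?I = "\<lambda>x. indicator {-(\<rho> + T)..\<rho> + T} x :: ennreal"
  let ?F = "\<lambda>s x. ennreal (f s (x + \<sigma> * s)) * indicator {0..T} s * ?I x"
  have [measurable]: "(\<lambda>p. f (fst p) (snd p + \<sigma> * fst p)) \<in> borel_measurable (borel \<Otimes>\<^sub>M borel)"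
    "(\<lambda>p. f (snd p) (fst p + \<sigma> * snd p)) \<in> borel_measurable (borel \<Otimes>\<^sub>M borel)"
    unfolding borel_prod by (intro borel_measurable_continuous_onI continuous_intros)+
  have [measurable]: "(indicator A :: real \<Rightarrow> ennreal) \<in> borel_measurable borel" if "A \<in> sets borel" for A
    using that by simp
  have fs: "f s \<in> borel_measurable borel" for s by (intro borel_measurable_continuous_onI continuous_intros)
  have "box_integral \<rho> T f \<le> (\<integral>\<^sup>+s. (\<integral>\<^sup>+x. ?F s x \<partial>lborel) \<partial>lborel)"
    unfolding box_integral_def
  proof (rule nn_integral_mono)
    fix s
    show "(\<integral>\<^sup>+y. ennreal (f s y) * indicator {-\<rho>..\<rho>} y \<partial>lborel) * indicator {0..T} s \<le> (\<integral>\<^sup>+x. ?F s x \<partial>lborel)"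
    proof (cases "s \<in> {0..T}")
      case True
      have "(\<integral>\<^sup>+y. ennreal (f s y) * indicator {-\<rho>..\<rho>} y \<partial>lborel)
        = (\<integral>\<^sup>+x. ennreal (f s (\<sigma> * s + 1 * x)) * indicator {-\<rho>..\<rho>} (\<sigma> * s + 1 * x) \<partial>lborel)"
        using fs by (subst nn_integral_real_affine[of _ 1 "\<sigma> * s"]) auto
      also have "\<dots> \<le> (\<integral>\<^sup>+x. ?F s x \<partial>lborel)"
      proof (rule nn_integral_mono)
        fix x
        have "\<bar>\<sigma> * s\<bar> \<le> T" using True \<sigma> by (simp add: abs_mult)
        thus "ennreal (f s (\<sigma> * s + 1 * x)) * indicator {-\<rho>..\<rho>} (\<sigma> * s + 1 * x) \<le> ?F s x"
          using True by (auto simp: indicator_def add.commute)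
      qed
      finally show ?thesis using True by simp
    qed simp
  qed
  also have "\<dots> = (\<integral>\<^sup>+x. (\<integral>\<^sup>+s. ?F s x \<partial>lborel) \<partial>lborel)"
    by (rule lborel_pair.Fubini'[symmetric]) measurable
  also have "\<dots> = (\<integral>\<^sup>+x. ennreal (integral {0..T} (\<lambda>s. f s (x + \<sigma> * s))) * ?I x \<partial>lborel)"
  proof (rule nn_integral_cong)
    fix x
    have [measurable]: "(\<lambda>s. f s (x + \<sigma> * s)) \<in> borel_measurable borel"
      by (intro borel_measurable_continuous_onI continuous_intros)
    have "(\<integral>\<^sup>+s. ?F s x \<partial>lborel) = (\<integral>\<^sup>+s. ennreal (f s (x + \<sigma> * s)) * indicator {0..T} s \<partial>lborel) * ?I x"
      by (rule nn_integral_multc) measurable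
    also have "(\<integral>\<^sup>+s. ennreal (f s (x + \<sigma> * s)) * indicator {0..T} s \<partial>lborel) = ennreal (integral {0..T} (\<lambda>s. f s (x + \<sigma> * s)))"
      using f(2) by (intro nn_integral_Icc_eq_integral continuous_intros)
    finally show "(\<integral>\<^sup>+s. ?F s x \<partial>lborel) = ennreal (integral {0..T} (\<lambda>s. f s (x + \<sigma> * s))) * ?I x" .
  qed
  finally show ?thesis .
qed

text \<open>From \<open>E \<le> \<kappa> + E\<^sup>2 / \<kappa>\<close>. With \<open>\<kappa>\<close>
  chosen small first and the square integral small afterwards, the right-hand side is
  arbitrarily small; this replaces Cauchy-Schwarz and avoids square roots of extended numbers.\<close>
lemma nn_integral_interval_le_sqint:
  fixes E :: "real \<Rightarrow> real"
  assumes [measurable]: "E \<in> borel_measurable borel" and \<kappa>: "\<kappa> > 0" and \<rho>: "\<rho> \<ge> 0"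
  shows "(\<integral>\<^sup>+x. ennreal (E x) * indicator {-\<rho>..\<rho>} x \<partial>lborel) \<le> ennreal (2 * \<rho> * \<kappa>) + ennreal (1 / \<kappa>) * sqint E"
proof -
  have pw: "E x \<le> \<kappa> + 1 / \<kappa> * (E x)\<^sup>2" for x
  proof -
    have "\<kappa> * E x \<le> \<kappa>\<^sup>2 + (E x)\<^sup>2"
    proof (cases "E x \<ge> 0")
      case False
      hence "\<kappa> * E x \<le> 0" using \<kappa> by (intro mult_nonneg_nonpos) auto
      moreover have "0 \<le> \<kappa>\<^sup>2 + (E x)\<^sup>2" by simp
      ultimately show ?thesis by linarith
    qed (use \<kappa> mult_le_sum_power2[of \<kappa> "E x"] in auto)
    thus ?thesis using \<kappa> by (simp add: field_simps power2_eq_square)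
  qed
  have "(\<integral>\<^sup>+x. ennreal (E x) * indicator {-\<rho>..\<rho>} x \<partial>lborel)
      \<le> (\<integral>\<^sup>+x. ennreal \<kappa> * indicator {-\<rho>..\<rho>} x + ennreal (1 / \<kappa>) * ennreal ((E x)\<^sup>2) \<partial>lborel)"
  proof (rule nn_integral_mono)
    fix x
    have "ennreal (E x) \<le> ennreal (\<kappa> + 1 / \<kappa> * (E x)\<^sup>2)" by (rule ennreal_leI[OF pw])
    also have "\<dots> = ennreal \<kappa> + ennreal (1 / \<kappa>) * ennreal ((E x)\<^sup>2)"
      using \<kappa> by (subst ennreal_plus) (auto simp: ennreal_mult'[symmetric])
    finally show "ennreal (E x) * indicator {-\<rho>..\<rho>} x \<le> ennreal \<kappa> * indicator {-\<rho>..\<rho>} x + ennreal (1 / \<kappa>) * ennreal ((E x)\<^sup>2)"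
      by (simp add: indicator_def)
  qed
  also have "\<dots> = ennreal \<kappa> * ennreal (2 * \<rho>) + ennreal (1 / \<kappa>) * sqint E"
    unfolding sqint_def using \<rho> by (simp add: nn_integral_add nn_integral_cmult nn_integral_cmult_indicator)
  also have "ennreal \<kappa> * ennreal (2 * \<rho>) = ennreal (2 * \<rho> * \<kappa>)"
    using \<kappa> by (simp add: ennreal_mult'[symmetric] mult.commute)
  finally show ?thesis .
qed

lemma box_integral_by_windows:
  fixes f :: "real \<Rightarrow> real \<Rightarrow> real"
  assumes f: "continuous_on UNIV (\<lambda>(s, x). f s x)" and T: "T > 0"
    and B: "\<And>j. j < n \<Longrightarrow> box_integral \<rho> T (\<lambda>s. f (real j * T + s)) \<le> B"
  shows "box_integral \<rho> (real n * T) f \<le> of_nat n * B"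
proof -
  define h where "h s = (\<integral>\<^sup>+y. ennreal (f s y) * indicator {-\<rho>..\<rho>} y \<partial>lborel)" for s
  have [measurable]: "h \<in> borel_measurable borel"
  proof -
    have [measurable]: "(\<lambda>p. f (fst p) (snd p)) \<in> borel_measurable (borel \<Otimes>\<^sub>M borel)"
      unfolding borel_prod by (intro borel_measurable_continuous_onI continuous_along_curve[OF f] continuous_intros)
    have [measurable]: "(indicator {-\<rho>..\<rho>} :: real \<Rightarrow> ennreal) \<in> borel_measurable borel" by simp
    show ?thesis unfolding h_def by measurable
  qed
  have "j \<le> n \<Longrightarrow> box_integral \<rho> (real j * T) f \<le> of_nat j * B" for j
  proof (induction j)
    case 0
    have "box_integral \<rho> 0 f = 0"
      unfolding box_integral_def h_def[symmetric]
    proof (subst nn_integral_0_iff_AE)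
      show "AE s in lborel. h s * indicator {0..0} s = 0"
        using AE_lborel_singleton[of "0::real"] by eventually_elim (auto simp: indicator_def)
    qed measurable
    thus ?case by simp
  next
    case (Suc j)
    let ?r = "real j * T"
    have r: "?r \<ge> 0" using T by simp
    have "box_integral \<rho> (real (Suc j) * T) f \<le> (\<integral>\<^sup>+s. h s * indicator {0..?r} s + h s * indicator {?r..?r + T} s \<partial>lborel)"
      unfolding box_integral_def h_def[symmetric] by (rule nn_integral_mono) (auto simp: indicator_def distrib_right)
    also have "\<dots> = box_integral \<rho> ?r f + (\<integral>\<^sup>+s. h s * indicator {?r..?r + T} s \<partial>lborel)"
      unfolding box_integral_def h_def[symmetric] by (rule nn_integral_add) measurable
    also have "(\<integral>\<^sup>+s. h s * indicator {?r..?r + T} s \<partial>lborel) = (\<integral>\<^sup>+s. h (?r + 1 * s) * indicator {?r..?r + T} (?r + 1 * s) \<partial>lborel)"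
      by (subst nn_integral_real_affine[of _ 1 ?r]) auto
    also have "\<dots> = box_integral \<rho> T (\<lambda>s. f (?r + s))"
      unfolding box_integral_def h_def[symmetric] by (rule nn_integral_cong) (auto simp: indicator_def h_def)
    also have "box_integral \<rho> ?r f + \<dots> \<le> of_nat j * B + B"
      using Suc B[of j] by (intro add_mono) auto
    finally show ?case by (simp add: distrib_right add.commute)
  qed
  thus ?thesis by simp
qed

context small_window
begin

text \<open>The envelope of a difference contains the integral of the difference of the right-hand sides
  along the characteristic. So smallness of the envelopes in \<open>L\<^sup>2\<close> makes
  the right-hand sides close in \<open>L\<^sup>1\<close> of boxes.\<close>
lemma box_integral_deviation:
  fixes n :: nat
  assumes s: "sol u v" "sol u' v'" and small: "charge_small u v" "charge_small u' v'"
    and \<kappa>: "\<kappa> > 0" and \<rho>: "\<rho> \<ge> 0"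
  defines "B \<equiv> of_nat n * (ennreal (2 * (\<rho> + T) * \<kappa>) + ennreal (1 / \<kappa>) * (24 ^ Suc n * deviation u v u' v' 0))"
  shows "box_integral \<rho> (real n * T) (\<lambda>s x. cmod (G1 u v s x - G1 u' v' s x)) \<le> B"
    and "box_integral \<rho> (real n * T) (\<lambda>s x. cmod (G2 u v s x - G2 u' v' s x)) \<le> B"
proof -
  note d = solD[OF s(1)] and d' = solD[OF s(2)]
  have one: "box_integral \<rho> (real n * T) (\<lambda>s x. cmod (g s x - g' s x)) \<le> B"
    if \<sigma>: "\<bar>\<sigma>\<bar> = 1" and c: "continuous_on UNIV (\<lambda>(t, x). g t x)" "continuous_on UNIV (\<lambda>(t, x). g' t x)"
      "continuous_on UNIV (\<lambda>(t, x). a t x)" "continuous_on UNIV (\<lambda>(t, x). a' t x)"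
      and e: "\<And>r. r \<ge> 0 \<Longrightarrow> sqint (envelope \<sigma> T (\<lambda>t x. a (r + t) x - a' (r + t) x) (\<lambda>t x. g (r + t) x - g' (r + t) x)) \<le> 24 * deviation u v u' v' r"
    for \<sigma> g g' a a'
    unfolding B_def
  proof (rule box_integral_by_windows[OF _ T(1)])
    note cd = continuous_on_diff2[OF c(1,2)]
    show "continuous_on UNIV (\<lambda>(s, x). cmod (g s x - g' s x))" by (rule continuous_on_cmod2[OF cd])
    fix j assume j: "j < n"
    define r where "r = real j * T"
    have r: "r \<ge> 0" using T(1) by (simp add: r_def)
    let ?E = "envelope \<sigma> T (\<lambda>t x. a (r + t) x - a' (r + t) x) (\<lambda>t x. g (r + t) x - g' (r + t) x)"
    note cs = continuous_on_time_shift[OF cd, of r] continuous_on_time_shift[OF continuous_on_diff2[OF c(3,4)], of r]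
    have "box_integral \<rho> T (\<lambda>s x. cmod (g (r + s) x - g' (r + s) x))
      \<le> (\<integral>\<^sup>+x. ennreal (integral {0..T} (\<lambda>s. cmod (g (r + s) (x + \<sigma> * s) - g' (r + s) (x + \<sigma> * s)))) * indicator {-(\<rho> + T)..\<rho> + T} x \<partial>lborel)"
      using T(1) by (intro box_integral_window_le[OF continuous_on_cmod2[OF cs(1)] _ \<sigma>]) auto
    also have "\<dots> \<le> (\<integral>\<^sup>+x. ennreal (?E x) * indicator {-(\<rho> + T)..\<rho> + T} x \<partial>lborel)"
      by (intro nn_integral_mono mult_right_mono ennreal_leI) (auto simp: envelope_def)
    also have "\<dots> \<le> ennreal (2 * (\<rho> + T) * \<kappa>) + ennreal (1 / \<kappa>) * sqint ?E"
      using \<kappa> \<rho> T(1) by (intro nn_integral_interval_le_sqint envelope_measurable cs) auto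
    also have "\<dots> \<le> ennreal (2 * (\<rho> + T) * \<kappa>) + ennreal (1 / \<kappa>) * (24 ^ Suc n * deviation u v u' v' 0)"
    proof (intro add_left_mono mult_left_mono)
      have "sqint ?E \<le> 24 * deviation u v u' v' r" by (rule e[OF r])
      also have "\<dots> \<le> 24 * (24 ^ n * deviation u v u' v' 0)"
        using j T(1) r by (intro mult_left_mono deviation_growth[OF s small]) (auto simp: r_def)
      finally show "sqint ?E \<le> 24 ^ Suc n * deviation u v u' v' 0" by (simp add: mult.assoc)
    qed simp
    finally show "box_integral \<rho> T (\<lambda>s x. cmod (g (real j * T + s) x - g' (real j * T + s) x))
      \<le> ennreal (2 * (\<rho> + T) * \<kappa>) + ennreal (1 / \<kappa>) * (24 ^ Suc n * deviation u v u' v' 0)" by (simp add: r_def)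
  qed
  have e: "sqint (envelope_u u v u' v' r) \<le> 24 * deviation u v u' v' r" "sqint (envelope_v u v u' v' r) \<le> 24 * deviation u v u' v' r"
    if "r \<ge> 0" for r
    using stability_after_time[OF s small that] by (auto intro: order_trans[rotated])
  show "box_integral \<rho> (real n * T) (\<lambda>s x. cmod (G1 u v s x - G1 u' v' s x)) \<le> B"
    by (rule one[of 1, OF _ d(3) d'(3) d(1) d'(1) e(1)]) simp
  show "box_integral \<rho> (real n * T) (\<lambda>s x. cmod (G2 u v s x - G2 u' v' s x)) \<le> B"
    by (rule one[of "-1", OF _ d(4) d'(4) d(2) d'(2) e(2)]) simp
qed

end

section \<open>The weak equation and its limits\<close>

lemma continuous_box_integrable:
  fixes F :: "real \<times> real \<Rightarrow> complex"
  assumes F: "continuous_on UNIV F" and supp: "\<And>p. p \<notin> {a..b} \<times> {c..d} \<Longrightarrow> F p = 0"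
  shows "integrable lborel F"
proof -
  have "integrable lborel (\<lambda>p. indicator ({a..b} \<times> {c..d}) p *\<^sub>R F p)"
    by (intro borel_integrable_compact compact_Times continuous_on_subset[OF F]) auto
  moreover have "(\<lambda>p. indicator ({a..b} \<times> {c..d}) p *\<^sub>R F p) = F"
  proof
    fix p show "indicator ({a..b} \<times> {c..d}) p *\<^sub>R F p = F p"
      using supp[of p] by (cases "p \<in> {a..b} \<times> {c..d}") auto
  qed
  ultimately show ?thesis by simp
qed

text \<open>The support is a compact subset of the open half plane, so it stays away from time 0 and
  from some later time \<open>S\<close>.\<close>
lemma half_plane_test_function:
  assumes \<phi>: "\<phi> \<in> test_functions half_plane"
  obtains S \<rho> where "S \<ge> 0" "\<rho> \<ge> 0"
    "continuous_on UNIV \<phi>" "continuous_on UNIV (deriv_t \<phi>)" "continuous_on UNIV (deriv_x \<phi>)"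
    "\<And>p. \<phi> differentiable (at p)"
    "\<And>p. p \<notin> {0..S} \<times> {-\<rho>..\<rho>} \<Longrightarrow> \<phi> p = 0 \<and> deriv_t \<phi> p = 0 \<and> deriv_x \<phi> p = 0"
    "\<And>p. p \<notin> half_plane \<Longrightarrow> \<phi> p = 0 \<and> deriv_t \<phi> p = 0 \<and> deriv_x \<phi> p = 0"
    "\<And>x. \<phi> (0, x) = 0" "\<And>x. \<phi> (S, x) = 0"
proof -
  let ?K = "closure {p. \<phi> p \<noteq> 0}"
  have C: "\<And>n. Ck n \<phi>" and K: "compact ?K" "?K \<subseteq> half_plane" using \<phi> by (auto simp: test_functions_def)
  have diff: "\<phi> differentiable (at p)" for p using C[of "Suc 0"] by (cases p) simp
  have cont: "continuous_on UNIV \<phi>" using C[of 0] by simp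
  have "Ck (Suc 0) \<phi>" by (rule C)
  hence b: "continuous_on UNIV (\<lambda>p. frechet_derivative \<phi> (at p) b)" if "b \<in> Basis" for b using that by simp
  have ct: "continuous_on UNIV (deriv_t \<phi>)" "continuous_on UNIV (deriv_x \<phi>)"
    using b[of "(1, 0)"] b[of "(0, 1)"] by (simp_all add: deriv_t_def[abs_def] deriv_x_def[abs_def] Basis_prod_def)
  have out: "\<phi> p = 0 \<and> deriv_t \<phi> p = 0 \<and> deriv_x \<phi> p = 0" if p: "p \<notin> ?K" for p
  proof -
    have z: "\<phi> q = 0" if "q \<notin> ?K" for q
      using that closure_subset[of "{p. \<phi> p \<noteq> 0}"] by auto
    have "(\<phi> has_derivative (\<lambda>h. 0)) (at p)"
    proof (rule has_derivative_transform_within_open[OF has_derivative_const, of "- ?K" p 0])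
      show "open (- ?K)" "p \<in> - ?K" using p by (simp_all only: open_Compl closed_closure Compl_iff not_False_eq_True)
      show "0 = \<phi> q" if "q \<in> - ?K" for q using z[of q, symmetric] that unfolding Compl_iff .
    qed
    hence "frechet_derivative \<phi> (at p) = (\<lambda>h. 0)" by (rule frechet_derivative_at[symmetric])
    thus ?thesis using z[OF p] by (simp add: deriv_t_def deriv_x_def)
  qed
  obtain M where M: "M > 0" "\<And>p. p \<in> ?K \<Longrightarrow> norm p \<le> M"
    using compact_imp_bounded[OF K(1)] by (auto simp: bounded_pos)
  have inK: "p \<in> {0..M} \<times> {-M..M}" "fst p > 0" if "p \<in> ?K" for p
  proof -
    have "p \<in> half_plane" using K(2) that by blast
    thus "fst p > 0" by (auto simp: half_plane_def)
    moreover have "\<bar>fst p\<bar> \<le> M" "\<bar>snd p\<bar> \<le> M"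
      using M(2)[OF that] norm_fst_le[of "fst p" "snd p"] norm_snd_le[of "snd p" "fst p"] by auto
    ultimately show "p \<in> {0..M} \<times> {-M..M}" by (cases p) auto
  qed
  show ?thesis
  proof (rule that[of "M + 1" M, OF _ _ cont ct diff])
    fix p :: "real \<times> real"
    show "\<phi> p = 0 \<and> deriv_t \<phi> p = 0 \<and> deriv_x \<phi> p = 0" if p: "p \<notin> {0..M + 1} \<times> {-M..M}"
    proof (rule out, rule notI)
      assume "p \<in> ?K"
      from inK(1)[OF this] p show False by auto
    qed
    show "\<phi> p = 0 \<and> deriv_t \<phi> p = 0 \<and> deriv_x \<phi> p = 0" if "p \<notin> half_plane"
      using that out[of p] K(2) by blast
  next
    fix x
    have "(0, x) \<notin> ?K" using inK(2)[of "(0, x)"] by (metis fst_conv less_irrefl)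
    from out[OF this] show "\<phi> (0, x) = 0" by (rule conjunct1)
    have "(M + 1, x) \<notin> ?K"
    proof
      assume "(M + 1, x) \<in> ?K"
      from inK(1)[OF this] show False by auto
    qed
    from out[OF this] show "\<phi> (M + 1, x) = 0" by (rule conjunct1)
  qed (use M(1) in auto)
qed

text \<open>Along every characteristic \<open>F\<close> is the derivative of \<open>u \<phi>\<close>,
  which vanishes at both ends; integrate over all starting points.\<close>
lemma transported_weak_equation:
  fixes u g :: "real \<Rightarrow> real \<Rightarrow> complex"
  assumes tr: "transported \<sigma> u g" and cu: "continuous_on UNIV (\<lambda>(t, x). u t x)" and cg: "continuous_on UNIV (\<lambda>(t, x). g t x)"
    and \<sigma>: "\<bar>\<sigma>\<bar> = 1" and S: "S \<ge> 0"
    and c: "continuous_on UNIV \<phi>" "continuous_on UNIV (deriv_t \<phi>)" "continuous_on UNIV (deriv_x \<phi>)"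
    and diff: "\<And>p. \<phi> differentiable (at p)"
    and supp: "\<And>p. p \<notin> {0..S} \<times> {-\<rho>..\<rho>} \<Longrightarrow> \<phi> p = 0 \<and> deriv_t \<phi> p = 0 \<and> deriv_x \<phi> p = 0"
    and ends: "\<And>x. \<phi> (0, x) = 0" "\<And>x. \<phi> (S, x) = 0"
  defines "F \<equiv> \<lambda>p. u (fst p) (snd p) * (deriv_t \<phi> p + of_real \<sigma> * deriv_x \<phi> p) + g (fst p) (snd p) * \<phi> p"
  shows "integrable lborel F" "(\<integral>p. F p \<partial>lborel) = 0"
proof -
  note [continuous_intros] = continuous_along_curve[OF cu] continuous_along_curve[OF cg]
  have cF: "continuous_on UNIV F" unfolding F_def by (intro continuous_intros c)
  have F0: "F p = 0" if "p \<notin> {0..S} \<times> {-\<rho>..\<rho>}" for p using supp[OF that] by (simp add: F_def)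
  show int: "integrable lborel F" by (rule continuous_box_integrable[OF cF F0])
  \<comment> \<open>\<open>H\<close> is \<open>F\<close> in characteristic coordinates; its support is
    wider by the distance \<open>S\<close> travelled.\<close>
  define H where "H p = F (fst p, snd p + \<sigma> * fst p)" for p
  have cH: "continuous_on UNIV H" unfolding H_def
    by (intro continuous_on_compose2[OF cF] continuous_intros) auto
  have H0: "H p = 0" if "p \<notin> {0..S} \<times> {-(\<rho> + S)..\<rho> + S}" for p
  proof -
    have "(fst p, snd p + \<sigma> * fst p) \<notin> {0..S} \<times> {-\<rho>..\<rho>}"
    proof
      assume a: "(fst p, snd p + \<sigma> * fst p) \<in> {0..S} \<times> {-\<rho>..\<rho>}"
      hence "\<bar>\<sigma> * fst p\<bar> \<le> S" using \<sigma> by (simp add: abs_mult)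
      with a that show False by (cases p) auto
    qed
    thus ?thesis unfolding H_def by (rule F0)
  qed
  have intH: "integrable lborel H" by (rule continuous_box_integrable[OF cH H0])
  have line: "(\<integral>s. H (s, x) \<partial>lborel) = 0" for x
  proof -
    let ?c = "\<lambda>s. (s, x + \<sigma> * s)"
    have D: "((\<lambda>s. u s (x + \<sigma> * s) * \<phi> (?c s)) has_vector_derivative H (s, x)) (at s within {0..S})" if s: "s \<in> {0..S}" for s
    proof -
      have "(\<phi> has_derivative frechet_derivative \<phi> (at (?c s))) (at (?c s))"
        using diff frechet_derivative_works by blast
      moreover have "(?c has_derivative (\<lambda>h. (h, \<sigma> * h))) (at s within {0..S})"
        by (auto intro!: derivative_eq_intros)
      ultimately have "((\<lambda>s. \<phi> (?c s)) has_derivative (\<lambda>h. frechet_derivative \<phi> (at (?c s)) (h, \<sigma> * h))) (at s within {0..S})"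
        using has_derivative_in_compose[of ?c _ s "{0..S}" \<phi>] has_derivative_at_withinI by blast
      moreover have "frechet_derivative \<phi> (at (?c s)) (h, \<sigma> * h) = h *\<^sub>R (deriv_t \<phi> (?c s) + of_real \<sigma> * deriv_x \<phi> (?c s))" for h
      proof -
        have lin: "linear (frechet_derivative \<phi> (at (?c s)))" using linear_frechet_derivative[OF diff] .
        have "(h, \<sigma> * h) = h *\<^sub>R (1, 0) + (\<sigma> * h) *\<^sub>R (0, 1)" by simp
        hence "frechet_derivative \<phi> (at (?c s)) (h, \<sigma> * h) = h *\<^sub>R deriv_t \<phi> (?c s) + (\<sigma> * h) *\<^sub>R deriv_x \<phi> (?c s)"
          by (simp only: linear_add[OF lin] linear_scale[OF lin] deriv_t_def deriv_x_def)
        thus ?thesis by (simp add: scaleR_conv_of_real algebra_simps)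
      qed
      ultimately have D\<phi>: "((\<lambda>s. \<phi> (?c s)) has_vector_derivative (deriv_t \<phi> (?c s) + of_real \<sigma> * deriv_x \<phi> (?c s))) (at s within {0..S})"
        by (simp add: has_vector_derivative_def)
      have "((\<lambda>s. u s (x + \<sigma> * s)) has_vector_derivative g s (x + \<sigma> * s)) (at s within {0..S})"
        by (rule has_vector_derivative_within_subset[of _ _ _ "{0..}"]) (use tr s in \<open>auto simp: transported_def\<close>)
      from has_vector_derivative_mult[OF this D\<phi>] show ?thesis by (simp add: H_def F_def)
    qed
    have "((\<lambda>s. H (s, x)) has_integral u S (x + \<sigma> * S) * \<phi> (?c S) - u 0 (x + \<sigma> * 0) * \<phi> (?c 0)) {0..S}"
      by (rule fundamental_theorem_of_calculus[OF S D])
    hence "integral {0..S} (\<lambda>s. H (s, x)) = 0" using ends by (simp add: integral_unique)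
    moreover have "(\<integral>s. H (s, x) \<partial>lborel) = integral {0..S} (\<lambda>s. H (s, x))"
      by (rule integral_lebesgue_eq_integral_support(2))
        (use H0 in \<open>auto intro!: continuous_on_compose2[OF cH] continuous_intros\<close>)
    ultimately show ?thesis by simp
  qed
  have intF': "integrable (lborel \<Otimes>\<^sub>M lborel) (\<lambda>(s, x). F (s, x))" and intH': "integrable (lborel \<Otimes>\<^sub>M lborel) (\<lambda>(s, x). H (s, x))"
    using int intH by (simp_all add: lborel_prod)
  have "(\<integral>p. F p \<partial>lborel) = (\<integral>s. (\<integral>y. F (s, y) \<partial>lborel) \<partial>lborel)"
    using lborel_pair.integral_fst[OF intF'] by (simp add: lborel_prod)
  also have "\<dots> = (\<integral>s. (\<integral>x. H (s, x) \<partial>lborel) \<partial>lborel)"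
  proof (rule Bochner_Integration.integral_cong[OF refl])
    fix s
    show "(\<integral>y. F (s, y) \<partial>lborel) = (\<integral>x. H (s, x) \<partial>lborel)"
      by (subst lborel_integral_real_affine[of 1 _ "\<sigma> * s"]) (auto simp: H_def add.commute)
  qed
  also have "\<dots> = (\<integral>x. (\<integral>s. H (s, x) \<partial>lborel) \<partial>lborel)"
    by (rule lborel_pair.Fubini_integral[symmetric]) (rule intH')
  also have "\<dots> = 0" by (simp add: line)
  finally show "(\<integral>p. F p \<partial>lborel) = 0" .
qed

lemma box_integral_eq_nn_integral:
  fixes f :: "real \<Rightarrow> real \<Rightarrow> real"
  assumes [measurable]: "(\<lambda>p. f (fst p) (snd p)) \<in> borel_measurable borel"
  shows "box_integral \<rho> S f = (\<integral>\<^sup>+p. ennreal (f (fst p) (snd p)) * indicator ({0..S} \<times> {-\<rho>..\<rho>}) p \<partial>lborel)"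
proof -
  have [measurable]: "(\<lambda>p. f (fst p) (snd p)) \<in> borel_measurable (borel \<Otimes>\<^sub>M borel)" by (simp add: borel_prod)
  have [measurable]: "(indicator A :: real \<Rightarrow> ennreal) \<in> borel_measurable borel" if "A \<in> sets borel" for A
    using that by simp
  let ?F = "\<lambda>s y. ennreal (f s y) * indicator {-\<rho>..\<rho>} y * indicator {0..S} s"
  have fs: "(\<lambda>y. ennreal (f s y) * indicator {-\<rho>..\<rho>} y) \<in> borel_measurable lborel" for s
  proof -
    have "(\<lambda>y. (\<lambda>p. f (fst p) (snd p)) (s, y)) \<in> borel_measurable borel" by measurable
    thus ?thesis by simp
  qed
  have "box_integral \<rho> S f = (\<integral>\<^sup>+s. (\<integral>\<^sup>+y. ?F s y \<partial>lborel) \<partial>lborel)"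
    unfolding box_integral_def by (intro nn_integral_cong nn_integral_multc[symmetric] fs)
  also have "\<dots> = (\<integral>\<^sup>+p. ?F (fst p) (snd p) \<partial>(lborel \<Otimes>\<^sub>M lborel))"
  proof -
    have "(\<lambda>p. ?F (fst p) (snd p)) \<in> borel_measurable (borel \<Otimes>\<^sub>M borel)" by measurable
    hence m: "(\<lambda>p. ?F (fst p) (snd p)) \<in> borel_measurable (lborel \<Otimes>\<^sub>M lborel)"
      by (simp add: borel_prod lborel_prod)
    show ?thesis by (subst lborel.nn_integral_fst[OF m, symmetric]) simp
  qed
  also have "\<dots> = (\<integral>\<^sup>+p. ennreal (f (fst p) (snd p)) * indicator ({0..S} \<times> {-\<rho>..\<rho>}) p \<partial>lborel)"
    unfolding lborel_prod by (rule nn_integral_cong) (auto simp: indicator_def)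
  finally show ?thesis .
qed

lemma box_integral_finite_continuous:
  fixes f :: "real \<Rightarrow> real \<Rightarrow> complex"
  assumes "continuous_on UNIV (\<lambda>(t, x). f t x)"
  shows "box_integral \<rho> S (\<lambda>s x. cmod (f s x)) < top"
proof -
  have c: "continuous_on UNIV (\<lambda>p. f (fst p) (snd p))" using assms by (simp add: case_prod_unfold)
  have i: "integrable lborel (\<lambda>p. indicator ({0..S} \<times> {-\<rho>..\<rho>}) p *\<^sub>R f (fst p) (snd p))"
    by (intro borel_integrable_compact compact_Times continuous_on_subset[OF c]) auto
  have "box_integral \<rho> S (\<lambda>s x. cmod (f s x)) = (\<integral>\<^sup>+p. ennreal (cmod (f (fst p) (snd p))) * indicator ({0..S} \<times> {-\<rho>..\<rho>}) p \<partial>lborel)"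
    by (rule box_integral_eq_nn_integral) (intro borel_measurable_continuous_onI continuous_on_norm c)
  also have "\<dots> = (\<integral>\<^sup>+p. ennreal (norm (indicator ({0..S} \<times> {-\<rho>..\<rho>}) p *\<^sub>R f (fst p) (snd p))) \<partial>lborel)"
    by (rule nn_integral_cong) (auto simp: indicator_def)
  also have "\<dots> < top" using i by (simp add: integrable_iff_bounded)
  finally show ?thesis .
qed

text \<open>Convergence in \<open>L\<^sup>1\<close> on bounded subsets of the half plane.\<close>
definition box_converges :: "(nat \<Rightarrow> real \<Rightarrow> real \<Rightarrow> complex) \<Rightarrow> (real \<Rightarrow> real \<Rightarrow> complex) \<Rightarrow> bool" where
  "box_converges f h \<longleftrightarrow> (\<forall>\<rho>\<ge>0. \<forall>S\<ge>0. (\<lambda>j. box_integral \<rho> S (\<lambda>s x. cmod (f j s x - h s x))) \<longlonglongrightarrow> 0)"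

lemma box_converges_limit_finite:
  assumes c: "\<And>j. continuous_on UNIV (\<lambda>(t, x). f j t x)" and h: "(\<lambda>p. h (fst p) (snd p)) \<in> borel_measurable borel"
    and b: "box_converges f h" and "\<rho> \<ge> 0" "S \<ge> 0"
  shows "box_integral \<rho> S (\<lambda>s x. cmod (h s x)) < top"
proof -
  note [measurable] = h
  have cj: "continuous_on UNIV (\<lambda>p. f j (fst p) (snd p))" for j using c[of j] by (simp add: case_prod_unfold)
  have [measurable]: "(\<lambda>p. f j (fst p) (snd p)) \<in> borel_measurable borel" for j using cj by (rule borel_measurable_continuous_onI)
  have "(\<lambda>j. box_integral \<rho> S (\<lambda>s x. cmod (f j s x - h s x))) \<longlonglongrightarrow> 0" using b \<open>\<rho> \<ge> 0\<close> \<open>S \<ge> 0\<close> by (simp add: box_converges_def)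
  hence "\<forall>\<^sub>F j in sequentially. box_integral \<rho> S (\<lambda>s x. cmod (f j s x - h s x)) < 1"
    by (rule order_tendstoD) simp
  then obtain j where j: "box_integral \<rho> S (\<lambda>s x. cmod (f j s x - h s x)) < 1" by (auto simp: eventually_sequentially)
  let ?I = "indicator ({0..S} \<times> {-\<rho>..\<rho>}) :: real \<times> real \<Rightarrow> ennreal"
  have "box_integral \<rho> S (\<lambda>s x. cmod (h s x)) = (\<integral>\<^sup>+p. ennreal (cmod (h (fst p) (snd p))) * ?I p \<partial>lborel)"
    by (rule box_integral_eq_nn_integral) measurable
  also have "\<dots> \<le> (\<integral>\<^sup>+p. ennreal (cmod (f j (fst p) (snd p))) * ?I p + ennreal (cmod (f j (fst p) (snd p) - h (fst p) (snd p))) * ?I p \<partial>lborel)"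
  proof (rule nn_integral_mono)
    fix p
    have "cmod (h (fst p) (snd p)) \<le> cmod (f j (fst p) (snd p)) + cmod (f j (fst p) (snd p) - h (fst p) (snd p))"
      using norm_triangle_sub[of "h (fst p) (snd p)" "f j (fst p) (snd p)"] by (simp add: norm_minus_commute)
    hence "ennreal (cmod (h (fst p) (snd p))) \<le> ennreal (cmod (f j (fst p) (snd p))) + ennreal (cmod (f j (fst p) (snd p) - h (fst p) (snd p)))"
      by (simp add: ennreal_leI flip: ennreal_plus)
    thus "ennreal (cmod (h (fst p) (snd p))) * ?I p \<le> ennreal (cmod (f j (fst p) (snd p))) * ?I p + ennreal (cmod (f j (fst p) (snd p) - h (fst p) (snd p))) * ?I p"
      by (simp add: indicator_def)
  qed
  also have "\<dots> = (\<integral>\<^sup>+p. ennreal (cmod (f j (fst p) (snd p))) * ?I p \<partial>lborel) + (\<integral>\<^sup>+p. ennreal (cmod (f j (fst p) (snd p) - h (fst p) (snd p))) * ?I p \<partial>lborel)"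
    by (rule nn_integral_add) (simp_all add: closed_Times borel_closed)
  also have "\<dots> = box_integral \<rho> S (\<lambda>s x. cmod (f j s x)) + box_integral \<rho> S (\<lambda>s x. cmod (f j s x - h s x))"
    by (simp add: box_integral_eq_nn_integral)
  also have "\<dots> < top"
    using box_integral_finite_continuous[OF c] order_less_trans[OF j ennreal_one_less_top] by simp
  finally show ?thesis .
qed

lemma box_integrable_mult:
  fixes h :: "real \<times> real \<Rightarrow> complex"
  assumes [measurable]: "h \<in> borel_measurable borel" "\<psi> \<in> borel_measurable borel"
    and fin: "box_integral \<rho> S (\<lambda>s x. cmod (h (s, x))) < top"
    and \<psi>: "\<And>p. cmod (\<psi> p) \<le> M" "\<And>p. p \<notin> {0..S} \<times> {-\<rho>..\<rho>} \<Longrightarrow> \<psi> p = 0" and M: "M \<ge> 0"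
  shows "integrable lborel (\<lambda>p. h p * \<psi> p)"
    and "cmod (\<integral>p. h p * \<psi> p \<partial>lborel) \<le> M * enn2real (box_integral \<rho> S (\<lambda>s x. cmod (h (s, x))))"
proof -
  let ?I = "indicator ({0..S} \<times> {-\<rho>..\<rho>}) :: real \<times> real \<Rightarrow> ennreal"
  have bi: "box_integral \<rho> S (\<lambda>s x. cmod (h (s, x))) = (\<integral>\<^sup>+p. ennreal (cmod (h p)) * ?I p \<partial>lborel)"
    by (subst box_integral_eq_nn_integral) auto
  have le: "(\<integral>\<^sup>+p. ennreal (norm (h p * \<psi> p)) \<partial>lborel) \<le> ennreal M * box_integral \<rho> S (\<lambda>s x. cmod (h (s, x)))"
  proof -
    have "(\<integral>\<^sup>+p. ennreal (norm (h p * \<psi> p)) \<partial>lborel) \<le> (\<integral>\<^sup>+p. ennreal M * (ennreal (cmod (h p)) * ?I p) \<partial>lborel)"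
    proof (rule nn_integral_mono)
      fix p
      show "ennreal (norm (h p * \<psi> p)) \<le> ennreal M * (ennreal (cmod (h p)) * ?I p)"
      proof (cases "p \<in> {0..S} \<times> {-\<rho>..\<rho>}")
        case True
        have "norm (h p * \<psi> p) \<le> M * cmod (h p)" using \<psi>(1)[of p] by (simp add: norm_mult mult.commute mult_right_mono)
        thus ?thesis using True M by (simp add: ennreal_leI flip: ennreal_mult)
      qed (simp add: \<psi>(2))
    qed
    also have "\<dots> = ennreal M * box_integral \<rho> S (\<lambda>s x. cmod (h (s, x)))"
      unfolding bi by (rule nn_integral_cmult) (simp add: closed_Times borel_closed)
    finally show ?thesis .
  qed
  show int: "integrable lborel (\<lambda>p. h p * \<psi> p)"
  proof (rule integrableI_bounded)
    show "(\<integral>\<^sup>+p. ennreal (norm (h p * \<psi> p)) \<partial>lborel) < \<infinity>"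
      using le fin by (auto intro: le_less_trans simp: ennreal_mult_less_top)
  qed simp
  have "ennreal (cmod (\<integral>p. h p * \<psi> p \<partial>lborel)) \<le> (\<integral>\<^sup>+p. ennreal (norm (h p * \<psi> p)) \<partial>lborel)"
    by (rule integral_norm_bound_ennreal[OF int])
  also have "\<dots> \<le> ennreal M * ennreal (enn2real (box_integral \<rho> S (\<lambda>s x. cmod (h (s, x)))))"
    using le fin by (simp add: ennreal_enn2real)
  also have "\<dots> = ennreal (M * enn2real (box_integral \<rho> S (\<lambda>s x. cmod (h (s, x)))))"
    using M by (simp add: ennreal_mult)
  finally show "cmod (\<integral>p. h p * \<psi> p \<partial>lborel) \<le> M * enn2real (box_integral \<rho> S (\<lambda>s x. cmod (h (s, x))))"
    using M by (subst (asm) ennreal_le_iff) auto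
qed

text \<open>Both terms of the weak equation are continuous under \<open>L\<^sup>1\<close> convergence on
  the box that contains the support of the test function.\<close>
lemma weak_equation_limit:
  assumes tr: "\<And>j. transported \<sigma> (U j) (g j)" and cU: "\<And>j. continuous_on UNIV (\<lambda>(t, x). U j t x)"
    and cg: "\<And>j. continuous_on UNIV (\<lambda>(t, x). g j t x)" and \<sigma>: "\<bar>\<sigma>\<bar> = 1"
    and m: "(\<lambda>p. u (fst p) (snd p)) \<in> borel_measurable borel" "(\<lambda>p. h (fst p) (snd p)) \<in> borel_measurable borel"
    and conv: "box_converges U u" "box_converges g h"
    and \<phi>: "\<phi> \<in> test_functions half_plane"
  shows "integrable lborel (\<lambda>p. u (fst p) (snd p) * (deriv_t \<phi> p + of_real \<sigma> * deriv_x \<phi> p))"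
    and "integrable lborel (\<lambda>p. h (fst p) (snd p) * \<phi> p)"
    and "(\<integral>p. u (fst p) (snd p) * (deriv_t \<phi> p + of_real \<sigma> * deriv_x \<phi> p) \<partial>lborel)
       + (\<integral>p. h (fst p) (snd p) * \<phi> p \<partial>lborel) = 0"
proof -
  obtain S \<rho> where S: "S \<ge> 0" "\<rho> \<ge> 0"
    and c: "continuous_on UNIV \<phi>" "continuous_on UNIV (deriv_t \<phi>)" "continuous_on UNIV (deriv_x \<phi>)"
    and diff: "\<And>p. \<phi> differentiable (at p)"
    and supp: "\<And>p. p \<notin> {0..S} \<times> {-\<rho>..\<rho>} \<Longrightarrow> \<phi> p = 0 \<and> deriv_t \<phi> p = 0 \<and> deriv_x \<phi> p = 0"
    and ends: "\<And>x. \<phi> (0, x) = 0" "\<And>x. \<phi> (S, x) = 0"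
    by (rule half_plane_test_function[OF \<phi>]) (rule that)
  define \<psi> where "\<psi> p = deriv_t \<phi> p + of_real \<sigma> * deriv_x \<phi> p" for p
  have c\<psi>: "continuous_on UNIV \<psi>" unfolding \<psi>_def by (intro continuous_intros c)
  have supp': "\<And>p. p \<notin> {0..S} \<times> {-\<rho>..\<rho>} \<Longrightarrow> \<phi> p = 0" "\<And>p. p \<notin> {0..S} \<times> {-\<rho>..\<rho>} \<Longrightarrow> \<psi> p = 0"
    using supp by (auto simp: \<psi>_def)
  have bdd: "\<exists>M\<ge>0. \<forall>p. cmod (f p) \<le> M" if f: "continuous_on UNIV f" and z: "\<And>p. p \<notin> {0..S} \<times> {-\<rho>..\<rho>} \<Longrightarrow> f p = 0" for f :: "real \<times> real \<Rightarrow> complex"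
  proof -
    have "bounded (f ` ({0..S} \<times> {-\<rho>..\<rho>}))"
      by (intro compact_imp_bounded compact_continuous_image continuous_on_subset[OF f] compact_Times) auto
    then obtain B where B: "\<forall>y\<in>f ` ({0..S} \<times> {-\<rho>..\<rho>}). cmod y \<le> B" unfolding bounded_iff by blast
    have "cmod (f p) \<le> max B 0" for p
    proof (cases "p \<in> {0..S} \<times> {-\<rho>..\<rho>}")
      case True
      hence "f p \<in> f ` ({0..S} \<times> {-\<rho>..\<rho>})" by (rule imageI)
      thus ?thesis using B by (auto simp: le_max_iff_disj)
    qed (simp add: z)
    thus ?thesis by (intro exI[of _ "max B 0"]) auto
  qed
  obtain M where M: "M \<ge> 0" "\<And>p. cmod (\<phi> p) \<le> M" using bdd[OF c(1) supp'(1)] by blast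
  obtain N where N: "N \<ge> 0" "\<And>p. cmod (\<psi> p) \<le> N" using bdd[OF c\<psi> supp'(2)] by blast
  have [measurable]: "\<phi> \<in> borel_measurable borel" "\<psi> \<in> borel_measurable borel"
    using c(1) c\<psi> by (auto intro: borel_measurable_continuous_onI)
  note [measurable] = m
  have [measurable]: "(\<lambda>p. U j (fst p) (snd p)) \<in> borel_measurable borel" "(\<lambda>p. g j (fst p) (snd p)) \<in> borel_measurable borel" for j
    using cU[of j] cg[of j] by (auto intro!: borel_measurable_continuous_onI simp: case_prod_unfold)
  have fin: "box_integral \<rho> S (\<lambda>s x. cmod (u s x)) < top" "box_integral \<rho> S (\<lambda>s x. cmod (h s x)) < top"
    using box_converges_limit_finite[OF cU m(1) conv(1) S(2,1)] box_converges_limit_finite[OF cg m(2) conv(2) S(2,1)] .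
  have intu: "integrable lborel (\<lambda>p. u (fst p) (snd p) * \<psi> p)"
    by (rule box_integrable_mult(1)[OF m(1) _ _ N(2) supp'(2) N(1)]) (use fin in auto)
  have inth: "integrable lborel (\<lambda>p. h (fst p) (snd p) * \<phi> p)"
    by (rule box_integrable_mult(1)[OF m(2) _ _ M(2) supp'(1) M(1)]) (use fin in auto)
  show "integrable lborel (\<lambda>p. u (fst p) (snd p) * (deriv_t \<phi> p + of_real \<sigma> * deriv_x \<phi> p))"
    using intu by (simp add: \<psi>_def)
  show "integrable lborel (\<lambda>p. h (fst p) (snd p) * \<phi> p)" by (rule inth)
  let ?Z = "(\<integral>p. u (fst p) (snd p) * \<psi> p \<partial>lborel) + (\<integral>p. h (fst p) (snd p) * \<phi> p \<partial>lborel)"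
  let ?a = "\<lambda>j. box_integral \<rho> S (\<lambda>s x. cmod (U j s x - u s x))" and ?b = "\<lambda>j. box_integral \<rho> S (\<lambda>s x. cmod (g j s x - h s x))"
  have lim: "?a \<longlonglongrightarrow> 0" "?b \<longlonglongrightarrow> 0" using conv S by (auto simp: box_converges_def)
  have "\<forall>\<^sub>F j in sequentially. ?a j < top \<and> ?b j < top"
    using order_tendstoD(2)[OF lim(1), of top] order_tendstoD(2)[OF lim(2), of top] by (simp add: eventually_conj)
  hence "\<forall>\<^sub>F j in sequentially. cmod ?Z \<le> N * enn2real (?a j) + M * enn2real (?b j)"
  proof eventually_elim
    case (elim j)
    have d: "integrable lborel (\<lambda>p. (U j (fst p) (snd p) - u (fst p) (snd p)) * \<psi> p)"
      "cmod (\<integral>p. (U j (fst p) (snd p) - u (fst p) (snd p)) * \<psi> p \<partial>lborel) \<le> N * enn2real (?a j)"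
      using elim box_integrable_mult[of "\<lambda>p. U j (fst p) (snd p) - u (fst p) (snd p)" \<psi> \<rho> S, OF _ _ _ N(2) supp'(2) N(1)] by auto
    have d': "integrable lborel (\<lambda>p. (g j (fst p) (snd p) - h (fst p) (snd p)) * \<phi> p)"
      "cmod (\<integral>p. (g j (fst p) (snd p) - h (fst p) (snd p)) * \<phi> p \<partial>lborel) \<le> M * enn2real (?b j)"
      using elim box_integrable_mult[of "\<lambda>p. g j (fst p) (snd p) - h (fst p) (snd p)" \<phi> \<rho> S, OF _ _ _ M(2) supp'(1) M(1)] by auto
    note w = transported_weak_equation[OF tr[of j] cU cg \<sigma> S(1) c diff supp ends, folded \<psi>_def]
    let ?F = "\<lambda>p. U j (fst p) (snd p) * \<psi> p + g j (fst p) (snd p) * \<phi> p"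
    have "?Z = (\<integral>p. u (fst p) (snd p) * \<psi> p + h (fst p) (snd p) * \<phi> p \<partial>lborel) - (\<integral>p. ?F p \<partial>lborel)"
      using intu inth w(2) by simp
    also have "\<dots> = (\<integral>p. (u (fst p) (snd p) * \<psi> p + h (fst p) (snd p) * \<phi> p) - ?F p \<partial>lborel)"
      by (rule Bochner_Integration.integral_diff[symmetric]) (use intu inth w(1) in auto)
    also have "\<dots> = (\<integral>p. - ((U j (fst p) (snd p) - u (fst p) (snd p)) * \<psi> p + (g j (fst p) (snd p) - h (fst p) (snd p)) * \<phi> p) \<partial>lborel)"
      by (rule Bochner_Integration.integral_cong[OF refl]) (simp add: algebra_simps)
    also have "\<dots> = - ((\<integral>p. (U j (fst p) (snd p) - u (fst p) (snd p)) * \<psi> p \<partial>lborel) + (\<integral>p. (g j (fst p) (snd p) - h (fst p) (snd p)) * \<phi> p \<partial>lborel))"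
      unfolding Bochner_Integration.integral_minus by (subst Bochner_Integration.integral_add[OF d(1) d'(1)]) simp
    finally have "cmod ?Z = cmod ((\<integral>p. (U j (fst p) (snd p) - u (fst p) (snd p)) * \<psi> p \<partial>lborel) + (\<integral>p. (g j (fst p) (snd p) - h (fst p) (snd p)) * \<phi> p \<partial>lborel))"
      by (simp only: norm_minus_cancel)
    also have "\<dots> \<le> N * enn2real (?a j) + M * enn2real (?b j)"
      using d(2) d'(2) by (intro order_trans[OF norm_triangle_ineq] add_mono)
    finally show ?case .
  qed
  moreover have "(\<lambda>j. N * enn2real (?a j) + M * enn2real (?b j)) \<longlonglongrightarrow> N * enn2real 0 + M * enn2real 0"
    by (intro tendsto_intros tendsto_enn2real) (use lim in auto)
  ultimately have "cmod ?Z \<le> N * enn2real 0 + M * enn2real 0"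
    by (intro tendsto_le[OF _ _ tendsto_const]) auto
  hence "?Z = 0" by simp
  thus "(\<integral>p. u (fst p) (snd p) * (deriv_t \<phi> p + of_real \<sigma> * deriv_x \<phi> p) \<partial>lborel) + (\<integral>p. h (fst p) (snd p) * \<phi> p \<partial>lborel) = 0"
    by (simp add: \<psi>_def)
qed

section \<open>The limit of a Cauchy sequence of solutions\<close>

text \<open>The weights \<open>2 ^ j\<close> still leave a convergent series \<open>\<Sum> C 2 ^ (-
  j)\<close> of integrals, so for almost every \<open>x\<close> the increments decay like
  \<open>2 ^ (- j / 2)\<close> and are summable.\<close>
lemma fast_sqint_convergence_AE:
  fixes f :: "nat \<Rightarrow> real \<Rightarrow> complex"
  assumes m[measurable]: "\<And>j. f j \<in> borel_measurable borel" and C: "C \<ge> 0"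
    and fast: "\<And>j. sqint (\<lambda>x. cmod (f j x - f (Suc j) x)) \<le> ennreal (C * (1 / 4) ^ j)"
  shows "AE x in lborel. convergent (\<lambda>j. f j x)"
proof -
  define d where "d j x = cmod (f j x - f (Suc j) x)" for j x
  have [measurable]: "d j \<in> borel_measurable borel" for j unfolding d_def by measurable
  define g where "g x = (\<Sum>j. ennreal (2 ^ j * (d j x)\<^sup>2))" for x
  have "(\<integral>\<^sup>+x. g x \<partial>lborel) = (\<Sum>j. \<integral>\<^sup>+x. ennreal (2 ^ j * (d j x)\<^sup>2) \<partial>lborel)"
    unfolding g_def by (rule nn_integral_suminf) measurable
  also have "\<dots> \<le> (\<Sum>j. ennreal (C * (1 / 2) ^ j))"
  proof (rule suminf_le)
    fix j
    have "(\<integral>\<^sup>+x. ennreal (2 ^ j * (d j x)\<^sup>2) \<partial>lborel) = (\<integral>\<^sup>+x. ennreal (2 ^ j) * ennreal ((d j x)\<^sup>2) \<partial>lborel)"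
      by (rule nn_integral_cong) (simp add: ennreal_mult)
    also have "\<dots> = ennreal (2 ^ j) * sqint (d j)" unfolding sqint_def by (rule nn_integral_cmult) measurable
    also have "\<dots> \<le> ennreal (2 ^ j) * ennreal (C * (1 / 4) ^ j)"
      using fast[of j] by (intro mult_left_mono) (auto simp: d_def[abs_def])
    also have "\<dots> = ennreal (2 ^ j * (C * (1 / 4) ^ j))" using C by (intro ennreal_mult[symmetric]) auto
    also have "2 ^ j * (C * (1 / 4) ^ j) = C * (1 / 2) ^ j"
    proof -
      have "(2::real) ^ j * (1 / 4) ^ j = (1 / 2) ^ j" by (subst power_mult_distrib[symmetric]) simp
      thus ?thesis by simp
    qed
    finally show "(\<integral>\<^sup>+x. ennreal (2 ^ j * (d j x)\<^sup>2) \<partial>lborel) \<le> ennreal (C * (1 / 2) ^ j)" .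
  qed auto
  also have "\<dots> = ennreal (\<Sum>j. C * (1 / 2) ^ j)"
    by (rule suminf_ennreal2) (use C in \<open>auto intro: summable_mult summable_geometric\<close>)
  also have "\<dots> < \<infinity>" by simp
  finally have "AE x in lborel. g x \<noteq> \<infinity>"
    by (intro nn_integral_PInf_AE) (auto simp: g_def)
  thus ?thesis
  proof eventually_elim
    case (elim x)
    then obtain M where M: "g x = ennreal M" "M \<ge> 0" by (cases "g x") auto
    have bound: "norm (d j x) \<le> sqrt M * sqrt (1 / 2) ^ j" for j
    proof -
      have "ennreal (2 ^ j * (d j x)\<^sup>2) \<le> g x"
      proof -
        have "(\<Sum>i\<in>{j}. ennreal (2 ^ i * (d i x)\<^sup>2)) \<le> g x" unfolding g_def by (rule sum_le_suminf) auto
        thus ?thesis by simp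
      qed
      hence "2 ^ j * (d j x)\<^sup>2 \<le> M" using M by simp
      hence "(d j x)\<^sup>2 \<le> M * (1 / 2) ^ j" by (simp add: field_simps power_divide)
      hence "d j x \<le> sqrt (M * (1 / 2) ^ j)" by (rule real_le_rsqrt)
      moreover have "norm (d j x) = d j x" by (simp add: d_def)
      ultimately show ?thesis by (simp only: real_sqrt_mult real_sqrt_power)
    qed
    have "summable (\<lambda>j. sqrt M * sqrt (1 / 2) ^ j)"
      by (intro summable_mult summable_geometric) (simp add: real_sqrt_divide)
    hence "summable (\<lambda>j. d j x)" by (rule summable_comparison_test') (rule bound)
    hence "summable (\<lambda>j. norm (f (Suc j) x - f j x))" by (simp only: d_def norm_minus_commute)
    hence "summable (\<lambda>j. f (Suc j) x - f j x)" by (rule summable_norm_cancel)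
    hence "convergent (\<lambda>n. \<Sum>j<n. f (Suc j) x - f j x)" by (simp add: summable_iff_convergent)
    hence "convergent (\<lambda>n. f n x - f 0 x)" by (simp only: sum_lessThan_telescope[of "\<lambda>j. f j x"])
    hence "convergent (\<lambda>n. (f n x - f 0 x) + f 0 x)" by (rule convergent_add) (rule convergent_const)
    thus ?case by simp
  qed
qed

lemma nn_integral_Fatou_le:
  fixes B :: ennreal
  assumes [measurable]: "\<And>j. f j \<in> borel_measurable M"
    and lim: "AE x in M. (\<lambda>j. f j x) \<longlonglongrightarrow> h x"
    and B: "\<forall>\<^sub>F j in sequentially. (\<integral>\<^sup>+x. f j x \<partial>M) \<le> B"
  shows "(\<integral>\<^sup>+x. h x \<partial>M) \<le> B"
proof -
  have "(\<integral>\<^sup>+x. h x \<partial>M) = (\<integral>\<^sup>+x. liminf (\<lambda>j. f j x) \<partial>M)"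
    by (rule nn_integral_cong_AE) (use lim in eventually_elim, simp add: lim_imp_Liminf)
  also have "\<dots> \<le> liminf (\<lambda>j. \<integral>\<^sup>+x. f j x \<partial>M)" by (rule nn_integral_liminf) simp
  also have "\<dots> \<le> limsup (\<lambda>j. \<integral>\<^sup>+x. f j x \<partial>M)" by (rule Liminf_le_Limsup) simp
  also have "\<dots> \<le> B" by (rule Limsup_bounded[OF B])
  finally show ?thesis .
qed

lemma ennreal_tendsto_0I:
  fixes F :: "nat \<Rightarrow> ennreal"
  assumes "\<And>e. e > 0 \<Longrightarrow> \<forall>\<^sub>F j in sequentially. F j \<le> ennreal e"
  shows "F \<longlonglongrightarrow> 0"
proof (rule order_tendstoI)
  fix a :: ennreal assume "a > 0"
  then obtain e where e: "e > 0" "ennreal e < a"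
  proof (cases a)
    case (real b)
    with \<open>a > 0\<close> have "b > 0" by simp
    with real show ?thesis by (intro that[of "b / 2"]) (auto intro!: ennreal_lessI)
  qed (use that[of 1] in auto)
  show "\<forall>\<^sub>F j in sequentially. F j < a"
    using assms[OF e(1)] by eventually_elim (use e(2) in auto)
qed simp

lemma fast_subsequence:
  fixes D :: "nat \<Rightarrow> nat \<Rightarrow> ennreal"
  assumes "\<And>e. e > 0 \<Longrightarrow> \<exists>N. \<forall>k\<ge>N. \<forall>l\<ge>N. D k l \<le> ennreal e"
  obtains r :: "nat \<Rightarrow> nat" where "strict_mono r" "\<And>j. 1 \<le> r j" "\<And>j. D (r j) (r (Suc j)) \<le> ennreal ((1 / 4) ^ j)"
proof -
  have "\<forall>j. \<exists>N. \<forall>k\<ge>N. \<forall>l\<ge>N. D k l \<le> ennreal ((1 / 4) ^ j)" using assms by simp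
  then obtain N where N: "\<And>j k l. k \<ge> N j \<Longrightarrow> l \<ge> N j \<Longrightarrow> D k l \<le> ennreal ((1 / 4) ^ j)" by metis
  \<comment> \<open>Summing the thresholds makes \<open>r\<close> strictly increasing and at least
    \<open>N j\<close>; the summand \<open>Suc j\<close> keeps it positive.\<close>
  define r where "r j = Suc j + (\<Sum>i\<le>j. N i)" for j
  have ge: "N j \<le> r j" for j unfolding r_def using member_le_sum[of j "{..j}" N] by simp
  have "strict_mono r" unfolding strict_mono_Suc_iff by (simp add: r_def)
  moreover from this have "r j \<le> r (Suc j)" for j by (simp add: strict_mono_less_eq)
  hence "D (r j) (r (Suc j)) \<le> ennreal ((1 / 4) ^ j)" for j using ge[of j] by (intro N) (auto intro: order_trans)
  ultimately show ?thesis by (intro that[of r]) (auto simp: r_def)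
qed

lemma borel_imp_lebesgue: "f \<in> borel_measurable borel \<Longrightarrow> f \<in> borel_measurable lebesgue"
  by (simp add: measurable_completion)

lemma sqint_finite_imp_L2:
  assumes [measurable]: "f \<in> borel_measurable borel" and fin: "sqint (\<lambda>x. cmod (f x)) < top"
  shows "f \<in> L2"
proof -
  have "integrable lborel (\<lambda>x. (cmod (f x))\<^sup>2)"
    by (rule integrableI_bounded) (use fin in \<open>auto simp: sqint_def\<close>)
  hence "integrable lebesgue (\<lambda>x. (cmod (f x))\<^sup>2)" by (simp add: integrable_completion)
  thus ?thesis by (simp add: L2_def borel_imp_lebesgue)
qed

lemma sqint_eq_L2_norm_borel:
  assumes [measurable]: "f \<in> borel_measurable borel" and L: "f \<in> L2"
  shows "sqint (\<lambda>x. cmod (f x)) = ennreal ((L2_norm f)\<^sup>2)"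
proof -
  have "sqint (\<lambda>x. cmod (f x)) = (\<integral>\<^sup>+x. ennreal ((cmod (f x))\<^sup>2) \<partial>lebesgue)"
    unfolding sqint_def by (rule nn_integral_completion[symmetric])
  also have "\<dots> = ennreal ((L2_norm f)\<^sup>2)"
    unfolding L2_norm_power2 by (rule nn_integral_eq_integral) (use L2D(2)[OF L] in auto)
  finally show ?thesis .
qed

context small_window
begin

lemma deviation_eq_L2:
  assumes s: "sol u v" "sol u' v'" and t: "t \<ge> 0"
  shows "deviation u v u' v' t = ennreal ((L2_norm (\<lambda>x. u t x - u' t x))\<^sup>2 + (L2_norm (\<lambda>x. v t x - v' t x))\<^sup>2)"
proof -
  have L: "u t \<in> L2" "v t \<in> L2" "u' t \<in> L2" "v' t \<in> L2" using s t by (auto simp: characteristic_solution_def)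
  note d = solD(1,2)[OF s(1)] and d' = solD(1,2)[OF s(2)]
  have "sqint (\<lambda>x. cmod (u t x - u' t x)) = ennreal ((L2_norm (\<lambda>x. u t x - u' t x))\<^sup>2)"
    "sqint (\<lambda>x. cmod (v t x - v' t x)) = ennreal ((L2_norm (\<lambda>x. v t x - v' t x))\<^sup>2)"
    by (intro sqint_cmod_eq_L2_norm continuous_on_diff slice_continuous[OF d(1)] slice_continuous[OF d(2)]
        slice_continuous[OF d'(1)] slice_continuous[OF d'(2)] L2_diff L)+
  thus ?thesis by (simp add: deviation_def ennreal_plus)
qed

text \<open>Initial data that are Cauchy stay Cauchy, up to the factor \<open>24 ^ n\<close>, on
  \<open>n\<close> windows. A subsequence with \<open>D (r j) (r (j + 1)) \<le> 4 ^ (-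
  j)\<close> converges, at each time, for almost every \<open>x\<close>. Its limit is
  measurable as a function of both variables, being the \<open>lim\<close> of continuous
  functions, with a default value where they diverge. Fatou's lemma then turns the Cauchy
  property into convergence of the whole sequence, uniformly on bounded time intervals. The
  right-hand sides are Cauchy in \<open>L\<^sup>1\<close> of boxes and converge pointwise
  along the subsequence, so by Fatou once more their \<open>L\<^sup>1\<close> limit is the
  right-hand side of the limit.\<close>
proposition characteristic_limit:
  fixes U V :: "nat \<Rightarrow> real \<Rightarrow> real \<Rightarrow> complex"
  assumes s: "\<And>k. k \<ge> 1 \<Longrightarrow> sol (U k) (V k)" and small: "\<And>k. k \<ge> 1 \<Longrightarrow> charge_small (U k) (V k)"
    and cauchy: "\<And>e. e > 0 \<Longrightarrow> \<exists>N\<ge>1. \<forall>k\<ge>N. \<forall>l\<ge>N. deviation (U k) (V k) (U l) (V l) 0 \<le> ennreal e"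
  obtains r :: "nat \<Rightarrow> nat" and u v where
    "\<And>j. 1 \<le> r j"
    "(\<lambda>p. u (fst p) (snd p)) \<in> borel_measurable borel" "(\<lambda>p. v (fst p) (snd p)) \<in> borel_measurable borel"
    "\<And>n e. e > 0 \<Longrightarrow> \<exists>N\<ge>1. \<forall>k\<ge>N. \<forall>t\<in>{0..real n * T}.
        sqint (\<lambda>x. cmod (U k t x - u t x)) \<le> ennreal e \<and> sqint (\<lambda>x. cmod (V k t x - v t x)) \<le> ennreal e"
    "box_converges (\<lambda>j. U (r j)) u" "box_converges (\<lambda>j. V (r j)) v"
    "box_converges (\<lambda>j. G1 (U (r j)) (V (r j))) (G1 u v)" "box_converges (\<lambda>j. G2 (U (r j)) (V (r j))) (G2 u v)"
proof -
  define D where "D k l = deviation (U k) (V k) (U l) (V l) 0" for k l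
  have "\<exists>N. \<forall>k\<ge>N. \<forall>l\<ge>N. D k l \<le> ennreal e" if "e > 0" for e using cauchy[OF that] by (auto simp: D_def)
  from fast_subsequence[of D, OF this] obtain r where r: "strict_mono r" "\<And>j. 1 \<le> r j"
    "\<And>j. D (r j) (r (Suc j)) \<le> ennreal ((1 / 4) ^ j)" by metis
  note sr = s[OF r(2)] and smr = small[OF r(2)]
  define u where "u t x = lim (\<lambda>j. U (r j) t x)" for t x
  define v where "v t x = lim (\<lambda>j. V (r j) t x)" for t x
  have cont: "continuous_on UNIV (\<lambda>p. U (r j) (fst p) (snd p))" "continuous_on UNIV (\<lambda>p. V (r j) (fst p) (snd p))" for j
    using solD(1,2)[OF sr[of j]] by (simp_all add: case_prod_unfold)
  have mU[measurable]: "(\<lambda>p. U (r j) (fst p) (snd p)) \<in> borel_measurable borel" "(\<lambda>p. V (r j) (fst p) (snd p)) \<in> borel_measurable borel" for j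
    using cont[of j] by (auto intro: borel_measurable_continuous_onI)
  have mu[measurable]: "(\<lambda>p. u (fst p) (snd p)) \<in> borel_measurable borel" "(\<lambda>p. v (fst p) (snd p)) \<in> borel_measurable borel"
    unfolding u_def v_def by measurable
  have slice: "f t \<in> borel_measurable borel" if "(\<lambda>p. f (fst p) (snd p)) \<in> borel_measurable borel" for f :: "real \<Rightarrow> real \<Rightarrow> complex" and t
  proof -
    have "(\<lambda>x. (\<lambda>p. f (fst p) (snd p)) (t, x)) \<in> borel_measurable borel"
      by (rule measurable_compose[OF _ that]) measurable
    thus ?thesis by simp
  qed
  have mk: "U k t \<in> borel_measurable borel" "V k t \<in> borel_measurable borel" if "k \<ge> 1" for k t
    using solD(1,2)[OF s[OF that]] by (auto intro!: borel_measurable_continuous_onI slice_continuous)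
  note msl = slice[OF mu(1)] slice[OF mu(2)]
  have le_dev: "sqint (\<lambda>x. cmod (a t x - a' t x)) \<le> deviation a b a' b' t" "sqint (\<lambda>x. cmod (b t x - b' t x)) \<le> deviation a b a' b' t" for a b a' b' :: "real \<Rightarrow> real \<Rightarrow> complex" and t
    by (auto simp: deviation_def)
  \<comment> \<open>The number of windows needed to reach the time \<open>t\<close>.\<close>
  obtain nn :: "real \<Rightarrow> nat" where nn: "\<And>t. t \<le> real (nn t) * T"
  proof -
    have "\<exists>n::nat. t \<le> real n * T" for t using reals_Archimedean3[OF T(1), rule_format, of t] by (auto intro: less_imp_le)
    thus ?thesis using that by metis
  qed
  have p24: "(24::ennreal) ^ n = ennreal (24 ^ n)" for n by (simp add: ennreal_power[symmetric] flip: ennreal_numeral)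
  have ae: "AE x in lborel. (\<lambda>j. U (r j) t x) \<longlonglongrightarrow> u t x" "AE x in lborel. (\<lambda>j. V (r j) t x) \<longlonglongrightarrow> v t x" if t: "t \<ge> 0" for t
  proof -
    have step: "deviation (U (r j)) (V (r j)) (U (r (Suc j))) (V (r (Suc j))) t \<le> ennreal (24 ^ nn t * (1 / 4) ^ j)" for j
    proof -
      have "deviation (U (r j)) (V (r j)) (U (r (Suc j))) (V (r (Suc j))) t \<le> 24 ^ nn t * D (r j) (r (Suc j))"
        unfolding D_def by (rule deviation_growth[OF sr sr smr smr t nn])
      also have "\<dots> \<le> 24 ^ nn t * ennreal ((1 / 4) ^ j)" by (rule mult_left_mono[OF r(3)]) simp
      finally show ?thesis unfolding p24 by (simp add: ennreal_mult)
    qed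
    have "AE x in lborel. convergent (\<lambda>j. U (r j) t x)"
      by (rule fast_sqint_convergence_AE[where C="24 ^ nn t", OF mk(1)[OF r(2)] _ order_trans[OF le_dev(1) step]]) simp
    thus "AE x in lborel. (\<lambda>j. U (r j) t x) \<longlonglongrightarrow> u t x" by (simp add: u_def convergent_LIMSEQ_iff)
    have "AE x in lborel. convergent (\<lambda>j. V (r j) t x)"
      by (rule fast_sqint_convergence_AE[where C="24 ^ nn t", OF mk(2)[OF r(2)] _ order_trans[OF le_dev(2) step]]) simp
    thus "AE x in lborel. (\<lambda>j. V (r j) t x) \<longlonglongrightarrow> v t x" by (simp add: v_def convergent_LIMSEQ_iff)
  qed
  have rj: "j \<le> r j" for j using r(1) by (rule seq_suble)
  have unif: "\<exists>N\<ge>1. \<forall>k\<ge>N. \<forall>t\<in>{0..real n * T}.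
      sqint (\<lambda>x. cmod (U k t x - u t x)) \<le> ennreal e \<and> sqint (\<lambda>x. cmod (V k t x - v t x)) \<le> ennreal e" if e: "e > 0" for n e
  proof -
    obtain N where N: "N \<ge> 1" "\<And>k l. k \<ge> N \<Longrightarrow> l \<ge> N \<Longrightarrow> D k l \<le> ennreal (e / 24 ^ n)"
      using cauchy[of "e / 24 ^ n"] e by (auto simp: D_def)
    have "sqint (\<lambda>x. cmod (U k t x - u t x)) \<le> ennreal e \<and> sqint (\<lambda>x. cmod (V k t x - v t x)) \<le> ennreal e"
      if k: "k \<ge> N" and t: "t \<in> {0..real n * T}" for k t
    proof -
      have k1: "k \<ge> 1" using N(1) k by simp
      have t0: "0 \<le> t" "t \<le> real n * T" using t by auto
      have dev: "deviation (U k) (V k) (U (r j)) (V (r j)) t \<le> ennreal e" if "j \<ge> N" for j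
      proof -
        have "deviation (U k) (V k) (U (r j)) (V (r j)) t \<le> 24 ^ n * D k (r j)"
          unfolding D_def by (rule deviation_growth[OF s[OF k1] sr small[OF k1] smr t0])
        also have "\<dots> \<le> 24 ^ n * ennreal (e / 24 ^ n)"
          using that rj[of j] k by (intro mult_left_mono N) auto
        finally show ?thesis unfolding p24 using e by (simp add: ennreal_mult'[symmetric])
      qed
      have fatou: "sqint (\<lambda>x. cmod (a x - b x)) \<le> ennreal e"
        if "a \<in> borel_measurable borel" "\<And>j. c j \<in> borel_measurable borel" "AE x in lborel. (\<lambda>j. c j x) \<longlonglongrightarrow> b x"
          "\<And>j. j \<ge> N \<Longrightarrow> sqint (\<lambda>x. cmod (a x - c j x)) \<le> ennreal e" for a b and c :: "nat \<Rightarrow> real \<Rightarrow> complex"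
        unfolding sqint_def
      proof (rule nn_integral_Fatou_le)
        note [measurable] = that(1,2)
        show "(\<lambda>x. ennreal ((cmod (a x - c j x))\<^sup>2)) \<in> borel_measurable lborel" for j by measurable
        show "AE x in lborel. (\<lambda>j. ennreal ((cmod (a x - c j x))\<^sup>2)) \<longlonglongrightarrow> ennreal ((cmod (a x - b x))\<^sup>2)"
          using that(3) by eventually_elim (intro tendsto_ennrealI tendsto_intros)
        show "\<forall>\<^sub>F j in sequentially. (\<integral>\<^sup>+x. ennreal ((cmod (a x - c j x))\<^sup>2) \<partial>lborel) \<le> ennreal e"
          using that(4) by (intro eventually_sequentiallyI[of N]) (simp add: sqint_def)
      qed
      show ?thesis
        using fatou[OF mk(1)[OF k1] mk(1)[OF r(2)] ae(1)[OF t0(1)] order_trans[OF le_dev(1) dev]]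
          fatou[OF mk(2)[OF k1] mk(2)[OF r(2)] ae(2)[OF t0(1)] order_trans[OF le_dev(2) dev]] by blast
    qed
    thus ?thesis using N(1) by blast
  qed
  have bigN: "\<exists>n::nat. S \<le> real n * T" for S using nn by blast
  have bmono: "box_integral \<rho> S f \<le> box_integral \<rho> S' f" if "S \<le> S'" for \<rho> S S' f
    unfolding box_integral_def using that by (intro nn_integral_mono mult_left_mono) (auto simp: indicator_def)
  \<comment> \<open>Fatou's lemma is applied twice, in \<open>x\<close> at each fixed time and then in
    time.\<close>
  have boxF: "box_integral \<rho> S (\<lambda>s x. cmod (a s x - b s x)) \<le> B"
    if ma: "(\<lambda>p. a (fst p) (snd p)) \<in> borel_measurable borel"
      and mc: "\<And>j. (\<lambda>p. c j (fst p) (snd p)) \<in> borel_measurable borel"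
      and lim: "\<And>s. s \<ge> 0 \<Longrightarrow> AE x in lborel. (\<lambda>j. c j s x) \<longlonglongrightarrow> b s x"
      and le: "\<forall>\<^sub>F j in sequentially. box_integral \<rho> S (\<lambda>s x. cmod (a s x - c j s x)) \<le> B"
    for \<rho> S B a b and c :: "nat \<Rightarrow> real \<Rightarrow> real \<Rightarrow> complex"
  proof -
    note [measurable] = ma mc
    let ?i = "\<lambda>j s. (\<integral>\<^sup>+y. ennreal (cmod (a s y - c j s y)) * indicator {-\<rho>..\<rho>} y \<partial>lborel)"
    have sl: "a s \<in> borel_measurable borel" "c j s \<in> borel_measurable borel" for s j using slice[OF ma] slice[OF mc] by auto
    have mi: "(\<lambda>s. ?i j s) \<in> borel_measurable borel" for j
    proof -
      have 1: "(\<lambda>p. ennreal (cmod (a (fst p) (snd p) - c j (fst p) (snd p)))) \<in> borel_measurable (borel \<Otimes>\<^sub>M borel)"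
        unfolding borel_prod by measurable
      have 2: "(indicator {-\<rho>..\<rho>} :: real \<Rightarrow> ennreal) \<in> borel_measurable borel" by simp
      note [measurable] = 1 2
      have "(\<lambda>(s, y). ennreal (cmod (a s y - c j s y)) * indicator {-\<rho>..\<rho>} y) \<in> borel_measurable (borel \<Otimes>\<^sub>M lborel)"
        unfolding case_prod_unfold by measurable
      thus ?thesis by (rule lborel.borel_measurable_nn_integral)
    qed
    have inner: "(\<integral>\<^sup>+y. ennreal (cmod (a s y - b s y)) * indicator {-\<rho>..\<rho>} y \<partial>lborel) \<le> liminf (\<lambda>j. ?i j s)" if "s \<ge> 0" for s
    proof -
      have "(\<integral>\<^sup>+y. ennreal (cmod (a s y - b s y)) * indicator {-\<rho>..\<rho>} y \<partial>lborel)
         = (\<integral>\<^sup>+y. liminf (\<lambda>j. ennreal (cmod (a s y - c j s y)) * indicator {-\<rho>..\<rho>} y) \<partial>lborel)"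
      proof (rule nn_integral_cong_AE, use lim[OF that] in eventually_elim)
        case (elim y)
        have "(\<lambda>j. ennreal (cmod (a s y - c j s y)) * indicator {-\<rho>..\<rho>} y) \<longlonglongrightarrow> ennreal (cmod (a s y - b s y)) * indicator {-\<rho>..\<rho>} y"
        proof (cases "y \<in> {-\<rho>..\<rho>}")
          case True
          thus ?thesis by (auto intro!: tendsto_intros tendsto_ennrealI elim)
        qed simp
        thus ?case by (simp add: lim_imp_Liminf)
      qed
      also have "\<dots> \<le> liminf (\<lambda>j. ?i j s)"
        using sl by (intro nn_integral_liminf) auto
      finally show ?thesis .
    qed
    have "box_integral \<rho> S (\<lambda>s x. cmod (a s x - b s x)) \<le> (\<integral>\<^sup>+s. liminf (\<lambda>j. ?i j s * indicator {0..S} s) \<partial>lborel)"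
      unfolding box_integral_def
    proof (rule nn_integral_mono)
      fix s show "(\<integral>\<^sup>+y. ennreal (cmod (a s y - b s y)) * indicator {-\<rho>..\<rho>} y \<partial>lborel) * indicator {0..S} s \<le> liminf (\<lambda>j. ?i j s * indicator {0..S} s)"
        using inner[of s] by (cases "s \<in> {0..S}") auto
    qed
    also have "\<dots> \<le> liminf (\<lambda>j. box_integral \<rho> S (\<lambda>s x. cmod (a s x - c j s x)))"
      unfolding box_integral_def using mi by (intro nn_integral_liminf) auto
    also have "\<dots> \<le> limsup (\<lambda>j. box_integral \<rho> S (\<lambda>s x. cmod (a s x - c j s x)))" by (rule Liminf_le_Limsup) simp
    also have "\<dots> \<le> B" by (rule Limsup_bounded[OF le])
    finally show ?thesis .
  qed
  have bu: "box_converges (\<lambda>j. f (r j)) h"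
    if hyp: "\<And>n e. e > 0 \<Longrightarrow> \<exists>N\<ge>1. \<forall>k\<ge>N. \<forall>t\<in>{0..real n * T}. sqint (\<lambda>x. cmod (f k t x - h t x)) \<le> ennreal e"
      and mf: "\<And>k t. k \<ge> 1 \<Longrightarrow> f k t \<in> borel_measurable borel" and mh: "\<And>t. h t \<in> borel_measurable borel" for f h
    unfolding box_converges_def
  proof (intro allI impI)
    fix \<rho> S :: real assume "\<rho> \<ge> 0" "S \<ge> 0"
    obtain n where n: "S \<le> real n * T" using bigN by blast
    show "(\<lambda>j. box_integral \<rho> S (\<lambda>s x. cmod (f (r j) s x - h s x))) \<longlonglongrightarrow> 0"
    proof (rule ennreal_tendsto_0I)
      fix e :: real assume e: "e > 0"
      \<comment> \<open>First \<open>\<kappa>\<close> makes the contribution of the interval at most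
        \<open>e / 2\<close>, then \<open>\<eta>\<close> does the same for the square
        integral; the added 1 avoids a zero denominator.\<close>
      define \<kappa> where "\<kappa> = e / (4 * \<rho> * S + 1)"
      have den: "4 * \<rho> * S + 1 > 0" using \<open>\<rho> \<ge> 0\<close> \<open>S \<ge> 0\<close> by (simp add: add_nonneg_pos)
      have \<kappa>: "\<kappa> > 0" using e den by (simp add: \<kappa>_def)
      have "(4 * \<rho> * S) * \<kappa> \<le> e" using e den by (simp add: \<kappa>_def field_simps)
      hence half1: "2 * \<rho> * \<kappa> * S \<le> e / 2" by (simp add: mult_ac)
      define \<eta> where "\<eta> = \<kappa> * e / (2 * (S + 1))"
      have \<eta>: "\<eta> > 0" using \<kappa> e \<open>S \<ge> 0\<close> by (simp add: \<eta>_def)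
      have half2: "1 / \<kappa> * \<eta> * S \<le> e / 2"
        using \<kappa> e \<open>S \<ge> 0\<close> by (simp add: \<eta>_def field_simps)
      obtain N where N: "N \<ge> 1" "\<And>k t. k \<ge> N \<Longrightarrow> t \<in> {0..real n * T} \<Longrightarrow> sqint (\<lambda>x. cmod (f k t x - h t x)) \<le> ennreal \<eta>"
        using hyp[OF \<eta>] by meson
      show "\<forall>\<^sub>F j in sequentially. box_integral \<rho> S (\<lambda>s x. cmod (f (r j) s x - h s x)) \<le> ennreal e"
      proof (rule eventually_sequentiallyI[of N])
        fix j assume j: "N \<le> j"
        have "box_integral \<rho> S (\<lambda>s x. cmod (f (r j) s x - h s x)) \<le> (\<integral>\<^sup>+s. ennreal (2 * \<rho> * \<kappa> + 1 / \<kappa> * \<eta>) * indicator {0..S} s \<partial>lborel)"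
          unfolding box_integral_def
        proof (rule nn_integral_mono)
          fix s
          show "(\<integral>\<^sup>+y. ennreal (cmod (f (r j) s y - h s y)) * indicator {-\<rho>..\<rho>} y \<partial>lborel) * indicator {0..S} s
             \<le> ennreal (2 * \<rho> * \<kappa> + 1 / \<kappa> * \<eta>) * indicator {0..S} s"
          proof (cases "s \<in> {0..S}")
            case True
            note [measurable] = mf[OF r(2)[of j]] mh
            have "(\<integral>\<^sup>+y. ennreal (cmod (f (r j) s y - h s y)) * indicator {-\<rho>..\<rho>} y \<partial>lborel)
               \<le> ennreal (2 * \<rho> * \<kappa>) + ennreal (1 / \<kappa>) * sqint (\<lambda>y. cmod (f (r j) s y - h s y))"
              by (rule nn_integral_interval_le_sqint) (use \<kappa> \<open>\<rho> \<ge> 0\<close> in auto)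
            also have "\<dots> \<le> ennreal (2 * \<rho> * \<kappa>) + ennreal (1 / \<kappa>) * ennreal \<eta>"
              using True n j rj[of j] by (intro add_left_mono mult_left_mono N) auto
            also have "\<dots> = ennreal (2 * \<rho> * \<kappa> + 1 / \<kappa> * \<eta>)"
              using \<kappa> \<eta> \<open>\<rho> \<ge> 0\<close> by (subst ennreal_mult[symmetric], simp, simp, subst ennreal_plus[symmetric]) auto
            finally show ?thesis using True by simp
          qed simp
        qed
        also have "\<dots> = ennreal (2 * \<rho> * \<kappa> + 1 / \<kappa> * \<eta>) * ennreal S" using \<open>S \<ge> 0\<close> by (simp add: nn_integral_cmult_indicator)
        also have "\<dots> = ennreal ((2 * \<rho> * \<kappa> + 1 / \<kappa> * \<eta>) * S)"
          using \<kappa> \<eta> \<open>\<rho> \<ge> 0\<close> \<open>S \<ge> 0\<close> by (intro ennreal_mult[symmetric]) auto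
        also have "(2 * \<rho> * \<kappa> + 1 / \<kappa> * \<eta>) * S \<le> e"
          unfolding distrib_right using half1 half2 by linarith
        finally show "box_integral \<rho> S (\<lambda>s x. cmod (f (r j) s x - h s x)) \<le> ennreal e" by (simp add: ennreal_leI)
      qed
    qed
  qed
  have bg: "box_converges g h"
    if mg: "\<And>j. (\<lambda>p. g j (fst p) (snd p)) \<in> borel_measurable borel"
      and lim: "\<And>s. s \<ge> 0 \<Longrightarrow> AE x in lborel. (\<lambda>j. g j s x) \<longlonglongrightarrow> h s x"
      and bound: "\<And>\<rho> n \<kappa> i j. \<kappa> > 0 \<Longrightarrow> \<rho> \<ge> 0 \<Longrightarrow> box_integral \<rho> (real n * T) (\<lambda>s x. cmod (g i s x - g j s x))
         \<le> of_nat n * (ennreal (2 * (\<rho> + T) * \<kappa>) + ennreal (1 / \<kappa>) * (24 ^ Suc n * D (r i) (r j)))" for g h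
    unfolding box_converges_def
  proof (intro allI impI)
    fix \<rho> S :: real assume \<rho>: "\<rho> \<ge> 0" and "S \<ge> 0"
    obtain n where n: "S \<le> real n * T" using bigN by blast
    show "(\<lambda>j. box_integral \<rho> S (\<lambda>s x. cmod (g j s x - h s x))) \<longlonglongrightarrow> 0"
    proof (rule ennreal_tendsto_0I)
      fix e :: real assume e: "e > 0"
      have frac: "real n * (e / (2 * (real n + 1))) \<le> e / 2" using e by (simp add: field_simps)
      have \<rho>T: "\<rho> + T > 0" using \<rho> T(1) by simp
      \<comment> \<open>The same two-step choice of constants for the bound over \<open>n\<close> windows.\<close>
      define \<kappa> where "\<kappa> = e / (4 * (real n + 1) * (\<rho> + T))"
      have \<kappa>: "\<kappa> > 0" using e \<rho>T by (simp add: \<kappa>_def)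
      have half1: "real n * (2 * (\<rho> + T) * \<kappa>) \<le> e / 2"
      proof -
        have "2 * P * (e / (4 * Q * P)) = e / (2 * Q)" if "P > 0" "Q > 0" for P Q :: real
          using that by (simp add: field_simps)
        from this[OF \<rho>T, of "real n + 1"] have "2 * (\<rho> + T) * \<kappa> = e / (2 * (real n + 1))" by (simp add: \<kappa>_def)
        thus ?thesis using frac by (simp only:)
      qed
      define \<eta> where "\<eta> = \<kappa> * e / (2 * (real n + 1) * 24 ^ Suc n)"
      have \<eta>: "\<eta> > 0" using \<kappa> e by (simp add: \<eta>_def)
      have half2: "real n * (1 / \<kappa> * (24 ^ Suc n * \<eta>)) \<le> e / 2"
      proof -
        have "1 / \<kappa> * (24 ^ Suc n * \<eta>) = e / (2 * (real n + 1))"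
          unfolding \<eta>_def using \<kappa> by (simp del: power_Suc)
        thus ?thesis using frac by (simp only:)
      qed
      obtain N where N: "N \<ge> 1" "\<And>k l. k \<ge> N \<Longrightarrow> l \<ge> N \<Longrightarrow> D k l \<le> ennreal \<eta>"
        using cauchy[OF \<eta>] by (auto simp: D_def)
      have pair: "box_integral \<rho> S (\<lambda>s x. cmod (g i s x - g j s x)) \<le> ennreal e" if ij: "i \<ge> N" "j \<ge> N" for i j
      proof -
        have "box_integral \<rho> S (\<lambda>s x. cmod (g i s x - g j s x)) \<le> box_integral \<rho> (real n * T) (\<lambda>s x. cmod (g i s x - g j s x))"
          by (rule bmono[OF n])
        also have "\<dots> \<le> of_nat n * (ennreal (2 * (\<rho> + T) * \<kappa>) + ennreal (1 / \<kappa>) * (24 ^ Suc n * D (r i) (r j)))"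
          by (rule bound[OF \<kappa> \<rho>])
        also have "\<dots> \<le> of_nat n * (ennreal (2 * (\<rho> + T) * \<kappa>) + ennreal (1 / \<kappa>) * (24 ^ Suc n * ennreal \<eta>))"
          using ij rj[of i] rj[of j] by (intro mult_left_mono add_left_mono N) auto
        also have "\<dots> = ennreal (real n * (2 * (\<rho> + T) * \<kappa>) + real n * (1 / \<kappa> * (24 ^ Suc n * \<eta>)))"
        proof -
          have "ennreal (1 / \<kappa>) * (24 ^ Suc n * ennreal \<eta>) = ennreal (1 / \<kappa> * (24 ^ Suc n * \<eta>))"
          proof -
            have "24 ^ Suc n * ennreal \<eta> = ennreal (24 ^ Suc n * \<eta>)"
              unfolding p24 using \<eta> by (intro ennreal_mult[symmetric]) auto
            thus ?thesis using \<kappa> \<eta> by (simp only:) (intro ennreal_mult[symmetric], auto)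
          qed
          moreover have "ennreal (2 * (\<rho> + T) * \<kappa>) + ennreal (1 / \<kappa> * (24 ^ Suc n * \<eta>)) = ennreal (2 * (\<rho> + T) * \<kappa> + 1 / \<kappa> * (24 ^ Suc n * \<eta>))"
            using \<kappa> \<eta> \<rho>T by (intro ennreal_plus[symmetric]) auto
          moreover have "of_nat n * ennreal (2 * (\<rho> + T) * \<kappa> + 1 / \<kappa> * (24 ^ Suc n * \<eta>)) = ennreal (real n * (2 * (\<rho> + T) * \<kappa> + 1 / \<kappa> * (24 ^ Suc n * \<eta>)))"
            using \<kappa> \<eta> \<rho>T by (subst ennreal_mult) (auto simp: ennreal_of_nat_eq_real_of_nat)
          ultimately show ?thesis by (simp only: distrib_left)
        qed
        also have "\<dots> \<le> ennreal e" using half1 half2 by (intro ennreal_leI) linarith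
        finally show ?thesis .
      qed
      show "\<forall>\<^sub>F j in sequentially. box_integral \<rho> S (\<lambda>s x. cmod (g j s x - h s x)) \<le> ennreal e"
      proof (rule eventually_sequentiallyI[of N])
        fix i assume i: "N \<le> i"
        show "box_integral \<rho> S (\<lambda>s x. cmod (g i s x - h s x)) \<le> ennreal e"
          by (rule boxF[OF mg[of i] mg lim]) (use pair[OF i] in \<open>auto intro: eventually_sequentiallyI\<close>)
      qed
    qed
  qed
  have cG: "continuous_on UNIV (\<lambda>p. G1 (U (r j)) (V (r j)) (fst p) (snd p))" "continuous_on UNIV (\<lambda>p. G2 (U (r j)) (V (r j)) (fst p) (snd p))" for j
    using solD(3,4)[OF sr[of j]] by (simp_all add: case_prod_unfold)
  have limG: "AE x in lborel. (\<lambda>j. G1 (U (r j)) (V (r j)) t x) \<longlonglongrightarrow> G1 u v t x" "AE x in lborel. (\<lambda>j. G2 (U (r j)) (V (r j)) t x) \<longlonglongrightarrow> G2 u v t x" if "t \<ge> 0" for t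
  proof -
    have 1: "AE x in lborel. (\<lambda>j. U (r j) t x) \<longlonglongrightarrow> u t x \<and> (\<lambda>j. V (r j) t x) \<longlonglongrightarrow> v t x"
      using ae[OF that] by eventually_elim simp
    show "AE x in lborel. (\<lambda>j. G1 (U (r j)) (V (r j)) t x) \<longlonglongrightarrow> G1 u v t x"
      using 1 by eventually_elim (auto simp: rhs_def N1_def intro!: tendsto_intros)
    show "AE x in lborel. (\<lambda>j. G2 (U (r j)) (V (r j)) t x) \<longlonglongrightarrow> G2 u v t x"
      using 1 by eventually_elim (auto simp: rhs_def N1_def intro!: tendsto_intros)
  qed
  show ?thesis
  proof (rule that[of r u v])
    show "box_converges (\<lambda>j. U (r j)) u" by (rule bu) (use unif mk msl in blast)+
    show "box_converges (\<lambda>j. V (r j)) v" by (rule bu) (use unif mk msl in blast)+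
    show "box_converges (\<lambda>j. G1 (U (r j)) (V (r j))) (G1 u v)"
      by (rule bg) (use cG limG box_integral_deviation(1)[OF sr sr smr smr] in \<open>auto simp: D_def intro: borel_measurable_continuous_onI\<close>)
    show "box_converges (\<lambda>j. G2 (U (r j)) (V (r j))) (G2 u v)"
      by (rule bg) (use cG limG box_integral_deviation(2)[OF sr sr smr smr] in \<open>auto simp: D_def intro: borel_measurable_continuous_onI\<close>)
  qed (use r(2) mu unif in auto)
qed

end

section \<open>The limit is a weak solution\<close>

lemma power2_sum_le: "a\<^sup>2 + b\<^sup>2 \<le> (a + b)\<^sup>2" if "0 \<le> a" "0 \<le> b" for a b :: real
  using that by (simp add: power2_sum)

lemma L2_norm_minus_commute: "L2_norm (\<lambda>x. f x - g x) = L2_norm (\<lambda>x. g x - f x)"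
  by (simp add: L2_norm_def norm_minus_commute)

lemma L2_norm_diff_triangle_power2:
  assumes "f \<in> L2" "g \<in> L2" "h \<in> L2"
  shows "(L2_norm (\<lambda>x. f x - h x))\<^sup>2 \<le> 2 * (L2_norm (\<lambda>x. f x - g x))\<^sup>2 + 2 * (L2_norm (\<lambda>x. g x - h x))\<^sup>2"
  using L2_norm_add_power2[OF L2_diff[OF assms(1,2)] L2_diff[OF assms(2,3)]] by simp

lemma L2_norm_diff_cong_AE:
  assumes "AE x in lebesgue. f x = f' x" "AE x in lebesgue. g x = g' x" "f \<in> L2" "g \<in> L2"
  shows "L2_norm (\<lambda>x. f x - g x) = L2_norm (\<lambda>x. f' x - g' x)"
proof (rule L2_norm_cong_AE)
  show "AE x in lebesgue. f x - g x = f' x - g' x" using assms(1,2) by eventually_elim simp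
  show "(\<lambda>x. f x - g x) \<in> borel_measurable lebesgue" using L2D(1)[OF L2_diff[OF assms(3,4)]] .
qed

text \<open>The usual three-term estimate, with squares: twice applying \<open>(a + b)\<^sup>2 \<le> 2
  a\<^sup>2 + 2 b\<^sup>2\<close> to three pieces of size \<open>\<eta>\<close> gives
  \<open>10 \<eta>\<close>.\<close>
lemma uniform_L2_limit:
  fixes f :: "nat \<Rightarrow> real \<Rightarrow> real \<Rightarrow> complex" and h :: "real \<Rightarrow> real \<Rightarrow> complex"
  assumes f: "\<And>k. k \<ge> 1 \<Longrightarrow> f k \<in> cont_time L2 L2_norm"
    and h: "\<And>t. t \<ge> 0 \<Longrightarrow> h t \<in> L2"
    and unif: "\<And>S e. e > 0 \<Longrightarrow> \<exists>N\<ge>1. \<forall>k\<ge>N. \<forall>t\<in>{0..S}. (L2_norm (\<lambda>x. f k t x - h t x))\<^sup>2 \<le> e"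
  shows "h \<in> cont_time L2 L2_norm"
    and "T \<ge> 0 \<Longrightarrow> (\<lambda>k. C_L2_norm T (\<lambda>t x. f k t x - h t x)) \<longlonglongrightarrow> 0"
proof -
  have fL: "f k t \<in> L2" if "k \<ge> 1" "t \<ge> 0" for k t using f[OF that(1)] that(2) by (auto simp: cont_time_def)
  have "((\<lambda>s. L2_norm (\<lambda>x. h s x - h t x)) \<longlongrightarrow> 0) (at t within {0..})" if t: "t \<ge> 0" for t
  proof (rule tendstoI)
    fix e :: real assume e: "e > 0"
    \<comment> \<open>Any number above 10 in the denominator gives a strict inequality.\<close>
    define \<eta> where "\<eta> = e\<^sup>2 / 11"
    have \<eta>: "\<eta> > 0" using e by (simp add: \<eta>_def)
    obtain N where N: "N \<ge> 1" "\<And>s. s \<in> {0..t + 1} \<Longrightarrow> (L2_norm (\<lambda>x. f N s x - h s x))\<^sup>2 \<le> \<eta>"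
      using unif[OF \<eta>, of "t + 1"] by blast
    have "((\<lambda>s. L2_norm (\<lambda>x. f N s x - f N t x)) \<longlongrightarrow> 0) (at t within {0..})"
      using f[OF N(1)] t by (auto simp: cont_time_def)
    hence "\<forall>\<^sub>F s in at t within {0..}. L2_norm (\<lambda>x. f N s x - f N t x) < sqrt \<eta>"
      using \<eta> by (intro order_tendstoD) auto
    moreover have "\<forall>\<^sub>F s in at t within {0..}. s \<in> {0..t + 1}"
      unfolding eventually_at by (intro exI[of _ 1]) (auto simp: dist_real_def)
    ultimately show "\<forall>\<^sub>F s in at t within {0..}. dist (L2_norm (\<lambda>x. h s x - h t x)) 0 < e"
    proof eventually_elim
      case (elim s)
      hence s0: "s \<ge> 0" by simp
      have "(L2_norm (\<lambda>x. f N s x - f N t x))\<^sup>2 \<le> (sqrt \<eta>)\<^sup>2"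
        using elim(1) L2_norm_nonneg by (intro power_mono) auto
      hence mid: "(L2_norm (\<lambda>x. f N s x - f N t x))\<^sup>2 \<le> \<eta>" using \<eta> by simp
      have "(L2_norm (\<lambda>x. h s x - h t x))\<^sup>2 \<le> 2 * (L2_norm (\<lambda>x. h s x - f N s x))\<^sup>2 + 2 * (L2_norm (\<lambda>x. f N s x - h t x))\<^sup>2"
        by (intro L2_norm_diff_triangle_power2 h fL N s0 t)
      also have "\<dots> \<le> 2 * (L2_norm (\<lambda>x. f N s x - h s x))\<^sup>2 + 2 * (2 * (L2_norm (\<lambda>x. f N s x - f N t x))\<^sup>2 + 2 * (L2_norm (\<lambda>x. f N t x - h t x))\<^sup>2)"
        using L2_norm_diff_triangle_power2[OF fL[OF N(1) s0] fL[OF N(1) t] h[OF t]]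
        by (simp add: L2_norm_minus_commute[of "h s"])
      also have "\<dots> \<le> 10 * \<eta>" using N(2)[OF elim(2)] N(2)[of t] mid t by simp
      also have "\<dots> < e\<^sup>2" using e by (simp add: \<eta>_def)
      finally have "L2_norm (\<lambda>x. h s x - h t x) < e" using e by (simp add: power_less_imp_less_base)
      thus ?case using L2_norm_nonneg[of "\<lambda>x. h s x - h t x"] by simp
    qed
  qed
  thus "h \<in> cont_time L2 L2_norm" using h by (auto simp: cont_time_def)
  show "(\<lambda>k. C_L2_norm T (\<lambda>t x. f k t x - h t x)) \<longlonglongrightarrow> 0" if T: "T \<ge> 0"
  proof (rule LIMSEQ_I)
    fix e :: real assume e: "e > 0"
    have "(e / 2)\<^sup>2 > 0" using e by simp
    from unif[OF this, of T] obtain N where N: "\<And>k t. k \<ge> N \<Longrightarrow> t \<in> {0..T} \<Longrightarrow> (L2_norm (\<lambda>x. f k t x - h t x))\<^sup>2 \<le> (e / 2)\<^sup>2"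
      by blast
    have "norm (C_L2_norm T (\<lambda>t x. f k t x - h t x) - 0) < e" if k: "k \<ge> N" for k
    proof -
      have b: "L2_norm (\<lambda>x. f k t x - h t x) \<le> e / 2" if "t \<in> {0..T}" for t
        by (rule power2_le_imp_le[OF N[OF k that]]) (use e in simp)
      have "C_L2_norm T (\<lambda>t x. f k t x - h t x) \<le> e / 2"
        unfolding C_L2_norm_def using T b by (intro cSUP_least) auto
      moreover have "0 \<le> C_L2_norm T (\<lambda>t x. f k t x - h t x)"
        unfolding C_L2_norm_def
        by (rule cSUP_upper2[of _ _ 0]) (use T L2_norm_nonneg in \<open>auto intro!: bdd_aboveI2[where M = "e / 2"] b\<close>)
      ultimately show ?thesis using e by simp
    qed
    thus "\<exists>N. \<forall>k\<ge>N. norm (C_L2_norm T (\<lambda>t x. f k t x - h t x) - 0) < e" by blast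
  qed
qed

lemma half_plane_integral_eq:
  fixes F :: "real \<times> real \<Rightarrow> complex"
  assumes [measurable]: "F \<in> borel_measurable borel" and "\<And>p. p \<notin> half_plane \<Longrightarrow> F p = 0"
  shows "(LINT p:half_plane|lebesgue. F p) = (\<integral>p. F p \<partial>lborel)"
proof -
  have "(\<lambda>p. indicator half_plane p *\<^sub>R F p) = F" using assms(2) by (auto simp: indicator_def)
  thus ?thesis by (simp add: set_lebesgue_integral_def integral_completion)
qed

lemma box_finite_imp_locally_integrable:
  fixes f :: "real \<Rightarrow> real \<Rightarrow> complex"
  assumes m[measurable]: "(\<lambda>p. f (fst p) (snd p)) \<in> borel_measurable borel"
    and fin: "\<And>\<rho> S. \<rho> \<ge> 0 \<Longrightarrow> S \<ge> 0 \<Longrightarrow> box_integral \<rho> S (\<lambda>s x. cmod (f s x)) < top"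
  shows "locally_integrable_on (\<lambda>(t, x). f t x) half_plane"
  unfolding locally_integrable_on_def
proof (intro allI impI, elim conjE)
  fix K :: "(real \<times> real) set" assume K: "compact K" "K \<subseteq> half_plane"
  have [measurable]: "K \<in> sets borel" using K(1) by (simp add: compact_imp_closed)
  obtain M where M: "M > 0" "\<And>p. p \<in> K \<Longrightarrow> norm p \<le> M"
    using compact_imp_bounded[OF K(1)] by (auto simp: bounded_pos)
  have inK: "p \<in> {0..M} \<times> {-M..M}" if "p \<in> K" for p
  proof -
    have "fst p > 0" using K(2) that by (auto simp: half_plane_def)
    moreover have "\<bar>fst p\<bar> \<le> M" "\<bar>snd p\<bar> \<le> M"
      using M(2)[OF that] norm_fst_le[of "fst p" "snd p"] norm_snd_le[of "snd p" "fst p"] by auto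
    ultimately show ?thesis by (cases p) auto
  qed
  have "integrable lborel (\<lambda>p. indicator K p *\<^sub>R f (fst p) (snd p))"
  proof (rule integrableI_bounded)
    have "(\<integral>\<^sup>+p. ennreal (norm (indicator K p *\<^sub>R f (fst p) (snd p))) \<partial>lborel)
       \<le> (\<integral>\<^sup>+p. ennreal (cmod (f (fst p) (snd p))) * indicator ({0..M} \<times> {-M..M}) p \<partial>lborel)"
      by (rule nn_integral_mono) (use inK in \<open>auto simp: indicator_def\<close>)
    also have "\<dots> = box_integral M M (\<lambda>s x. cmod (f s x))"
      by (rule box_integral_eq_nn_integral[symmetric]) measurable
    also have "\<dots> < \<infinity>" using fin[of M M] M(1) by simp
    finally show "(\<integral>\<^sup>+p. ennreal (norm (indicator K p *\<^sub>R f (fst p) (snd p))) \<partial>lborel) < \<infinity>" .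
  qed measurable
  hence "integrable lebesgue (\<lambda>p. indicator K p *\<^sub>R f (fst p) (snd p))"
    by (subst integrable_completion) auto
  thus "(\<lambda>(t, x). f t x) absolutely_integrable_on K"
    by (simp add: set_integrable_def case_prod_unfold)
qed

context small_window
begin

lemma box_integral_add_finite:
  fixes f g h :: "real \<Rightarrow> real \<Rightarrow> complex"
  assumes [measurable]: "(\<lambda>p. f (fst p) (snd p)) \<in> borel_measurable borel" "(\<lambda>p. g (fst p) (snd p)) \<in> borel_measurable borel"
     "(\<lambda>p. h (fst p) (snd p)) \<in> borel_measurable borel"
    and le: "\<And>s x. cmod (h s x) \<le> a * cmod (f s x) + cmod (g s x)" and a: "a \<ge> 0"
    and fin: "box_integral \<rho> S (\<lambda>s x. cmod (f s x)) < top" "box_integral \<rho> S (\<lambda>s x. cmod (g s x)) < top"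
  shows "box_integral \<rho> S (\<lambda>s x. cmod (h s x)) < top"
proof -
  let ?I = "indicator ({0..S} \<times> {-\<rho>..\<rho>}) :: real \<times> real \<Rightarrow> ennreal"
  have [measurable]: "?I \<in> borel_measurable borel" by (simp add: closed_Times borel_closed)
  have "box_integral \<rho> S (\<lambda>s x. cmod (h s x)) = (\<integral>\<^sup>+p. ennreal (cmod (h (fst p) (snd p))) * ?I p \<partial>lborel)"
    by (rule box_integral_eq_nn_integral) measurable
  also have "\<dots> \<le> (\<integral>\<^sup>+p. ennreal a * (ennreal (cmod (f (fst p) (snd p))) * ?I p) + ennreal (cmod (g (fst p) (snd p))) * ?I p \<partial>lborel)"
  proof (rule nn_integral_mono)
    fix p
    have "ennreal (cmod (h (fst p) (snd p))) \<le> ennreal a * ennreal (cmod (f (fst p) (snd p))) + ennreal (cmod (g (fst p) (snd p)))"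
      using le[of "fst p" "snd p"] a by (simp add: ennreal_leI flip: ennreal_plus ennreal_mult)
    thus "ennreal (cmod (h (fst p) (snd p))) * ?I p \<le> ennreal a * (ennreal (cmod (f (fst p) (snd p))) * ?I p) + ennreal (cmod (g (fst p) (snd p))) * ?I p"
      by (simp add: indicator_def)
  qed
  also have "\<dots> = (\<integral>\<^sup>+p. ennreal a * (ennreal (cmod (f (fst p) (snd p))) * ?I p) \<partial>lborel) + (\<integral>\<^sup>+p. ennreal (cmod (g (fst p) (snd p))) * ?I p \<partial>lborel)"
    by (rule nn_integral_add) measurable
  also have "\<dots> = ennreal a * (\<integral>\<^sup>+p. ennreal (cmod (f (fst p) (snd p))) * ?I p \<partial>lborel) + (\<integral>\<^sup>+p. ennreal (cmod (g (fst p) (snd p))) * ?I p \<partial>lborel)"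
  proof -
    have "(\<integral>\<^sup>+p. ennreal a * (ennreal (cmod (f (fst p) (snd p))) * ?I p) \<partial>lborel) = ennreal a * (\<integral>\<^sup>+p. ennreal (cmod (f (fst p) (snd p))) * ?I p \<partial>lborel)"
      by (rule nn_integral_cmult) measurable
    thus ?thesis by (simp only:)
  qed
  also have "\<dots> = ennreal a * box_integral \<rho> S (\<lambda>s x. cmod (f s x)) + box_integral \<rho> S (\<lambda>s x. cmod (g s x))"
    by (simp add: box_integral_eq_nn_integral)
  also have "\<dots> < top" using fin by (simp add: ennreal_mult_less_top)
  finally show ?thesis .
qed

text \<open>The weak transport equations pass to the limit; multiplied by \<open>\<i>\<close> they are
  those of the system. The cubic terms are locally integrable because they differ from
  \<open>\<i>\<close> times the right-hand sides only by the mass terms.\<close>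
lemma weak_solution_of_limit:
  assumes s: "\<And>j. sol (U j) (V j)"
    and ct: "u \<in> cont_time L2 L2_norm" "v \<in> cont_time L2 L2_norm"
    and mu: "(\<lambda>p. u (fst p) (snd p)) \<in> borel_measurable borel" "(\<lambda>p. v (fst p) (snd p)) \<in> borel_measurable borel"
    and bc: "box_converges U u" "box_converges V v"
      "box_converges (\<lambda>j. G1 (U j) (V j)) (G1 u v)" "box_converges (\<lambda>j. G2 (U j) (V j)) (G2 u v)"
  shows "weak_solution m \<alpha> \<beta> u v"
proof -
  note [measurable] = mu
  note d = solD[OF s]
  have mG[measurable]: "(\<lambda>p. G1 u v (fst p) (snd p)) \<in> borel_measurable borel" "(\<lambda>p. G2 u v (fst p) (snd p)) \<in> borel_measurable borel"
  proof -
    have *: "(\<lambda>p. rhs m \<gamma> (a p) (b p)) \<in> borel_measurable borel"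
      if "a \<in> borel_measurable borel" "b \<in> borel_measurable borel" for \<gamma> and a b :: "real \<times> real \<Rightarrow> complex"
      using borel_measurable_continuous_Pair[OF that, of "\<lambda>a b. rhs m \<gamma> a b"]
      by (simp add: case_prod_unfold continuous_on_rhs continuous_on_fst continuous_on_snd)
    show "(\<lambda>p. G1 u v (fst p) (snd p)) \<in> borel_measurable borel" "(\<lambda>p. G2 u v (fst p) (snd p)) \<in> borel_measurable borel"
      by (intro * mu)+
  qed
  have N: "N1 \<alpha> a b = of_real m * b + \<i> * rhs m \<alpha> a b" "N2 \<beta> a b = of_real m * a + \<i> * rhs m \<beta> b a" for a b
    by (simp_all add: rhs_def N2_eq_N1 algebra_simps)
  have mN[measurable]: "(\<lambda>p. N1 \<alpha> (u (fst p) (snd p)) (v (fst p) (snd p))) \<in> borel_measurable borel"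
    "(\<lambda>p. N2 \<beta> (u (fst p) (snd p)) (v (fst p) (snd p))) \<in> borel_measurable borel"
    unfolding N by measurable
  have fin: "box_integral \<rho> S (\<lambda>s x. cmod (u s x)) < top" "box_integral \<rho> S (\<lambda>s x. cmod (v s x)) < top"
     "box_integral \<rho> S (\<lambda>s x. cmod (G1 u v s x)) < top" "box_integral \<rho> S (\<lambda>s x. cmod (G2 u v s x)) < top"
    if "\<rho> \<ge> 0" "S \<ge> 0" for \<rho> S
    using box_converges_limit_finite[OF d(1) mu(1) bc(1) that] box_converges_limit_finite[OF d(2) mu(2) bc(2) that]
      box_converges_limit_finite[OF d(3) mG(1) bc(3) that] box_converges_limit_finite[OF d(4) mG(2) bc(4) that] .
  have loc1: "locally_integrable_on (\<lambda>(t, x). N1 \<alpha> (u t x) (v t x)) half_plane"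
  proof (rule box_finite_imp_locally_integrable[OF mN(1)])
    fix \<rho> S :: real assume \<rho>S: "\<rho> \<ge> 0" "S \<ge> 0"
    show "box_integral \<rho> S (\<lambda>s x. cmod (N1 \<alpha> (u s x) (v s x))) < top"
    proof (rule box_integral_add_finite[OF mu(2) mG(1) mN(1) _ m fin(2)[OF \<rho>S] fin(3)[OF \<rho>S]])
      fix s x show "cmod (N1 \<alpha> (u s x) (v s x)) \<le> m * cmod (v s x) + cmod (G1 u v s x)"
        unfolding N using m by (intro order_trans[OF norm_triangle_ineq]) (simp add: norm_mult)
    qed
  qed
  have loc2: "locally_integrable_on (\<lambda>(t, x). N2 \<beta> (u t x) (v t x)) half_plane"
  proof (rule box_finite_imp_locally_integrable[OF mN(2)])
    fix \<rho> S :: real assume \<rho>S: "\<rho> \<ge> 0" "S \<ge> 0"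
    show "box_integral \<rho> S (\<lambda>s x. cmod (N2 \<beta> (u s x) (v s x))) < top"
    proof (rule box_integral_add_finite[OF mu(1) mG(2) mN(2) _ m fin(1)[OF \<rho>S] fin(4)[OF \<rho>S]])
      fix s x show "cmod (N2 \<beta> (u s x) (v s x)) \<le> m * cmod (u s x) + cmod (G2 u v s x)"
        unfolding N using m by (intro order_trans[OF norm_triangle_ineq]) (simp add: norm_mult)
    qed
  qed
  have meas: "(\<lambda>(t, x). f t x) \<in> borel_measurable (lebesgue_on half_plane)"
    if "(\<lambda>p. f (fst p) (snd p)) \<in> borel_measurable borel" for f :: "real \<Rightarrow> real \<Rightarrow> complex"
    using that by (intro measurable_restrict_space1) (simp add: case_prod_unfold measurable_completion)
  have weak: "(LINT (t, x):half_plane|lebesgue. - \<i> * w t x * (deriv_t \<phi> (t, x) + of_real \<sigma> * deriv_x \<phi> (t, x)))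
      = (LINT (t, x):half_plane|lebesgue. (\<i> * g t x) * \<phi> (t, x))"
    if \<phi>: "\<phi> \<in> test_functions half_plane" and \<sigma>: "\<bar>\<sigma>\<bar> = 1"
      and tr: "\<And>j. transported \<sigma> (W j) (F j)" and cW: "\<And>j. continuous_on UNIV (\<lambda>(t, x). W j t x)"
      and cF: "\<And>j. continuous_on UNIV (\<lambda>(t, x). F j t x)"
      and mw: "(\<lambda>p. w (fst p) (snd p)) \<in> borel_measurable borel" and mg: "(\<lambda>p. g (fst p) (snd p)) \<in> borel_measurable borel"
      and conv: "box_converges W w" "box_converges F g" for \<phi> \<sigma> W F w g
  proof -
    obtain S \<rho> where c: "continuous_on UNIV \<phi>" "continuous_on UNIV (deriv_t \<phi>)" "continuous_on UNIV (deriv_x \<phi>)"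
      and out: "\<And>p. p \<notin> half_plane \<Longrightarrow> \<phi> p = 0 \<and> deriv_t \<phi> p = 0 \<and> deriv_x \<phi> p = 0"
      by (rule half_plane_test_function[OF \<phi>]) (rule that)
    have [measurable]: "\<phi> \<in> borel_measurable borel" "deriv_t \<phi> \<in> borel_measurable borel" "deriv_x \<phi> \<in> borel_measurable borel"
      by (intro borel_measurable_continuous_onI c)+
    note [measurable] = mw mg
    note L = weak_equation_limit[OF tr cW cF \<sigma> mw mg conv \<phi>]
    have "(LINT (t, x):half_plane|lebesgue. - \<i> * w t x * (deriv_t \<phi> (t, x) + of_real \<sigma> * deriv_x \<phi> (t, x)))
       = (LINT p:half_plane|lebesgue. - \<i> * (w (fst p) (snd p) * (deriv_t \<phi> p + of_real \<sigma> * deriv_x \<phi> p)))"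
      by (simp add: case_prod_unfold mult.assoc)
    also have "\<dots> = (\<integral>p. - \<i> * (w (fst p) (snd p) * (deriv_t \<phi> p + of_real \<sigma> * deriv_x \<phi> p)) \<partial>lborel)"
      by (rule half_plane_integral_eq) (measurable, use out in auto)
    also have "\<dots> = - \<i> * (\<integral>p. w (fst p) (snd p) * (deriv_t \<phi> p + of_real \<sigma> * deriv_x \<phi> p) \<partial>lborel)"
      by (rule Bochner_Integration.integral_mult_right_zero)
    also have "\<dots> = \<i> * (\<integral>p. g (fst p) (snd p) * \<phi> p \<partial>lborel)"
      using L(3) by (simp add: eq_neg_iff_add_eq_0[symmetric])
    also have "\<dots> = (\<integral>p. \<i> * (g (fst p) (snd p) * \<phi> p) \<partial>lborel)"
      by (rule Bochner_Integration.integral_mult_right_zero[symmetric])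
    also have "\<dots> = (LINT p:half_plane|lebesgue. \<i> * (g (fst p) (snd p) * \<phi> p))"
      by (rule half_plane_integral_eq[symmetric]) (measurable, use out in auto)
    also have "\<dots> = (LINT (t, x):half_plane|lebesgue. (\<i> * g t x) * \<phi> (t, x))"
      by (simp add: case_prod_unfold mult.assoc)
    finally show ?thesis .
  qed
  show ?thesis unfolding weak_solution_def
  proof (intro conjI ballI ct loc1 loc2 meas mu)
    fix \<phi> assume \<phi>: "\<phi> \<in> test_functions half_plane"
    have 1: "\<i> * rhs m \<alpha> a b = - of_real m * b + N1 \<alpha> a b" "\<i> * rhs m \<beta> b a = - of_real m * a + N2 \<beta> a b" for a b
      by (simp_all add: N)
    show "(LINT (t, x):half_plane|lebesgue. - \<i> * u t x * (deriv_t \<phi> (t, x) + deriv_x \<phi> (t, x)))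
          = (LINT (t, x):half_plane|lebesgue. (- of_real m * v t x + N1 \<alpha> (u t x) (v t x)) * \<phi> (t, x))"
      using weak[OF \<phi> _ d(5) d(1) d(3) mu(1) mG(1) bc(1,3)] unfolding 1 by simp
    show "(LINT (t, x):half_plane|lebesgue. - \<i> * v t x * (deriv_t \<phi> (t, x) - deriv_x \<phi> (t, x)))
          = (LINT (t, x):half_plane|lebesgue. (- of_real m * u t x + N2 \<beta> (u t x) (v t x)) * \<phi> (t, x))"
      using weak[OF \<phi> _ d(6) d(2) d(4) mu(2) mG(2) bc(2,4)] unfolding 1 by simp
  qed
qed

end

lemma H1_cont_time_imp_L2: "u \<in> cont_time H1 H1_norm \<Longrightarrow> u \<in> cont_time L2 L2_norm"
  unfolding cont_time_def
proof (clarify, intro conjI)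
  fix t :: real assume u: "\<forall>t\<ge>0. u t \<in> H1 \<and> ((\<lambda>s. H1_norm (\<lambda>x. u s x - u t x)) \<longlongrightarrow> 0) (at t within {0..})" and t: "0 \<le> t"
  show "u t \<in> L2" using u t by (auto simp: H1_def)
  show "((\<lambda>s. L2_norm (\<lambda>x. u s x - u t x)) \<longlongrightarrow> 0) (at t within {0..})"
    by (rule tendsto_sandwich[where f = "\<lambda>s. 0" and h = "\<lambda>s. H1_norm (\<lambda>x. u s x - u t x)"])
      (use u t in \<open>auto simp: L2_norm_nonneg L2_norm_le_H1_norm\<close>)
qed

theorem theorem1p2:
  fixes m :: real and \<alpha> \<beta> :: "nat \<Rightarrow> complex"
  assumes "m \<ge> 0"
    and "\<And>u v :: complex. Re (\<i> * cnj u * N1 \<alpha> u v + \<i> * cnj v * N2 \<beta> u v) = 0"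
  shows "\<exists>C0::real. C0 > 0 \<and>
    (\<forall>(u0 :: nat \<Rightarrow> real \<Rightarrow> complex) (v0 :: nat \<Rightarrow> real \<Rightarrow> complex)
      (u0_inf :: real \<Rightarrow> complex) (v0_inf :: real \<Rightarrow> complex)
      (u :: nat \<Rightarrow> real \<Rightarrow> real \<Rightarrow> complex) (v :: nat \<Rightarrow> real \<Rightarrow> real \<Rightarrow> complex).
      (\<forall>k\<ge>1. u0 k \<in> H1 \<and> v0 k \<in> H1 \<and> (L2_norm (u0 k))\<^sup>2 + (L2_norm (v0 k))\<^sup>2 \<le> C0) \<and>
      u0_inf \<in> L2 \<and> v0_inf \<in> L2 \<and>
      ((\<lambda>k. L2_norm (\<lambda>x. u0 k x - u0_inf x) + L2_norm (\<lambda>x. v0 k x - v0_inf x))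
         \<longlonglongrightarrow> 0) \<and>
      (\<forall>k\<ge>1. classical_solution m \<alpha> \<beta> (u0 k) (v0 k) (u k) (v k))
      \<longrightarrow>
      (\<exists>u_inf v_inf. weak_solution m \<alpha> \<beta> u_inf v_inf \<and>
         (\<forall>T\<ge>0. (\<lambda>k. C_L2_norm T (\<lambda>t x. u k t x - u_inf t x)
                   + C_L2_norm T (\<lambda>t x. v k t x - v_inf t x)) \<longlonglongrightarrow> 0)))"
proof -
  \<comment> \<open>The added 1 makes \<open>c\<close> positive. With \<open>c \<epsilon> = 1 / 7\<close>
    and \<open>m T \<le> 1 / 7\<close> both smallness conditions hold, because \<open>12 /
    49 \<le> 1 / 4\<close>.\<close>
  define c where "c = max (cubic_const \<alpha>) (cubic_const \<beta>) + 1"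
  define \<epsilon> where "\<epsilon> = 1 / (7 * c)"
  define T where "T = 1 / (7 * (m + 1))"
  have k0: "0 \<le> cubic_const \<gamma>" for \<gamma> by (simp add: cubic_const_def)
  have c1: "c \<ge> 1" using k0[of \<alpha>] by (simp add: c_def le_max_iff_disj)
  have c\<epsilon>: "c * \<epsilon> = 1 / 7" using c1 by (simp add: \<epsilon>_def)
  have mT: "m * T \<le> 1 / 7" "0 \<le> m * T" using assms(1) by (auto simp: T_def field_simps)
  interpret small_window m \<alpha> \<beta> c \<epsilon> T
  proof
    show "12 * c\<^sup>2 * \<epsilon>\<^sup>2 \<le> 1 / 4" proof -
      have "12 * c\<^sup>2 * \<epsilon>\<^sup>2 = 12 * (c * \<epsilon>)\<^sup>2" by (simp add: power_mult_distrib)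
      also have "\<dots> \<le> 1 / 4" by (simp only: c\<epsilon>) (simp add: power2_eq_square)
      finally show ?thesis .
    qed
    show "12 * m\<^sup>2 * T\<^sup>2 \<le> 1 / 4" proof -
      have "12 * m\<^sup>2 * T\<^sup>2 = 12 * (m * T)\<^sup>2" by (simp add: power_mult_distrib)
      also have "\<dots> \<le> 12 * (1 / 7)\<^sup>2" using mT by (intro mult_left_mono power_mono) auto
      also have "\<dots> \<le> 1 / 4" by (simp add: power2_eq_square)
      finally show ?thesis .
    qed
    show "c * \<epsilon> \<le> 1" using c\<epsilon> by simp
    show "0 < \<epsilon>" "0 < T" using c1 assms(1) by (auto simp: \<epsilon>_def T_def)
  qed (use assms(1) c1 in \<open>auto simp: c_def\<close>)
  show ?thesis
  proof (intro exI[of _ "\<epsilon> / 48"] conjI allI impI, goal_cases)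
    case 1 show ?case using \<epsilon>(1) by simp
  next
    case (2 u0 v0 u0_inf v0_inf u v)
    hence init: "\<And>k. k \<ge> 1 \<Longrightarrow> u0 k \<in> H1" "\<And>k. k \<ge> 1 \<Longrightarrow> v0 k \<in> H1"
        "\<And>k. k \<ge> 1 \<Longrightarrow> (L2_norm (u0 k))\<^sup>2 + (L2_norm (v0 k))\<^sup>2 \<le> \<epsilon> / 48"
      and inf: "u0_inf \<in> L2" "v0_inf \<in> L2"
      and lim: "(\<lambda>k. L2_norm (\<lambda>x. u0 k x - u0_inf x) + L2_norm (\<lambda>x. v0 k x - v0_inf x)) \<longlonglongrightarrow> 0"
      and cls: "\<And>k. k \<ge> 1 \<Longrightarrow> classical_solution m \<alpha> \<beta> (u0 k) (v0 k) (u k) (v k)" by auto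
    have "\<forall>k\<in>{1..}. \<exists>U V. sol U V \<and> (\<forall>t\<ge>0. (AE x in lebesgue. u k t x = U t x) \<and> (AE x in lebesgue. v k t x = V t x))"
    proof
      fix k :: nat assume "k \<in> {1..}"
      hence "classical_solution m \<alpha> \<beta> (u0 k) (v0 k) (u k) (v k)" using cls by simp
      thus "\<exists>U V. sol U V \<and> (\<forall>t\<ge>0. (AE x in lebesgue. u k t x = U t x) \<and> (AE x in lebesgue. v k t x = V t x))"
        by (rule classical_solution_has_characteristic_representative) blast
    qed
    from bchoice[OF this] obtain U where "\<forall>k\<in>{1..}. \<exists>V. sol (U k) (V) \<and> (\<forall>t\<ge>0. (AE x in lebesgue. u k t x = U k t x) \<and> (AE x in lebesgue. v k t x = V t x))" ..
    from bchoice[OF this] obtain V where V: "\<forall>k\<in>{1..}. sol (U k) (V k) \<and> (\<forall>t\<ge>0. (AE x in lebesgue. u k t x = U k t x) \<and> (AE x in lebesgue. v k t x = V k t x))" ..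
    have UV: "sol (U k) (V k)" if "k \<ge> 1" for k using bspec[OF V, of k] that by simp
    have ae: "AE x in lebesgue. u k t x = U k t x" "AE x in lebesgue. v k t x = V k t x" if "k \<ge> 1" "t \<ge> 0" for k t
      using bspec[OF V, of k] that by simp_all
    have ctu: "u k \<in> cont_time L2 L2_norm" "v k \<in> cont_time L2 L2_norm" if "k \<ge> 1" for k
      using cls[OF that] by (auto simp: classical_solution_def intro: H1_cont_time_imp_L2)
    have UL: "U k t \<in> L2" "V k t \<in> L2" if "k \<ge> 1" "t \<ge> 0" for k t
      using UV[OF that(1)] that(2) by (auto simp: characteristic_solution_def)
    have U0: "AE x in lebesgue. u0 k x = U k 0 x" "AE x in lebesgue. v0 k x = V k 0 x" if "k \<ge> 1" for k
    proof -
      have "AE x in lebesgue. u k 0 x = u0 k x" using cls[OF that] by (auto simp: classical_solution_def)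
      moreover have "AE x in lebesgue. u k 0 x = U k 0 x" by (rule ae(1)[OF that order_refl])
      ultimately show "AE x in lebesgue. u0 k x = U k 0 x" by eventually_elim simp
      have "AE x in lebesgue. v k 0 x = v0 k x" using cls[OF that] by (auto simp: classical_solution_def)
      moreover have "AE x in lebesgue. v k 0 x = V k 0 x" by (rule ae(2)[OF that order_refl])
      ultimately show "AE x in lebesgue. v0 k x = V k 0 x" by eventually_elim simp
    qed
    have u0L: "u0 k \<in> L2" "v0 k \<in> L2" if "k \<ge> 1" for k using init(1,2)[OF that] by (auto simp: H1_def)
    have small: "charge_small (U k) (V k)" if "k \<ge> 1" for k
      unfolding charge_small_def
    proof (intro allI impI)
      fix t :: real assume "t \<ge> 0"
      have "(L2_norm (U k t))\<^sup>2 + (L2_norm (V k t))\<^sup>2 = (L2_norm (U k 0))\<^sup>2 + (L2_norm (V k 0))\<^sup>2"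
        by (rule charge_conservation[OF UV[OF that] assms \<open>t \<ge> 0\<close>])
      also have "\<dots> = (L2_norm (u0 k))\<^sup>2 + (L2_norm (v0 k))\<^sup>2"
        using L2_norm_cong_AE[OF U0(1)[OF that]] L2_norm_cong_AE[OF U0(2)[OF that]] u0L[OF that] by (simp add: L2D(1))
      also have "\<dots> \<le> \<epsilon> / 48" by (rule init(3)[OF that])
      finally show "(L2_norm (U k t))\<^sup>2 + (L2_norm (V k t))\<^sup>2 \<le> \<epsilon> / 48" .
    qed
    have cauchy: "\<exists>N\<ge>1. \<forall>k\<ge>N. \<forall>l\<ge>N. deviation (U k) (V k) (U l) (V l) 0 \<le> ennreal e" if e: "e > 0" for e
    proof -
      define d where "d k = L2_norm (\<lambda>x. u0 k x - u0_inf x) + L2_norm (\<lambda>x. v0 k x - v0_inf x)" for k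
      have d0: "0 \<le> d k" for k using L2_norm_nonneg by (simp add: d_def)
      have "\<forall>\<^sub>F k in sequentially. d k < sqrt e / 2" using lim e by (intro order_tendstoD) (auto simp: d_def)
      then obtain N where N: "\<And>k. k \<ge> N \<Longrightarrow> d k < sqrt e / 2" by (auto simp: eventually_sequentially)
      have dsq: "(d k)\<^sup>2 \<le> e / 4" if "k \<ge> N" for k
      proof -
        have "(d k)\<^sup>2 \<le> (sqrt e / 2)\<^sup>2" using N[OF that] d0[of k] by (intro power_mono) auto
        thus ?thesis using e by (simp add: power_divide)
      qed
      have "deviation (U k) (V k) (U l) (V l) 0 \<le> ennreal e" if kl: "k \<ge> max 1 N" "l \<ge> max 1 N" for k l
      proof -
        have k1: "k \<ge> 1" "l \<ge> 1" using kl by auto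
        have tri: "(L2_norm (\<lambda>x. A x - B x))\<^sup>2 \<le> 2 * (L2_norm (\<lambda>x. a x - z x))\<^sup>2 + 2 * (L2_norm (\<lambda>x. b x - z x))\<^sup>2"
          if "AE x in lebesgue. a x = A x" "AE x in lebesgue. b x = B x" "a \<in> L2" "b \<in> L2" "z \<in> L2"
          for A B a b z
          using L2_norm_diff_triangle_power2[OF that(3,5,4)] L2_norm_diff_cong_AE[OF that(1-4)]
          by (simp add: L2_norm_minus_commute[of z])
        note tu = tri[of "u0 k" "U k 0" "u0 l" "U l 0" "u0_inf", OF U0(1)[OF k1(1)] U0(1)[OF k1(2)] u0L(1)[OF k1(1)] u0L(1)[OF k1(2)] inf(1)]
        note tv = tri[of "v0 k" "V k 0" "v0 l" "V l 0" "v0_inf", OF U0(2)[OF k1(1)] U0(2)[OF k1(2)] u0L(2)[OF k1(1)] u0L(2)[OF k1(2)] inf(2)]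
        have sqd: "(L2_norm (\<lambda>x. u0 k x - u0_inf x))\<^sup>2 + (L2_norm (\<lambda>x. v0 k x - v0_inf x))\<^sup>2 \<le> (d k)\<^sup>2" for k
          unfolding d_def using L2_norm_nonneg by (intro power2_sum_le)
        have "(L2_norm (\<lambda>x. U k 0 x - U l 0 x))\<^sup>2 + (L2_norm (\<lambda>x. V k 0 x - V l 0 x))\<^sup>2 \<le> e"
          using tu tv sqd[of k] sqd[of l] dsq[of k] dsq[of l] kl by simp
        thus ?thesis by (simp add: deviation_eq_L2[OF UV[OF k1(1)] UV[OF k1(2)]] ennreal_leI del: ennreal_plus add: ennreal_plus[symmetric])
      qed
      thus ?thesis by (intro exI[of _ "max 1 N"]) auto
    qed
    obtain r u_inf v_inf where r: "\<And>j. 1 \<le> r j"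
      and mu: "(\<lambda>p. u_inf (fst p) (snd p)) \<in> borel_measurable borel" "(\<lambda>p. v_inf (fst p) (snd p)) \<in> borel_measurable borel"
      and unif: "\<And>n e. e > 0 \<Longrightarrow> \<exists>N\<ge>1. \<forall>k\<ge>N. \<forall>t\<in>{0..real n * T}.
        sqint (\<lambda>x. cmod (U k t x - u_inf t x)) \<le> ennreal e \<and> sqint (\<lambda>x. cmod (V k t x - v_inf t x)) \<le> ennreal e"
      and bc: "box_converges (\<lambda>j. U (r j)) u_inf" "box_converges (\<lambda>j. V (r j)) v_inf"
        "box_converges (\<lambda>j. G1 (U (r j)) (V (r j))) (G1 u_inf v_inf)" "box_converges (\<lambda>j. G2 (U (r j)) (V (r j))) (G2 u_inf v_inf)"
    proof (rule characteristic_limit[of U V], goal_cases)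
      case 1 from 1(2) show ?case by (rule UV)
    next
      case 2 from 2(2) show ?case by (rule small)
    next
      case 3 from 3(2) show ?case by (rule cauchy)
    next
      case (4 r w z)
      show ?case by (rule that[of r w z, OF 4(2-)])
    qed
    have unif': "\<exists>N\<ge>1. \<forall>k\<ge>N. \<forall>t\<in>{0..real n * T}. sqint (\<lambda>x. cmod (U k t x - u_inf t x)) \<le> ennreal e"
      "\<exists>N\<ge>1. \<forall>k\<ge>N. \<forall>t\<in>{0..real n * T}. sqint (\<lambda>x. cmod (V k t x - v_inf t x)) \<le> ennreal e" if "e > 0" for n e
      using unif[OF that, of n] by blast+
    \<comment> \<open>Translation of the convergence of the continuous representatives \<open>F\<close>,
      on multiples of \<open>T\<close> and in terms of \<open>sqint\<close>, to the given
      solutions \<open>f\<close> and \<open>L\<^sup>2\<close> norms.\<close>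
    have comp: "(\<forall>t\<ge>0. h t \<in> L2) \<and> (\<forall>S. \<forall>e>0. \<exists>N\<ge>1. \<forall>k\<ge>N. \<forall>t\<in>{0..S}. (L2_norm (\<lambda>x. f k t x - h t x))\<^sup>2 \<le> e)"
      if mh: "(\<lambda>p. h (fst p) (snd p)) \<in> borel_measurable borel"
        and cF: "\<And>k. k \<ge> 1 \<Longrightarrow> continuous_on UNIV (\<lambda>(t, x). F k t x)" and FL: "\<And>k t. k \<ge> 1 \<Longrightarrow> t \<ge> 0 \<Longrightarrow> F k t \<in> L2"
        and fF: "\<And>k t. k \<ge> 1 \<Longrightarrow> t \<ge> 0 \<Longrightarrow> AE x in lebesgue. f k t x = F k t x"
        and un: "\<And>n e. e > 0 \<Longrightarrow> \<exists>N\<ge>1. \<forall>k\<ge>N. \<forall>t\<in>{0..real n * T}. sqint (\<lambda>x. cmod (F k t x - h t x)) \<le> ennreal e"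
      for f F :: "nat \<Rightarrow> real \<Rightarrow> real \<Rightarrow> complex" and h
    proof -
      have hm: "h t \<in> borel_measurable borel" for t
      proof -
        have "(\<lambda>x. (\<lambda>p. h (fst p) (snd p)) (t, x)) \<in> borel_measurable borel"
          by (rule measurable_compose[OF _ mh]) measurable
        thus ?thesis by simp
      qed
      have Fm: "F k t \<in> borel_measurable borel" if "k \<ge> 1" for k t
        by (intro borel_measurable_continuous_onI slice_continuous cF that)
      have big: "\<exists>n::nat. S \<le> real n * T" for S
        using reals_Archimedean3[OF T(1), rule_format, of S] by (auto intro: less_imp_le)
      have dL: "(\<lambda>x. F k t x - h t x) \<in> L2" if "k \<ge> 1" "sqint (\<lambda>x. cmod (F k t x - h t x)) \<le> ennreal e" for k t e
        using that Fm[OF that(1)] hm by (intro sqint_finite_imp_L2) (auto intro: le_less_trans)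
      have hL: "h t \<in> L2" if "t \<ge> 0" for t
      proof -
        obtain n where "t \<le> real n * T" using big by blast
        with un[of 1 n] that obtain k where k: "k \<ge> 1" "sqint (\<lambda>x. cmod (F k t x - h t x)) \<le> ennreal 1" by auto
        from L2_diff[OF FL[OF k(1) that] dL[OF k]] show ?thesis by simp
      qed
      have "\<exists>N\<ge>1. \<forall>k\<ge>N. \<forall>t\<in>{0..S}. (L2_norm (\<lambda>x. f k t x - h t x))\<^sup>2 \<le> e" if e: "e > 0" for S e
      proof -
        obtain n where n: "S \<le> real n * T" using big by blast
        from un[OF e, of n] obtain N where N: "N \<ge> 1" "\<And>k t. k \<ge> N \<Longrightarrow> t \<in> {0..real n * T} \<Longrightarrow> sqint (\<lambda>x. cmod (F k t x - h t x)) \<le> ennreal e" by blast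
        have "(L2_norm (\<lambda>x. f k t x - h t x))\<^sup>2 \<le> e" if k: "k \<ge> N" and t: "t \<in> {0..S}" for k t
        proof -
          have k1: "k \<ge> 1" and t0: "t \<ge> 0" using k N(1) t by auto
          have s: "sqint (\<lambda>x. cmod (F k t x - h t x)) \<le> ennreal e" using N(2)[OF k, of t] t n by auto
          have "sqint (\<lambda>x. cmod (F k t x - h t x)) = ennreal ((L2_norm (\<lambda>x. F k t x - h t x))\<^sup>2)"
            using Fm[OF k1] hm by (intro sqint_eq_L2_norm_borel dL[OF k1 s]) auto
          hence "(L2_norm (\<lambda>x. F k t x - h t x))\<^sup>2 \<le> e" using s e by simp
          moreover have "L2_norm (\<lambda>x. F k t x - h t x) = L2_norm (\<lambda>x. f k t x - h t x)"
            by (rule L2_norm_diff_cong_AE[OF _ _ FL[OF k1 t0] hL[OF t0]]) (use fF[OF k1 t0] in \<open>auto elim: eventually_mono\<close>)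
          ultimately show ?thesis by simp
        qed
        thus ?thesis using N(1) by blast
      qed
      thus ?thesis using hL by blast
    qed
    have cu: "(\<forall>t\<ge>0. u_inf t \<in> L2) \<and> (\<forall>S. \<forall>e>0. \<exists>N\<ge>1. \<forall>k\<ge>N. \<forall>t\<in>{0..S}. (L2_norm (\<lambda>x. u k t x - u_inf t x))\<^sup>2 \<le> e)"
      by (rule comp[of u_inf U u, OF mu(1) solD(1)[OF UV] UL(1) ae(1) unif'(1)])
    have cv: "(\<forall>t\<ge>0. v_inf t \<in> L2) \<and> (\<forall>S. \<forall>e>0. \<exists>N\<ge>1. \<forall>k\<ge>N. \<forall>t\<in>{0..S}. (L2_norm (\<lambda>x. v k t x - v_inf t x))\<^sup>2 \<le> e)"
      by (rule comp[of v_inf V v, OF mu(2) solD(2)[OF UV] UL(2) ae(2) unif'(2)])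
    note lu = uniform_L2_limit[of u u_inf, OF ctu(1)] and lv = uniform_L2_limit[of v v_inf, OF ctu(2)]
    have "u_inf \<in> cont_time L2 L2_norm" "v_inf \<in> cont_time L2 L2_norm"
      using cu cv by (auto intro!: lu(1) lv(1))
    hence "weak_solution m \<alpha> \<beta> u_inf v_inf"
      by (rule weak_solution_of_limit[of "\<lambda>j. U (r j)" "\<lambda>j. V (r j)", OF UV[OF r] _ _ mu bc])
    moreover have "(\<lambda>k. C_L2_norm S (\<lambda>t x. u k t x - u_inf t x) + C_L2_norm S (\<lambda>t x. v k t x - v_inf t x)) \<longlonglongrightarrow> 0" if "S \<ge> 0" for S
    proof -
      have "(\<lambda>k. C_L2_norm S (\<lambda>t x. u k t x - u_inf t x) + C_L2_norm S (\<lambda>t x. v k t x - v_inf t x)) \<longlonglongrightarrow> 0 + 0"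
        using cu cv that by (intro tendsto_add lu(2) lv(2)) auto
      thus ?thesis by simp
    qed
    ultimately show ?case by blast
  qed
qed

end
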